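(* Let $\lambda>0$ and assume: (i) $f\in C(\mathbb{R})$; (ii) there are $p\ge2$ and constants $C_1,\dots,C_4>0$ such that $|f(u)|\le C_1+C_2|u|^{p-1}$ for all $u\in\mathbb{R}$, and moreover $f(u)u\le C_3-C_4|u|^p$ for all $u\in\mathbb{R}$ if $p>2$, while $\limsup_{u\to\pm\infty}\frac{f(u)}{u}\le0$ if $p=2$; (iii) $a\in C(\mathbb{R}^+)$ and $a(s)\ge m>0$ for all $s\ge0$; (iv) $h\in L^2(\Omega)$ is independent of time; (v) either there is $M_1>0$ with $a(s)\le M_1$ for all $s\ge0$, or $a$ is non-decreasing. Let $\mathcal{A}$ be the global attractor of the multivalued semiflow $G$ generated by the strong solutions. Then $$\mathcal{A}=M^+(\mathfrak{R})=M^-(\mathfrak{R}),$$ where $$M^+(\mathfrak{R})=\{z:\exists\gamma\in\mathbb{K},\ \gamma(0)=z,\ dist_{H_0^1}(\gamma(t),\mathfrak{R})\to0\text{ as }t\to+\infty\},$$ $$M^-(\mathfrak{R})=\{z:\exists\gamma\in\mathbb{F},\ \gamma(0)=z,\ dist_{H_0^1}(\gamma(t),\mathfrak{R})\to0\text{ as }t\to-\infty\}.$$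
   Context: $\Omega=(0,1)$, $\mathbb{R}^+=[0,\infty)$, $X=H_0^1(\Omega)$ with $\|u\|_{H_0^1}=\|u_x\|_{L^2}$, $(\cdot,\cdot)$ is the $L^2(\Omega)$ inner product. Consider the problem $$u_t-a(\|u\|_{H_0^1}^2)u_{xx}=\lambda f(u)+h,\quad t>0,\ x\in\Omega;\qquad u(t,0)=u(t,1)=0;\qquad u(0,x)=u_0(x).$$ For $u_0\in X$, a strong solution is a function $u$ with $u\in L^\infty(0,T;H_0^1(\Omega))\cap L^2(0,T;H^2(\Omega)\cap H_0^1(\Omega))$, $u_t\in L^2(0,T;L^2(\Omega))$ for any $T>0$ (hence $u\in C([0,T];H_0^1(\Omega))$), $u(0)=u_0$, and $\frac{d}{dt}(u,v)+a(\|u\|_{H_0^1}^2)(u_x,v_x)=\lambda(f(u),v)+(h,v)$ for all $v\in H_0^1(\Omega)$ in the sense of distributions in $t$. Let $\mathcal{R}$ be the set of all strong solutions and $G(t,u_0)=\{u(t):u\in\mathcal{R},\ u(0)=u_0\}$. The global attractor $\mathcal{A}$ is the compact set with $\mathcal{A}=G(t,\mathcal{A})$ for all $t\ge0$ which attracts every bounded $B\subset X$ in the Hausdorff semidistance; it exists under the stated hypotheses. A map $\phi:\mathbb{R}\to X$ is a complete trajectory of $\mathcal{R}$ if $\phi(\cdot+s)|_{[0,\infty)}\in\mathcal{R}$ for all $s\in\mathbb{R}$. $\mathbb{F}$ is the set of all complete trajectories of $\mathcal{R}$ and $\mathbb{K}$ the set of all bounded (in $X$) complete trajectories of $\mathcal{R}$.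 $\mathfrak{R}$ is the set of stationary points: all $z\in H^2(\Omega)\cap H_0^1(\Omega)$ with $-a(\|z\|_{H_0^1}^2)z''=\lambda f(z)+h$ in $L^2(\Omega)$. $dist_{H_0^1}(y,\mathfrak{R})=\inf_{z\in\mathfrak{R}}\|y-z\|_{H_0^1}$. *)

theory Defs
  imports "HOL-Analysis.Analysis" "HOL-Computational_Algebra.Polynomial"
begin

definition smooth :: "(real \<Rightarrow> real) \<Rightarrow> bool" where
  "smooth \<phi> \<longleftrightarrow> (\<forall>n x. (deriv ^^ n) \<phi> field_differentiable at x)"

definition Cc_infty :: "real set \<Rightarrow> (real \<Rightarrow> real) set" where
  "Cc_infty S = {\<phi>. smooth \<phi> \<and> (\<exists>K. compact K \<and> K \<subseteq> S \<and> (\<forall>x. x \<notin> K \<longrightarrow> \<phi> x = 0))}"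

lemma smooth_iff: "smooth f \<longleftrightarrow> (\<forall>x. f field_differentiable at x) \<and> smooth (deriv f)"
proof
  assume f: "smooth f"
  have "(deriv ^^ n) (deriv f) field_differentiable at x" for n x
    using f[unfolded smooth_def, rule_format, of "Suc n" x] by (simp only: funpow_Suc_right comp_def)
  then show "(\<forall>x. f field_differentiable at x) \<and> smooth (deriv f)"
    using f[unfolded smooth_def, rule_format, of 0] by (simp add: smooth_def)
next
  assume f: "(\<forall>x. f field_differentiable at x) \<and> smooth (deriv f)"
  have "(deriv ^^ n) f field_differentiable at x" for n x
  proof (cases n)
    case 0
    then show ?thesis using f by simp
  next
    case (Suc m)
    then show ?thesis using f unfolding smooth_def Suc funpow_Suc_right comp_def by blast
  qed
  then show "smooth f" by (simp add: smooth_def)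
qed

lemma smooth_coinduct:
  assumes "f \<in> C" and "\<And>f. f \<in> C \<Longrightarrow> (\<forall>x. f field_differentiable at x) \<and> deriv f \<in> C"
  shows "smooth f"
proof -
  have "(deriv ^^ n) f \<in> C" for n
    by (induction n) (use assms in auto)
  then show ?thesis using assms(2) by (auto simp: smooth_def)
qed

lemma smooth_deriv: "smooth f \<Longrightarrow> smooth (deriv f)"
  and smooth_DERIV: "smooth f \<Longrightarrow> (f has_field_derivative deriv f x) (at x)"
  using smooth_iff DERIV_deriv_iff_field_differentiable by blast+

lemma smooth_continuous_on: "smooth f \<Longrightarrow> continuous_on S f"
  by (meson DERIV_continuous_on has_field_derivative_at_within smooth_DERIV)

inductive_set sum_prod :: "(real \<Rightarrow> real) set" where
  base: "smooth f \<Longrightarrow> smooth g \<Longrightarrow> (\<lambda>x. f x * g x) \<in> sum_prod"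
| add: "f \<in> sum_prod \<Longrightarrow> g \<in> sum_prod \<Longrightarrow> (\<lambda>x. f x + g x) \<in> sum_prod"

lemma sum_prod_deriv:
  "f \<in> sum_prod \<Longrightarrow> (\<forall>x. f field_differentiable at x) \<and> deriv f \<in> sum_prod"
proof (induction rule: sum_prod.induct)
  case (base f g)
  have d: "((\<lambda>x. f x * g x) has_field_derivative (deriv f x * g x + f x * deriv g x)) (at x)" for x
    by (rule derivative_eq_intros smooth_DERIV base refl)+ simp
  then have "deriv (\<lambda>x. f x * g x) = (\<lambda>x. deriv f x * g x + f x * deriv g x)"
    using DERIV_imp_deriv by blast
  moreover have "(\<lambda>x. deriv f x * g x + f x * deriv g x) \<in> sum_prod"
    by (intro sum_prod.intros smooth_deriv base)
  ultimately show ?case using d field_differentiable_def by metis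
next
  case (add f g)
  have d: "((\<lambda>x. f x + g x) has_field_derivative (deriv f x + deriv g x)) (at x)" for x
    using add DERIV_deriv_iff_field_differentiable by (intro DERIV_add) blast+
  then have "deriv (\<lambda>x. f x + g x) = (\<lambda>x. deriv f x + deriv g x)"
    using DERIV_imp_deriv by blast
  moreover have "(\<lambda>x. deriv f x + deriv g x) \<in> sum_prod"
    by (rule sum_prod.add) (use add in blast)+
  ultimately show ?case using d field_differentiable_def by metis
qed

lemma smooth_mult: "smooth f \<Longrightarrow> smooth g \<Longrightarrow> smooth (\<lambda>x. f x * g x)"
  by (rule smooth_coinduct[OF sum_prod.base sum_prod_deriv])

lemma smooth_const: "smooth (\<lambda>x. c)"
proof (rule smooth_coinduct[of _ "range (\<lambda>c x. c)"])
  fix f :: "real \<Rightarrow> real" assume "f \<in> range (\<lambda>c x. c)"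
  then obtain c where "f = (\<lambda>x::real. c)" by auto
  then show "(\<forall>x. f field_differentiable at x) \<and> deriv f \<in> range (\<lambda>c x. c)"
    by (simp add: field_differentiable_const rangeI)
qed simp

lemma smooth_add: "smooth f \<Longrightarrow> smooth g \<Longrightarrow> smooth (\<lambda>x. f x + g x)"
proof -
  assume "smooth f" "smooth g"
  then have "(\<lambda>x. f x * 1 + g x * 1) \<in> sum_prod"
    by (intro sum_prod.intros smooth_const)
  then have "smooth (\<lambda>x. f x * 1 + g x * 1)"
    by (rule smooth_coinduct) (rule sum_prod_deriv)
  then show ?thesis by simp
qed

lemma smooth_affine: assumes "smooth f" shows "smooth (\<lambda>x. f (c * x + d))"
proof -
  let ?F = "\<lambda>k g x. k * g (c * x + d)"
  let ?C = "{F. \<exists>k g. smooth g \<and> F = ?F k g}"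
  have "?F 1 f \<in> ?C" using assms by blast
  then have "smooth (?F 1 f)"
  proof (rule smooth_coinduct)
    fix F assume "F \<in> ?C"
    then obtain k g where g: "smooth g" and F: "F = ?F k g" by blast
    have "((\<lambda>x. c * x + d) has_field_derivative c) (at x)" for x
      by (auto intro!: derivative_eq_intros)
    then have "((\<lambda>x. g (c * x + d)) has_field_derivative (deriv g (c * x + d) * c)) (at x)" for x
      by (rule DERIV_chain2[OF smooth_DERIV[OF g]])
    then have "((\<lambda>x. k * g (c * x + d)) has_field_derivative (k * (deriv g (c * x + d) * c))) (at x)" for x
      by (rule DERIV_cmult)
    then have d: "(F has_field_derivative ?F (k * c) (deriv g) x) (at x)" for x
      unfolding F by (rule DERIV_cong) (simp only: mult_ac)
    then have "deriv F = ?F (k * c) (deriv g)"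
      using DERIV_imp_deriv by blast
    then show "(\<forall>x. F field_differentiable at x) \<and> deriv F \<in> ?C"
      using d smooth_deriv[OF g] unfolding field_differentiable_def by blast
  qed
  then show ?thesis by simp
qed

definition flat :: "real poly \<Rightarrow> real \<Rightarrow> real" where
  "flat p x = (if x > 0 then poly p (1 / x) * exp (- 1 / x) else 0)"

lemma poly_exp_tendsto_0: "((\<lambda>y. poly p y / exp y) \<longlongrightarrow> (0::real)) at_top"
proof -
  have "((\<lambda>y. \<Sum>i\<le>degree p. coeff p i * (y ^ i / exp y)) \<longlongrightarrow> (\<Sum>i\<le>degree p. coeff p i * 0)) at_top"
    by (intro tendsto_intros tendsto_power_div_exp_0)
  then show ?thesis by (simp add: poly_altdef sum_divide_distrib)
qed

lemma flat_DERIV: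
  "(flat p has_field_derivative flat ([:0,0,1:] * (p - pderiv p)) x) (at x)"
proof -
  consider "x > 0" | "x < 0" | "x = 0" by linarith
  then show ?thesis
  proof cases
    case 1
    have "((\<lambda>x. poly p (1/x) * exp (- 1/x)) has_field_derivative
           flat ([:0,0,1:] * (p - pderiv p)) x) (at x)"
      using 1 unfolding flat_def
      by (auto intro!: derivative_eq_intros DERIV_chain2[OF poly_DERIV]
          simp: field_simps power2_eq_square)
    then show ?thesis
      by (rule has_field_derivative_transform_within_open[of _ _ _ "{0<..}"])
         (use 1 in \<open>auto simp: flat_def\<close>)
  next
    case 2
    have "((\<lambda>x. 0) has_field_derivative flat ([:0,0,1:] * (p - pderiv p)) x) (at x)"
      using 2 by (simp add: flat_def)
    then show ?thesis
      by (rule has_field_derivative_transform_within_open[of _ _ _ "{..<0}"])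
         (use 2 in \<open>auto simp: flat_def\<close>)
  next
    case 3
    have "((\<lambda>y. poly (pCons 0 p) (inverse y) / exp (inverse y)) \<longlongrightarrow> 0) (at_right 0)"
      by (rule filterlim_compose[OF poly_exp_tendsto_0 filterlim_inverse_at_top_right])
    then have r: "((\<lambda>y. flat p y / y) \<longlongrightarrow> 0) (at_right 0)"
      by (rule Lim_transform_eventually)
         (auto simp: eventually_at_filter flat_def exp_minus field_simps)
    have l: "((\<lambda>y. flat p y / y) \<longlongrightarrow> 0) (at_left 0)"
      by (rule Lim_transform_eventually[OF tendsto_const])
         (auto simp: eventually_at_filter flat_def)
    have "((\<lambda>y. flat p y / y) \<longlongrightarrow> 0) (at 0)"
      using l r filterlim_split_at by blast
    then show ?thesis using 3 by (simp add: has_field_derivative_iff flat_def)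
  qed
qed

lemma smooth_flat: "smooth (flat p)"
proof (rule smooth_coinduct[of _ "range flat"])
  fix F assume "F \<in> range flat"
  then obtain q where F: "F = flat q" by auto
  have "deriv F = flat ([:0,0,1:] * (q - pderiv q))"
    unfolding F using DERIV_imp_deriv[OF flat_DERIV] by blast
  then show "(\<forall>x. F field_differentiable at x) \<and> deriv F \<in> range flat"
    using flat_DERIV F by (auto simp: field_differentiable_def)
qed auto

lemma Cc_inftyD:
  assumes "\<phi> \<in> Cc_infty S"
  shows "smooth \<phi>" "x \<notin> S \<Longrightarrow> \<phi> x = 0"
  using assms by (auto simp: Cc_infty_def)

lemma Cc_infty_zero: "(\<lambda>x. 0) \<in> Cc_infty S"
  by (auto simp: Cc_infty_def smooth_const intro!: exI[of _ "{}"])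

lemma Cc_infty_add:
  assumes "\<phi> \<in> Cc_infty S" "\<psi> \<in> Cc_infty S"
  shows "(\<lambda>x. \<phi> x + \<psi> x) \<in> Cc_infty S"
proof -
  obtain K L where "compact K" "K \<subseteq> S" "\<forall>x. x \<notin> K \<longrightarrow> \<phi> x = 0"
    "compact L" "L \<subseteq> S" "\<forall>x. x \<notin> L \<longrightarrow> \<psi> x = 0" using assms by (auto simp: Cc_infty_def)
  then show ?thesis using assms
    by (auto simp: Cc_infty_def smooth_add intro!: exI[of _ "K \<union> L"])
qed

lemma Cc_infty_mult:
  assumes "\<phi> \<in> Cc_infty S" "smooth \<psi>"
  shows "(\<lambda>x. \<psi> x * \<phi> x) \<in> Cc_infty S"
  using assms by (auto simp: Cc_infty_def smooth_mult)

lemma Cc_infty_deriv: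
  assumes "\<phi> \<in> Cc_infty S"
  shows "deriv \<phi> \<in> Cc_infty S"
proof -
  obtain K where K: "compact K" "K \<subseteq> S" "\<forall>x. x \<notin> K \<longrightarrow> \<phi> x = 0"
    using assms by (auto simp: Cc_infty_def)
  have "deriv \<phi> x = 0" if "x \<notin> K" for x
  proof -
    have "((\<lambda>x. 0) has_field_derivative 0) (at x)" by simp
    then have "(\<phi> has_field_derivative 0) (at x)"
      by (rule has_field_derivative_transform_within_open[of _ _ _ "- K"])
         (use K that compact_imp_closed in auto)
    then show ?thesis by (rule DERIV_imp_deriv)
  qed
  then show ?thesis using assms K smooth_deriv by (auto simp: Cc_infty_def)
qed

abbreviation Omega :: "real measure" where
  "Omega \<equiv> lebesgue_on {0<..<1}"

definition square_integrable :: "(real \<Rightarrow> real) \<Rightarrow> bool" where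
  "square_integrable f \<longleftrightarrow> f \<in> borel_measurable Omega \<and> integrable Omega (\<lambda>x. (f x)\<^sup>2)"

definition L2_eq :: "(real \<Rightarrow> real) \<Rightarrow> (real \<Rightarrow> real) \<Rightarrow> bool" where
  "L2_eq f g \<longleftrightarrow> square_integrable f \<and> square_integrable g \<and> (AE x in Omega. f x = g x)"

lemma square_integrable_zero: "square_integrable (\<lambda>x. 0)"
  by (simp add: square_integrable_def)

lemma square_integrable_mult:
  assumes "square_integrable f" "square_integrable g"
  shows "integrable Omega (\<lambda>x. f x * g x)"
proof (rule Bochner_Integration.integrable_bound[of _ "\<lambda>x. (f x)\<^sup>2 + (g x)\<^sup>2"])
  have "\<bar>a * b\<bar> \<le> a\<^sup>2 + b\<^sup>2" for a b :: real
  proof -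
    have "2 * (\<bar>a\<bar> * \<bar>b\<bar>) \<le> a\<^sup>2 + b\<^sup>2"
      using sum_squares_bound[of "\<bar>a\<bar>" "\<bar>b\<bar>"] by (simp add: mult.assoc)
    moreover have "0 \<le> \<bar>a\<bar> * \<bar>b\<bar>" by simp
    ultimately show ?thesis unfolding abs_mult by linarith
  qed
  then show "AE x in Omega. norm (f x * g x) \<le> norm ((f x)\<^sup>2 + (g x)\<^sup>2)" by simp
qed (use assms in \<open>auto simp: square_integrable_def\<close>)

lemma square_integrable_add:
  assumes "square_integrable f" "square_integrable g"
  shows "square_integrable (\<lambda>x. f x + g x)"
proof -
  have "integrable Omega (\<lambda>x. (f x)\<^sup>2 + (g x)\<^sup>2 + 2 * (f x * g x))"
    using assms square_integrable_mult[OF assms]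
    by (intro Bochner_Integration.integrable_add integrable_mult_right)
       (auto simp: square_integrable_def)
  moreover have "(\<lambda>x. f x + g x) \<in> borel_measurable Omega"
    using assms by (intro borel_measurable_add) (auto simp: square_integrable_def)
  ultimately show ?thesis by (simp add: square_integrable_def power2_sum mult.assoc)
qed

lemma square_integrable_scale:
  "square_integrable f \<Longrightarrow> square_integrable (\<lambda>x. c * f x)"
  by (auto simp: square_integrable_def power_mult_distrib)

lemma square_integrable_uminus:
  "square_integrable f \<Longrightarrow> square_integrable (\<lambda>x. - f x)"
  using square_integrable_scale[of f "-1"] by simp

lemma square_integrable_diff:
  "square_integrable f \<Longrightarrow> square_integrable g \<Longrightarrow> square_integrable (\<lambda>x. f x - g x)"
  using square_integrable_add[of f "\<lambda>x. - g x"] square_integrable_uminus[of g] by simp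

quotient_type L2 = "real \<Rightarrow> real" / partial: L2_eq
  morphisms rep_L2 abs_L2
proof (rule part_equivpI)
  show "\<exists>f. L2_eq f f" using square_integrable_zero by (auto simp: L2_eq_def)
  show "symp L2_eq" by (auto simp: L2_eq_def symp_def)
  show "transp L2_eq" unfolding L2_eq_def transp_def
  proof (intro allI impI conjI; (elim conjE)?)
    fix x y z :: "real \<Rightarrow> real"
    assume "AE t in Omega. x t = y t" "AE t in Omega. y t = z t"
    then show "AE t in Omega. x t = z t" by eventually_elim simp
  qed auto
qed

instantiation L2 :: real_inner
begin

lift_definition zero_L2 :: L2 is "\<lambda>x. 0"
  by (simp add: L2_eq_def square_integrable_zero)

lift_definition plus_L2 :: "L2 \<Rightarrow> L2 \<Rightarrow> L2" is "\<lambda>f g x. f x + g x"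
  by (auto simp: L2_eq_def square_integrable_add)

lift_definition minus_L2 :: "L2 \<Rightarrow> L2 \<Rightarrow> L2" is "\<lambda>f g x. f x - g x"
  by (auto simp: L2_eq_def square_integrable_diff)

lift_definition uminus_L2 :: "L2 \<Rightarrow> L2" is "\<lambda>f x. - f x"
  by (auto simp: L2_eq_def square_integrable_uminus)

lift_definition scaleR_L2 :: "real \<Rightarrow> L2 \<Rightarrow> L2" is "\<lambda>c f x. c * f x"
  by (auto simp: L2_eq_def square_integrable_scale)

lift_definition inner_L2 :: "L2 \<Rightarrow> L2 \<Rightarrow> real" is "\<lambda>f g. \<integral>x. f x * g x \<partial>Omega"
proof -
  fix f f' g g' assume "L2_eq f f'" "L2_eq g g'"
  then show "(\<integral>x. f x * g x \<partial>Omega) = (\<integral>x. f' x * g' x \<partial>Omega)"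
    by (intro integral_cong_AE) (auto simp: L2_eq_def square_integrable_def)
qed

definition norm_L2 :: "L2 \<Rightarrow> real" where "norm_L2 u = sqrt (inner u u)"
definition dist_L2 :: "L2 \<Rightarrow> L2 \<Rightarrow> real" where "dist_L2 u v = norm (u - v)"
definition sgn_L2 :: "L2 \<Rightarrow> L2" where "sgn_L2 u = inverse (norm u) *\<^sub>R u"
definition uniformity_L2 :: "(L2 \<times> L2) filter" where
  "uniformity_L2 = (INF e\<in>{0<..}. principal {(x, y). dist x y < e})"
definition open_L2 :: "L2 set \<Rightarrow> bool" where
  "open_L2 U = (\<forall>x\<in>U. \<forall>\<^sub>F (x', y) in uniformity. x' = x \<longrightarrow> y \<in> U)"

instance
proof
  fix u v w :: L2 and r s :: real
  show "u + v + w = u + (v + w)" "u + v = v + u" "0 + u = u" "- u + u = 0" "u - v = u + - v"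
    "r *\<^sub>R (u + v) = r *\<^sub>R u + r *\<^sub>R v" "(r + s) *\<^sub>R u = r *\<^sub>R u + s *\<^sub>R u"
    "r *\<^sub>R s *\<^sub>R u = (r * s) *\<^sub>R u" "1 *\<^sub>R u = u"
    by (transfer; auto simp: L2_eq_def algebra_simps
        intro!: square_integrable_add square_integrable_zero square_integrable_diff
          square_integrable_scale square_integrable_uminus;
        simp add: algebra_simps)+
  show "inner u v = inner v u" by transfer (simp add: mult.commute)
  show "inner (u + v) w = inner u w + inner v w"
    by transfer (auto simp: L2_eq_def distrib_right square_integrable_mult)
  show "inner (r *\<^sub>R u) v = r * inner u v"
    by transfer (auto simp: L2_eq_def mult.assoc)
  show "0 \<le> inner u u" by transfer simp
  show "inner u u = 0 \<longleftrightarrow> u = 0"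
  proof transfer
    fix f assume "L2_eq f f"
    then have f: "square_integrable f" by (simp add: L2_eq_def)
    then have "(\<integral>x. f x * f x \<partial>Omega) = 0 \<longleftrightarrow> (AE x in Omega. f x * f x = 0)"
      by (intro integral_nonneg_eq_0_iff_AE) (auto simp: square_integrable_mult)
    then show "(\<integral>x. f x * f x \<partial>Omega) = 0 \<longleftrightarrow> L2_eq f (\<lambda>x. 0)"
      using f square_integrable_zero by (simp add: L2_eq_def)
  qed
qed (rule norm_L2_def dist_L2_def sgn_L2_def uniformity_L2_def open_L2_def)+

end

lemma abs_L2_eq_iff:
  "square_integrable f \<Longrightarrow> square_integrable g \<Longrightarrow> abs_L2 f = abs_L2 g \<longleftrightarrow> (AE x in Omega. f x = g x)"
  using Quotient_rel[OF Quotient_L2, of f g] by (auto simp: L2_eq_def)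

lemma square_integrable_rep: "square_integrable (rep_L2 u)"
  using Quotient_rep_reflp[OF Quotient_L2] by (auto simp: L2_eq_def)

lemma abs_rep_L2: "abs_L2 (rep_L2 u) = u"
  using Quotient_abs_rep[OF Quotient_L2] .

lemma abs_L2_simps:
  assumes "square_integrable f" "square_integrable g"
  shows "inner (abs_L2 f) (abs_L2 g) = (\<integral>x. f x * g x \<partial>Omega)"
    and "abs_L2 f + abs_L2 g = abs_L2 (\<lambda>x. f x + g x)"
    and "c *\<^sub>R abs_L2 f = abs_L2 (\<lambda>x. c * f x)"
  using assms inner_L2.abs_eq plus_L2.abs_eq scaleR_L2.abs_eq by (auto simp: L2_eq_def)

definition has_weak_deriv :: "L2 \<Rightarrow> L2 \<Rightarrow> bool" where
  "has_weak_deriv u g \<longleftrightarrow>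
     (\<forall>\<phi> \<in> Cc_infty {0<..<1}. inner u (abs_L2 (deriv \<phi>)) = - inner g (abs_L2 \<phi>))"

definition H1 :: "L2 set" where
  "H1 = {u. \<exists>g. has_weak_deriv u g}"

definition weak_deriv :: "L2 \<Rightarrow> L2" where
  "weak_deriv u = (THE g. has_weak_deriv u g)"

definition H2 :: "L2 set" where
  "H2 = {u \<in> H1. weak_deriv u \<in> H1}"

definition H1_norm :: "L2 \<Rightarrow> real" where
  "H1_norm u = sqrt ((norm u)\<^sup>2 + (norm (weak_deriv u))\<^sup>2)"

definition H1_zero :: "L2 set" where
  "H1_zero = {u \<in> H1. \<forall>e>0. \<exists>\<phi> \<in> Cc_infty {0<..<1}. H1_norm (u - abs_L2 \<phi>) < e}"

lemma continuous_square_integrable: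
  assumes "continuous_on {0..1} f" shows "square_integrable f"
proof -
  have m: "f \<in> borel_measurable Omega"
    by (intro borel_measurable_if_I continuous_imp_measurable_on_sets_lebesgue
        continuous_on_subset[OF assms]) auto
  have "(\<lambda>x. (f x)\<^sup>2) absolutely_integrable_on {0..1}"
    using assms by (intro absolutely_integrable_continuous_real continuous_intros)
  then have "(\<lambda>x. (f x)\<^sup>2) absolutely_integrable_on {0<..<1}"
    by (rule set_integrable_subset) auto
  then have "integrable Omega (\<lambda>x. (f x)\<^sup>2)"
    by (simp add: integrable_restrict_space set_integrable_def)
  with m show ?thesis by (simp add: square_integrable_def)
qed

lemma square_integrable_smooth: "smooth \<phi> \<Longrightarrow> square_integrable \<phi>"
  by (rule continuous_square_integrable[OF smooth_continuous_on])

lemma integral_Omega_deriv: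
  assumes "\<And>x. (F has_field_derivative f x) (at x)" "continuous_on UNIV f"
  shows "(\<integral>x. f x \<partial>Omega) = F 1 - F 0" "integrable Omega f"
proof -
  have i: "f absolutely_integrable_on {0<..<1}"
    by (rule set_integrable_subset[of _ "{0..1}"])
       (use assms in \<open>auto intro!: absolutely_integrable_continuous_real
          continuous_on_subset[OF assms(2)]\<close>)
  then show int: "integrable Omega f"
    by (simp add: integrable_restrict_space set_integrable_def)
  have "(f has_integral (F 1 - F 0)) {0..1}"
    by (rule fundamental_theorem_of_calculus)
       (use assms in \<open>auto simp: has_real_derivative_iff_has_vector_derivative[symmetric]
          intro: has_field_derivative_at_within\<close>)
  then have "(f has_integral (F 1 - F 0)) {0<..<1}"
    using has_integral_Icc_iff_Ioo by blast
  moreover have "(f has_integral (\<integral>x. f x \<partial>Omega)) {0<..<1}"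
    by (rule has_integral_integral_lebesgue_on[OF int]) simp
  ultimately show "(\<integral>x. f x \<partial>Omega) = F 1 - F 0"
    using has_integral_unique by blast
qed

lemma has_weak_deriv_test:
  assumes "\<phi> \<in> Cc_infty {0<..<1}"
  shows "has_weak_deriv (abs_L2 \<phi>) (abs_L2 (deriv \<phi>))"
  unfolding has_weak_deriv_def
proof
  fix \<psi> assume \<psi>: "\<psi> \<in> Cc_infty {0<..<1}"
  note s = Cc_inftyD(1)[OF assms] Cc_inftyD(1)[OF \<psi>]
  have d: "((\<lambda>x. \<phi> x * \<psi> x) has_field_derivative \<phi> x * deriv \<psi> x + deriv \<phi> x * \<psi> x) (at x)" for x
    by (rule derivative_eq_intros smooth_DERIV s refl)+ simp
  have "(\<integral>x. \<phi> x * deriv \<psi> x + deriv \<phi> x * \<psi> x \<partial>Omega) = 0"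
    using integral_Omega_deriv(1)[OF d] Cc_inftyD(2)[OF \<psi>, of 0] Cc_inftyD(2)[OF \<psi>, of 1]
    by (simp add: smooth_continuous_on smooth_deriv s continuous_intros)
  then have "(\<integral>x. \<phi> x * deriv \<psi> x \<partial>Omega) + (\<integral>x. deriv \<phi> x * \<psi> x \<partial>Omega) = 0"
    by (subst (asm) Bochner_Integration.integral_add)
       (auto intro!: square_integrable_mult square_integrable_smooth smooth_deriv s)
  then show "inner (abs_L2 \<phi>) (abs_L2 (deriv \<psi>)) = - inner (abs_L2 (deriv \<phi>)) (abs_L2 \<psi>)"
    by (simp add: abs_L2_simps square_integrable_smooth smooth_deriv s)
qed

lemma bump_Cc_infty:
  assumes "0 < a" "b < 1" "0 < n"
  shows "(\<lambda>x. flat 1 (n * (x - a)) * flat 1 (n * (b - x))) \<in> Cc_infty {0<..<1}" (is "?\<phi> \<in> _")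
proof -
  have "smooth (\<lambda>x. flat 1 (n * x + - n * a) * flat 1 (- n * x + n * b))"
    by (intro smooth_mult smooth_affine smooth_flat)
  moreover have "(\<lambda>x. flat 1 (n * x + - n * a) * flat 1 (- n * x + n * b)) = ?\<phi>"
    by (simp add: algebra_simps)
  ultimately have 1: "smooth ?\<phi>" by metis
  have 2: "compact {a..b}" "{a..b} \<subseteq> {0<..<1}"
    using assms by auto
  have 3: "?\<phi> x = 0" if "x \<notin> {a..b}" for x
    using assms that by (auto simp: flat_def zero_less_mult_iff)
  show ?thesis
    unfolding Cc_infty_def using 1 2 3 by blast
qed

lemma flat_tendsto: assumes x: "x > 0" shows "(\<lambda>n. flat 1 (real (Suc n) * x)) \<longlonglongrightarrow> 1"
proof -
  have "flat 1 (real (Suc n) * x) = exp (- ((1 / x) * inverse (real (Suc n))))" for n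
  proof -
    have "0 < real (Suc n) * x" using x by (intro mult_pos_pos) auto
    moreover have "- 1 / (real (Suc n) * x) = - ((1 / x) * inverse (real (Suc n)))"
      by (simp only: divide_inverse inverse_mult_distrib) argo
    ultimately show ?thesis unfolding flat_def by (simp only: if_True poly_1 mult_1)
  qed
  moreover have "(\<lambda>n. exp (- ((1 / x) * inverse (real (Suc n))))) \<longlonglongrightarrow> exp (- ((1 / x) * 0))"
    by (intro tendsto_exp tendsto_minus tendsto_mult tendsto_const LIMSEQ_inverse_real_of_nat)
  ultimately show ?thesis by (simp only: mult_zero_right minus_zero exp_zero)
qed

lemma flat_nonpos: "x \<le> 0 \<Longrightarrow> flat 1 (real (Suc n) * x) = 0"
  unfolding flat_def by (simp add: mult_le_0_iff not_less del: of_nat_Suc)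

lemma flat_bound: "\<bar>flat 1 x\<bar> \<le> 1"
  by (simp add: flat_def)

lemma orthogonal_test_imp_0:
  assumes "\<And>\<phi>. \<phi> \<in> Cc_infty {0<..<1} \<Longrightarrow> inner g (abs_L2 \<phi>) = 0"
  shows "g = 0"
proof -
  define f where "f = rep_L2 g"
  have f: "square_integrable f" "g = abs_L2 f"
    by (simp_all add: f_def square_integrable_rep abs_rep_L2)
  have m [measurable]: "f \<in> borel_measurable Omega"
    using f by (simp add: square_integrable_def)
  have fi: "integrable Omega f"
    using square_integrable_mult[OF f(1) square_integrable_smooth[OF smooth_const[of 1]]] by simp
  have zero: "(\<integral>x. f x * indicat_real {a<..<b} x \<partial>Omega) = 0" if ab: "0 < a" "b < 1" for a b
  proof (rule LIMSEQ_unique)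
    let ?\<phi> = "\<lambda>n x. flat 1 (real (Suc n) * (x - a)) * flat 1 (real (Suc n) * (b - x))"
    have t: "?\<phi> n \<in> Cc_infty {0<..<1}" for n using bump_Cc_infty[OF ab] by simp
    have si: "square_integrable (?\<phi> n)" for n
      by (rule square_integrable_smooth[OF Cc_inftyD(1)[OF t]])
    have "inner g (abs_L2 (?\<phi> n)) = (\<integral>x. f x * ?\<phi> n x \<partial>Omega)" for n
      unfolding f(2) by (rule abs_L2_simps(1)[OF f(1) si])
    then have z: "(\<integral>x. f x * ?\<phi> n x \<partial>Omega) = 0" for n by (rule trans[OF sym assms[OF t]])
    show "(\<lambda>n. \<integral>x. f x * ?\<phi> n x \<partial>Omega) \<longlonglongrightarrow> 0" unfolding z by (rule tendsto_const)
    show "(\<lambda>n. \<integral>x. f x * ?\<phi> n x \<partial>Omega) \<longlonglongrightarrow> (\<integral>x. f x * indicat_real {a<..<b} x \<partial>Omega)"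
    proof (rule integral_dominated_convergence[where w = "\<lambda>x. \<bar>f x\<bar>"])
      have "(\<lambda>n. ?\<phi> n x) \<longlonglongrightarrow> indicat_real {a<..<b} x" for x
      proof (cases "x \<in> {a<..<b}")
        case True
        then have "(\<lambda>n. ?\<phi> n x) \<longlonglongrightarrow> 1 * 1"
          by (intro tendsto_mult flat_tendsto) auto
        then show ?thesis using True by (simp only: indicator_simps mult_1)
      next
        case False
        then have "x - a \<le> 0 \<or> b - x \<le> 0" by auto
        then have "?\<phi> n x = 0" for n by (auto simp only: flat_nonpos mult_zero_left mult_zero_right)
        then show ?thesis using False by (simp only: indicator_simps simp_thms tendsto_const)
      qed
      then show "AE x in Omega. (\<lambda>n. f x * ?\<phi> n x) \<longlonglongrightarrow> f x * indicat_real {a<..<b} x"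
        by (intro AE_I2 tendsto_mult tendsto_const)
      have "\<bar>?\<phi> n x\<bar> \<le> 1" for n x
        unfolding abs_mult by (rule mult_le_one[OF flat_bound abs_ge_zero flat_bound])
      then show "AE x in Omega. norm (f x * ?\<phi> n x) \<le> \<bar>f x\<bar>" for n
        unfolding real_norm_def abs_mult[of "f _"] by (intro AE_I2 mult_left_le abs_ge_zero)
    next
      show "(\<lambda>x. f x * ?\<phi> n x) \<in> borel_measurable Omega" for n
        by (rule borel_measurable_times[OF m si[unfolded square_integrable_def, THEN conjunct1]])
    next
      have "indicat_real {a<..<b} \<in> borel_measurable Omega"
        by (intro measurable_restrict_space1 borel_measurable_indicator) auto
      then show "(\<lambda>x. f x * indicat_real {a<..<b} x) \<in> borel_measurable Omega"
        by (intro borel_measurable_times m)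
    qed (use fi in auto)
  qed
  define F where "F = (\<lambda>x. if x \<in> {0<..<1} then f x else 0)"
  have F_int: "F integrable_on S" if "S \<in> sets lebesgue" for S
  proof -
    have "F = (\<lambda>x. indicator {0<..<1} x *\<^sub>R f x)"
      by (simp add: F_def indicator_def fun_eq_iff)
    then have "integrable lebesgue F"
      using fi by (simp add: integrable_restrict_space)
    then have "F absolutely_integrable_on UNIV" by (simp add: set_integrable_def)
    then have "F absolutely_integrable_on S" by (rule set_integrable_subset) (use that in auto)
    then show ?thesis using absolutely_integrable_on_def by blast
  qed
  have Fz: "integral (cbox a b) F = 0" if ab: "0 < a" "b < 1" for a b
  proof -
    have i: "integrable Omega (\<lambda>x. f x * indicat_real {a<..<b} x)"
      by (rule integrable_real_mult_indicator[OF _ fi])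
         (use ab in \<open>auto simp: sets_restrict_space_iff\<close>)
    have "((\<lambda>x. f x * indicat_real {a<..<b} x) has_integral 0) {0<..<1}"
      using has_integral_integral_lebesgue_on[OF i] zero[OF ab] by simp
    then have "((\<lambda>x. if x \<in> {0<..<1} then f x * indicat_real {a<..<b} x else 0) has_integral 0) UNIV"
      by (simp only: has_integral_restrict_UNIV)
    also have "(\<lambda>x. if x \<in> {0<..<1} then f x * indicat_real {a<..<b} x else 0)
       = (\<lambda>x. if x \<in> {a<..<b} then F x else 0)"
      using ab by (auto simp: fun_eq_iff F_def indicator_def)
    finally have "(F has_integral 0) {a<..<b}"
      by (simp only: has_integral_restrict_UNIV)
    then have "(F has_integral 0) {a..b}"
      using has_integral_Icc_iff_Ioo by blast
    then show ?thesis by (simp add: integral_unique)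
  qed
  have "F integrable_on cbox a b" for a b by (rule F_int) simp
  then obtain N where N: "negligible N" and
    lim: "\<And>x e. x \<notin> N \<Longrightarrow> 0 < e \<Longrightarrow> \<exists>d>0. \<forall>h. 0 < h \<and> h < d \<longrightarrow>
       norm (integral (cbox x (x + h *\<^sub>R One)) F /\<^sub>R h ^ DIM(real) - F x) < e"
    using integrable_ccontinuous_explicit[of F] by blast
  have "f x = 0" if x: "x \<notin> N" "x \<in> {0<..<1}" for x
  proof (rule ccontr)
    assume "f x \<noteq> 0"
    then have "0 < \<bar>F x\<bar>" using x by (simp add: F_def)
    then obtain d where d: "d > 0" and *: "\<And>h. 0 < h \<and> h < d \<Longrightarrow>
       norm (integral (cbox x (x + h *\<^sub>R One)) F /\<^sub>R h ^ DIM(real) - F x) < \<bar>F x\<bar>"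
      using lim[OF x(1) \<open>0 < \<bar>F x\<bar>\<close>] by blast
    define h where "h = min (d / 2) ((1 - x) / 2)"
    have h: "0 < h" "h < d" "x + h < 1" using d x by (auto simp: h_def min_def field_simps)
    show False using *[of h] h Fz[of x "x + h"] x by simp
  qed
  moreover have "AE x in lebesgue. x \<notin> N"
    using N by (simp add: negligible_iff_null_sets AE_not_in)
  ultimately have "AE x in Omega. f x = 0"
    by (subst AE_restrict_space_iff) (auto elim: eventually_mono)
  then have "abs_L2 f = abs_L2 (\<lambda>x. 0)"
    using abs_L2_eq_iff[OF f(1) square_integrable_zero] by simp
  then show ?thesis using f(2) by (simp add: zero_L2_def)
qed

lemma has_weak_deriv_unique:
  assumes "has_weak_deriv u g" "has_weak_deriv u g'"
  shows "g = g'"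
proof -
  have "g - g' = 0"
    using assms by (intro orthogonal_test_imp_0) (simp add: has_weak_deriv_def inner_diff_left)
  then show ?thesis by simp
qed

lemma weak_deriv_eqI: "has_weak_deriv u g \<Longrightarrow> weak_deriv u = g"
  unfolding weak_deriv_def using has_weak_deriv_unique by blast

lemma has_weak_deriv_weak_deriv: "u \<in> H1 \<Longrightarrow> has_weak_deriv u (weak_deriv u)"
  using weak_deriv_eqI by (force simp: H1_def)

lemma has_weak_deriv_linear:
  assumes "has_weak_deriv u g" "has_weak_deriv u' g'"
  shows "has_weak_deriv (u + u') (g + g')" "has_weak_deriv (c *\<^sub>R u) (c *\<^sub>R g)"
  using assms by (auto simp: has_weak_deriv_def inner_add_left)

lemma H1_add: "u \<in> H1 \<Longrightarrow> v \<in> H1 \<Longrightarrow> u + v \<in> H1 \<and> weak_deriv (u + v) = weak_deriv u + weak_deriv v"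
  using has_weak_deriv_linear(1) has_weak_deriv_weak_deriv weak_deriv_eqI H1_def by blast

lemma H1_scaleR: "u \<in> H1 \<Longrightarrow> c *\<^sub>R u \<in> H1 \<and> weak_deriv (c *\<^sub>R u) = c *\<^sub>R weak_deriv u"
  using has_weak_deriv_linear(2) has_weak_deriv_weak_deriv weak_deriv_eqI H1_def by blast

lemma H1_diff: "u \<in> H1 \<Longrightarrow> v \<in> H1 \<Longrightarrow> u - v \<in> H1 \<and> weak_deriv (u - v) = weak_deriv u - weak_deriv v"
  using H1_add[of u "(-1) *\<^sub>R v"] H1_scaleR[of v "-1"] by simp

lemma H1_test:
  "\<phi> \<in> Cc_infty {0<..<1} \<Longrightarrow> abs_L2 \<phi> \<in> H1 \<and> weak_deriv (abs_L2 \<phi>) = abs_L2 (deriv \<phi>)"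
  using has_weak_deriv_test weak_deriv_eqI H1_def by blast

lemma H1_norm_eq: "H1_norm u = norm (u, weak_deriv u)"
  by (simp add: H1_norm_def norm_prod_def)

lemma H1_zero_test: "\<phi> \<in> Cc_infty {0<..<1} \<Longrightarrow> abs_L2 \<phi> \<in> H1_zero"
  using H1_test H1_diff[of "abs_L2 \<phi>" "abs_L2 \<phi>"]
  by (auto simp: H1_zero_def H1_norm_def intro!: bexI[of _ \<phi>])

lemma zero_mem_H1_zero: "0 \<in> H1_zero"
  using H1_zero_test[OF Cc_infty_zero] by (simp add: zero_L2_def)

lemma H1_zero_add:
  assumes "u \<in> H1_zero" "v \<in> H1_zero" shows "u + v \<in> H1_zero"
proof -
  have H: "u \<in> H1" "v \<in> H1" using assms by (auto simp: H1_zero_def)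
  have "\<exists>\<phi> \<in> Cc_infty {0<..<1}. H1_norm (u + v - abs_L2 \<phi>) < e" if "e > 0" for e
  proof -
    have "e / 2 > 0" using that by simp
    then obtain \<phi> \<psi> where t: "\<phi> \<in> Cc_infty {0<..<1}" "\<psi> \<in> Cc_infty {0<..<1}"
      and n: "H1_norm (u - abs_L2 \<phi>) < e / 2" "H1_norm (v - abs_L2 \<psi>) < e / 2"
      using assms unfolding H1_zero_def by blast
    have eq: "abs_L2 (\<lambda>x. \<phi> x + \<psi> x) = abs_L2 \<phi> + abs_L2 \<psi>"
      using t Cc_inftyD(1) square_integrable_smooth by (simp add: abs_L2_simps)
    have "weak_deriv (u + v - (abs_L2 \<phi> + abs_L2 \<psi>))
        = weak_deriv (u - abs_L2 \<phi>) + weak_deriv (v - abs_L2 \<psi>)"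
      using H t H1_test H1_diff H1_add by simp
    then have "H1_norm (u + v - abs_L2 (\<lambda>x. \<phi> x + \<psi> x))
        \<le> H1_norm (u - abs_L2 \<phi>) + H1_norm (v - abs_L2 \<psi>)"
      unfolding H1_norm_eq eq
      using norm_triangle_ineq[of "(u - abs_L2 \<phi>, weak_deriv (u - abs_L2 \<phi>))"
          "(v - abs_L2 \<psi>, weak_deriv (v - abs_L2 \<psi>))"] by (simp add: algebra_simps)
    then show ?thesis using n Cc_infty_add[OF t] by (auto intro!: bexI)
  qed
  then show ?thesis using H H1_add by (auto simp: H1_zero_def)
qed

lemma H1_zero_scaleR:
  assumes "u \<in> H1_zero" shows "c *\<^sub>R u \<in> H1_zero"
proof -
  have H: "u \<in> H1" using assms by (auto simp: H1_zero_def)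
  have "\<exists>\<phi> \<in> Cc_infty {0<..<1}. H1_norm (c *\<^sub>R u - abs_L2 \<phi>) < e" if e: "e > 0" for e
  proof -
    have "e / (\<bar>c\<bar> + 1) > 0" using e by simp
    then obtain \<phi> where t: "\<phi> \<in> Cc_infty {0<..<1}" and n: "H1_norm (u - abs_L2 \<phi>) < e / (\<bar>c\<bar> + 1)"
      using assms unfolding H1_zero_def by blast
    have eq: "abs_L2 (\<lambda>x. c * \<phi> x) = c *\<^sub>R abs_L2 \<phi>"
      using abs_L2_simps(3)[OF square_integrable_smooth[OF Cc_inftyD(1)[OF t]] square_integrable_zero]
      by simp
    have eq2: "c *\<^sub>R u - c *\<^sub>R abs_L2 \<phi> = c *\<^sub>R (u - abs_L2 \<phi>)" by (simp add: algebra_simps)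
    have "weak_deriv (c *\<^sub>R (u - abs_L2 \<phi>)) = c *\<^sub>R weak_deriv (u - abs_L2 \<phi>)"
      using H t H1_test H1_diff H1_scaleR by simp
    then have "H1_norm (c *\<^sub>R u - abs_L2 (\<lambda>x. c * \<phi> x)) = \<bar>c\<bar> * H1_norm (u - abs_L2 \<phi>)"
      unfolding H1_norm_eq eq eq2
      using norm_scaleR[of c "(u - abs_L2 \<phi>, weak_deriv (u - abs_L2 \<phi>))"] by simp
    also have "\<dots> \<le> (\<bar>c\<bar> + 1) * H1_norm (u - abs_L2 \<phi>)"
      by (intro mult_right_mono) (auto simp: H1_norm_def)
    also have "\<dots> < e" using n by (simp add: field_simps add_pos_nonneg)
    finally show ?thesis using Cc_infty_mult[OF t smooth_const] by (auto intro!: bexI)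
  qed
  then show ?thesis using H H1_scaleR by (auto simp: H1_zero_def)
qed

lemma test_Poincare:
  assumes "\<phi> \<in> Cc_infty {0<..<1}"
  shows "norm (abs_L2 \<phi>) \<le> 2 * norm (abs_L2 (deriv \<phi>))"
proof -
  note s = Cc_inftyD(1)[OF assms]
  have [simp]: "\<phi> 0 = 0" "\<phi> 1 = 0" using Cc_inftyD(2)[OF assms] by auto
  let ?f = "\<lambda>x. (\<phi> x)\<^sup>2 + 2 * x * \<phi> x * deriv \<phi> x"
  have d: "((\<lambda>x. x * (\<phi> x)\<^sup>2) has_field_derivative ?f x) (at x)" for x
    by (rule derivative_eq_intros smooth_DERIV s refl)+ (simp add: algebra_simps)
  have c: "continuous_on UNIV ?f"
    by (intro continuous_intros smooth_continuous_on s smooth_deriv)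
  note F = integral_Omega_deriv[OF d c]
  have sq: "square_integrable \<phi>" "square_integrable (deriv \<phi>)"
    using s smooth_deriv square_integrable_smooth by auto
  then have i: "integrable Omega (\<lambda>x. (\<phi> x)\<^sup>2)" "integrable Omega (\<lambda>x. (deriv \<phi> x)\<^sup>2)"
    by (auto simp: square_integrable_def)
  have i2: "integrable Omega (\<lambda>x. 2 * ?f x)" "integrable Omega (\<lambda>x. 4 * (deriv \<phi> x)\<^sup>2)"
    by (rule integrable_mult_right[OF F(2)] integrable_mult_right[OF i(2)])+
  have "(\<integral>x. (\<phi> x)\<^sup>2 \<partial>Omega) \<le> (\<integral>x. 2 * ?f x + 4 * (deriv \<phi> x)\<^sup>2 \<partial>Omega)"
  proof (rule integral_mono)
    fix x assume "x \<in> space Omega"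
    then have x: "0 < x" "x < 1" by auto
    have "0 \<le> (\<phi> x + 2 * x * deriv \<phi> x)\<^sup>2" by simp
    moreover have "x\<^sup>2 * (deriv \<phi> x)\<^sup>2 \<le> 1 * (deriv \<phi> x)\<^sup>2"
      using x by (intro mult_right_mono) (auto simp: power_le_one)
    ultimately show "(\<phi> x)\<^sup>2 \<le> 2 * ?f x + 4 * (deriv \<phi> x)\<^sup>2"
      by (simp add: power2_eq_square algebra_simps)
  qed (rule i(1) Bochner_Integration.integrable_add[OF i2])+
  also have "\<dots> = 4 * (\<integral>x. (deriv \<phi> x)\<^sup>2 \<partial>Omega)"
    unfolding Bochner_Integration.integral_add[OF i2] integral_mult_right_zero F(1) by simp
  finally have "(norm (abs_L2 \<phi>))\<^sup>2 \<le> (2 * norm (abs_L2 (deriv \<phi>)))\<^sup>2"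
    using sq by (simp add: power_mult_distrib power2_norm_eq_inner abs_L2_simps(1) flip: power2_eq_square)
  then show ?thesis by (rule power2_le_imp_le) simp
qed

lemma Poincare:
  assumes "u \<in> H1_zero"
  shows "norm u \<le> 2 * norm (weak_deriv u)"
proof (rule field_le_epsilon)
  fix e :: real assume "e > 0"
  then have "e / 3 > 0" by simp
  then obtain \<phi> where t: "\<phi> \<in> Cc_infty {0<..<1}" and n: "H1_norm (u - abs_L2 \<phi>) < e / 3"
    using assms unfolding H1_zero_def by blast
  have "weak_deriv (u - abs_L2 \<phi>) = weak_deriv u - abs_L2 (deriv \<phi>)"
    using assms t H1_test H1_diff by (simp add: H1_zero_def)
  then have "norm (u - abs_L2 \<phi>) < e / 3" "norm (weak_deriv u - abs_L2 (deriv \<phi>)) < e / 3"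
    using n norm_fst_le[of "u - abs_L2 \<phi>" "weak_deriv (u - abs_L2 \<phi>)"]
      norm_snd_le[of "weak_deriv (u - abs_L2 \<phi>)" "u - abs_L2 \<phi>"]
    unfolding H1_norm_eq by auto
  moreover have "norm u \<le> norm (abs_L2 \<phi>) + norm (u - abs_L2 \<phi>)"
    by (rule norm_triangle_sub)
  moreover have "norm (abs_L2 (deriv \<phi>)) \<le> norm (weak_deriv u) + norm (weak_deriv u - abs_L2 (deriv \<phi>))"
    by (subst norm_minus_commute) (rule norm_triangle_sub)
  ultimately show "norm u \<le> 2 * norm (weak_deriv u) + e"
    using test_Poincare[OF t] by linarith
qed

typedef H01 = H1_zero morphisms L2_of H01_of
  using zero_mem_H1_zero by blast

setup_lifting type_definition_H01

definition H01_deriv :: "H01 \<Rightarrow> L2" where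
  "H01_deriv u = weak_deriv (L2_of u)"

instantiation H01 :: real_inner
begin

lift_definition zero_H01 :: H01 is 0 by (rule zero_mem_H1_zero)
lift_definition plus_H01 :: "H01 \<Rightarrow> H01 \<Rightarrow> H01" is "(+)" by (rule H1_zero_add)
lift_definition scaleR_H01 :: "real \<Rightarrow> H01 \<Rightarrow> H01" is "(*\<^sub>R)" by (rule H1_zero_scaleR)
lift_definition uminus_H01 :: "H01 \<Rightarrow> H01" is uminus
  using H1_zero_scaleR[of _ "-1"] by simp
lift_definition minus_H01 :: "H01 \<Rightarrow> H01 \<Rightarrow> H01" is "(-)"
  using H1_zero_add H1_zero_scaleR[of _ "-1"] by (metis diff_conv_add_uminus scaleR_minus1_left)

definition inner_H01 :: "H01 \<Rightarrow> H01 \<Rightarrow> real" where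
  "inner_H01 u v = inner (H01_deriv u) (H01_deriv v)"
definition norm_H01 :: "H01 \<Rightarrow> real" where "norm_H01 u = norm (H01_deriv u)"
definition dist_H01 :: "H01 \<Rightarrow> H01 \<Rightarrow> real" where "dist_H01 u v = norm (u - v)"
definition sgn_H01 :: "H01 \<Rightarrow> H01" where "sgn_H01 u = inverse (norm u) *\<^sub>R u"
definition uniformity_H01 :: "(H01 \<times> H01) filter" where
  "uniformity_H01 = (INF e\<in>{0<..}. principal {(x, y). dist x y < e})"
definition open_H01 :: "H01 set \<Rightarrow> bool" where
  "open_H01 U = (\<forall>x\<in>U. \<forall>\<^sub>F (x', y) in uniformity. x' = x \<longrightarrow> y \<in> U)"

instance
proof
  fix u v w :: H01 and r s :: real
  show "u + v + w = u + (v + w)" "u + v = v + u" "0 + u = u" "- u + u = 0" "u - v = u + - v"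
    "r *\<^sub>R (u + v) = r *\<^sub>R u + r *\<^sub>R v" "(r + s) *\<^sub>R u = r *\<^sub>R u + s *\<^sub>R u"
    "r *\<^sub>R s *\<^sub>R u = (r * s) *\<^sub>R u" "1 *\<^sub>R u = u"
    by (transfer; simp add: algebra_simps)+
  have H1: "L2_of x \<in> H1" "L2_of x \<in> H1_zero" for x
    using L2_of[of x] by (auto simp: H1_zero_def)
  show "inner u v = inner v u" by (simp add: inner_H01_def inner_commute)
  show "inner (u + v) w = inner u w + inner v w"
    by (simp add: inner_H01_def H01_deriv_def plus_H01.rep_eq H1_add H1 inner_add_left)
  show "inner (r *\<^sub>R u) v = r * inner u v"
    by (simp add: inner_H01_def H01_deriv_def scaleR_H01.rep_eq H1_scaleR H1)
  show "0 \<le> inner u u" by (simp add: inner_H01_def)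
  show "inner u u = 0 \<longleftrightarrow> u = 0"
  proof
    assume "inner u u = 0"
    then have "L2_of u = 0"
      using Poincare[OF H1(2)[of u]] by (simp add: inner_H01_def H01_deriv_def)
    then show "u = 0" by (simp add: zero_H01.rep_eq flip: L2_of_inject)
  next
    assume "u = 0"
    then show "inner u u = 0"
      using H1_scaleR[OF H1(1)[of 0], of 0]
      by (simp add: inner_H01_def H01_deriv_def zero_H01.rep_eq)
  qed
  show "norm u = sqrt (inner u u)"
    by (simp add: norm_H01_def inner_H01_def norm_eq_sqrt_inner)
qed (rule dist_H01_def sgn_H01_def uniformity_H01_def open_H01_def)+

end

text \<open>Elements of $H^1_0(0,1)$ are essentially bounded, so for continuous \<open>f\<close> the function below is
  square integrable, and its class does not depend on the representative chosen by \<open>rep_L2\<close>.\<close>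

definition nemytskii :: "(real \<Rightarrow> real) \<Rightarrow> H01 \<Rightarrow> L2" where
  "nemytskii f u = abs_L2 (\<lambda>x. f (rep_L2 (L2_of u) x))"

text \<open>The Bochner spaces below are only used with values in the separable spaces \<open>L2\<close> and \<open>H01\<close>, for
  which Borel measurability is strong measurability.\<close>

definition Linf_time :: "real \<Rightarrow> (real \<Rightarrow> 'a::real_normed_vector) \<Rightarrow> bool" where
  "Linf_time T w \<longleftrightarrow> w \<in> borel_measurable (lebesgue_on {0<..<T}) \<and>
     (\<exists>C. AE t in lebesgue_on {0<..<T}. norm (w t) \<le> C)"

definition L2_time :: "real \<Rightarrow> (real \<Rightarrow> 'a::real_normed_vector) \<Rightarrow> bool" where
  "L2_time T w \<longleftrightarrow> w \<in> borel_measurable (lebesgue_on {0<..<T}) \<and>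
     integrable (lebesgue_on {0<..<T}) (\<lambda>t. (norm (w t))\<^sup>2)"

text \<open>Membership in $L^2(0,T;H^2\cap H^1_0)$: the norm of $H^2$ is the one of
  $(u,u_x,u_{xx})\in (L^2)^3$. The value of \<open>weak_deriv (H01_deriv (u t))\<close> is unspecified
  only on the null set where \<open>u t\<close> is not in $H^2$.\<close>

definition L2_time_H2 :: "real \<Rightarrow> (real \<Rightarrow> H01) \<Rightarrow> bool" where
  "L2_time_H2 T u \<longleftrightarrow>
     (AE t in lebesgue_on {0<..<T}. L2_of (u t) \<in> H2) \<and>
     L2_time T (\<lambda>t. L2_of (u t)) \<and>
     L2_time T (\<lambda>t. H01_deriv (u t)) \<and>
     L2_time T (\<lambda>t. weak_deriv (H01_deriv (u t)))"

text \<open>The identity between \<open>L2\<close>-valued integrals that defines $u_t=w$ in the sense of distributions,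
  tested against every \<open>v\<close> in \<open>L2\<close>.\<close>

definition has_time_deriv :: "real \<Rightarrow> (real \<Rightarrow> L2) \<Rightarrow> (real \<Rightarrow> L2) \<Rightarrow> bool" where
  "has_time_deriv T u w \<longleftrightarrow> (\<forall>\<phi> \<in> Cc_infty {0<..<T}. \<forall>v.
     (\<integral>t. inner (u t) v * deriv \<phi> t \<partial>lebesgue_on {0<..<T}) =
     - (\<integral>t. inner (w t) v * \<phi> t \<partial>lebesgue_on {0<..<T}))"

text \<open>Solutions live on $[0,\infty)$: the values of \<open>u\<close> at negative times are irrelevant. A solution is identified
  with its representative in $C([0,\infty);H^1_0)$, so that \<open>u t\<close> is meaningful for every $t\ge0$.\<close>

definition strong_solutions ::
    "(real \<Rightarrow> real) \<Rightarrow> (real \<Rightarrow> real) \<Rightarrow> real \<Rightarrow> L2 \<Rightarrow> (real \<Rightarrow> H01) set" where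
  "strong_solutions a f lam h = {u. continuous_on {0..} u \<and> (\<forall>T>0.
     Linf_time T u \<and> L2_time_H2 T u \<and>
     (\<exists>w. L2_time T w \<and> has_time_deriv T (\<lambda>t. L2_of (u t)) w) \<and>
     (\<forall>v::H01. \<forall>\<phi> \<in> Cc_infty {0<..<T}.
        - (\<integral>t. inner (L2_of (u t)) (L2_of v) * deriv \<phi> t \<partial>lebesgue_on {0<..<T})
        + (\<integral>t. a ((norm (u t))\<^sup>2) * inner (H01_deriv (u t)) (H01_deriv v) * \<phi> t
             \<partial>lebesgue_on {0<..<T})
        = (\<integral>t. (lam * inner (nemytskii f (u t)) (L2_of v) + inner h (L2_of v)) * \<phi> t
             \<partial>lebesgue_on {0<..<T})))}"

definition stationary_points ::
    "(real \<Rightarrow> real) \<Rightarrow> (real \<Rightarrow> real) \<Rightarrow> real \<Rightarrow> L2 \<Rightarrow> H01 set" where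
  "stationary_points a f lam h = {z. L2_of z \<in> H2 \<and>
     - a ((norm z)\<^sup>2) *\<^sub>R weak_deriv (H01_deriv z) = lam *\<^sub>R nemytskii f z + h}"

definition semiflow :: "(real \<Rightarrow> 'a) set \<Rightarrow> real \<Rightarrow> 'a \<Rightarrow> 'a set" where
  "semiflow R t u0 = {u t | u. u \<in> R \<and> u 0 = u0}"

text \<open>Distances take values in $[0,\infty]$, so that the distance to the empty set is $\infty$.\<close>

definition set_dist :: "'a::metric_space \<Rightarrow> 'a set \<Rightarrow> ennreal" where
  "set_dist x S = (INF y\<in>S. ennreal (dist x y))"

definition Hausdorff_semidist :: "'a::metric_space set \<Rightarrow> 'a set \<Rightarrow> ennreal" where
  "Hausdorff_semidist S S' = (SUP x\<in>S. set_dist x S')"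

definition global_attractor :: "(real \<Rightarrow> 'a::metric_space \<Rightarrow> 'a set) \<Rightarrow> 'a set \<Rightarrow> bool" where
  "global_attractor G A \<longleftrightarrow> compact A \<and> (\<forall>t\<ge>0. A = (\<Union>u0\<in>A. G t u0)) \<and>
     (\<forall>B. bounded B \<longrightarrow> ((\<lambda>t. Hausdorff_semidist (\<Union>u0\<in>B. G t u0) A) \<longlongrightarrow> 0) at_top)"

definition complete_trajectories :: "(real \<Rightarrow> 'a) set \<Rightarrow> (real \<Rightarrow> 'a) set" where
  "complete_trajectories R = {\<gamma>. \<forall>s. (\<lambda>t. \<gamma> (t + s)) \<in> R}"

definition bounded_complete_trajectories ::
    "(real \<Rightarrow> 'a::metric_space) set \<Rightarrow> (real \<Rightarrow> 'a) set" where
  "bounded_complete_trajectories R = {\<gamma> \<in> complete_trajectories R. bounded (range \<gamma>)}"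

definition M_plus :: "(real \<Rightarrow> 'a::metric_space) set \<Rightarrow> 'a set \<Rightarrow> 'a set" where
  "M_plus R Z = {z. \<exists>\<gamma> \<in> bounded_complete_trajectories R.
     \<gamma> 0 = z \<and> ((\<lambda>t. set_dist (\<gamma> t) Z) \<longlongrightarrow> 0) at_top}"

definition M_minus :: "(real \<Rightarrow> 'a::metric_space) set \<Rightarrow> 'a set \<Rightarrow> 'a set" where
  "M_minus R Z = {z. \<exists>\<gamma> \<in> complete_trajectories R.
     \<gamma> 0 = z \<and> ((\<lambda>t. set_dist (\<gamma> t) Z) \<longlongrightarrow> 0) at_bot}"

end

theory Submission
  imports Defs
begin

text \<open>Existence, compactness and dissipativity enter only through the assumption that the attractor
  exists, so the theorem reduces to an energy inequality. If \<open>\<alpha>\<close> is an antiderivative of \<open>a\<close> and \<open>F\<close> one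
  of \<open>f\<close>, then
  \<open>E(u) = \<alpha>(\<parallel>u\<parallel>\<^sup>2)/2 - \<lambda> \<integral> F(u) - (h, u)\<close> satisfies
  \<open>E(u(T)) + \<parallel>u(T) - u(s)\<parallel>\<^sup>2/(T - s) \<le> E(u(s))\<close> (\<open>L\<^sup>2\<close>-norm on the left) along strong solutions.
  On a complete trajectory \<open>\<gamma>\<close> inside the compact set \<open>A\<close> the energy is bounded and monotone, so
  \<open>\<gamma>(t + r) - \<gamma>(t) \<rightarrow> 0\<close> in \<open>L\<^sup>2\<close>, uniformly in \<open>r \<in> [0,1]\<close>, as \<open>t \<rightarrow> \<plusminus>\<infinity>\<close>; since the topologies of
  \<open>L\<^sup>2\<close> and \<open>H\<^sup>1\<^sub>0\<close> agree on \<open>A\<close>, the weak formulation shows that the limit points of \<open>\<gamma>\<close> at \<open>\<plusminus>\<infinity>\<close> are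
  stationary. Invariance of \<open>A\<close>, with the concatenation of solutions, gives such a trajectory through each
  point of \<open>A\<close>; conversely a trajectory that is bounded in the past lies in \<open>A\<close> because \<open>A\<close> attracts
  bounded sets.

  The energy inequality is proved without differentiating \<open>\<parallel>u(t)\<parallel>\<^sup>2\<close> (the Lions--Magenes lemma).
  Pairings \<open>(u(t), v)\<close> are continuously differentiable, hence so is \<open>\<parallel>u(r) - u(t)\<parallel>\<^sup>2\<close> in \<open>r\<close>, and
  convexity of the \<open>H\<^sup>1\<^sub>0\<close>-norm bounds it by an integral over \<open>[t, r]\<close> of increments of \<open>\<parallel>u\<parallel>\<^sup>2\<close>
  starting from \<open>t\<close>. The global inequality then follows because a continuous function \<open>K\<close> with
  \<open>K(T) < K(s)\<close> has a last point \<open>t < T\<close> at which it attains the value \<open>K(s)\<close>.\<close>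

section \<open>Primitives and distributional derivatives\<close>

text \<open>The times in \<open>{s..T}\<close> at which \<open>K\<close> is at least
  \<open>K s\<close> form a closed set, so they have a last one; by \<open>step\<close> it cannot be
  earlier than \<open>T\<close>. For merely continuous \<open>K\<close> this takes the place of a
  sign condition on the derivative: local comparisons, each starting at its own \<open>t\<close>,
  add up to a global one.\<close>

lemma le_if_no_last_record:
  fixes K :: "real \<Rightarrow> real"
  assumes "s \<le> T" and K: "continuous_on {s..T} K"
    and step: "\<And>t. s \<le> t \<Longrightarrow> t < T \<Longrightarrow> \<exists>r. t < r \<and> r \<le> T \<and> K t \<le> K r"
  shows "K s \<le> K T"
proof -
  define S where "S = {t \<in> {s..T}. K s \<le> K t}"
  have "closed S"
    unfolding S_def by (intro continuous_on_closed_Collect_le K continuous_on_const closed_atLeastAtMost)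
  moreover have S: "s \<in> S" "bdd_above S"
    using assms(1) by (auto simp: S_def bdd_above_def)
  ultimately have "Sup S \<in> S"
    by (intro closed_contains_Sup) auto
  then have t: "s \<le> Sup S" "Sup S \<le> T" "K s \<le> K (Sup S)"
    by (auto simp: S_def)
  show ?thesis
  proof (cases "Sup S < T")
    case True
    with step[OF t(1)] obtain r where r: "Sup S < r" "r \<le> T" "K (Sup S) \<le> K r"
      by blast
    then have "r \<in> S"
      using t by (auto simp: S_def)
    then have "r \<le> Sup S"
      using S by (intro cSup_upper)
    with r show ?thesis by simp
  qed (use t in auto)
qed

section \<open>Lebesgue integrals on open intervals and gauge integrals on closed ones\<close>

lemma integral_lebesgue_on_Ioo_eq:
  fixes g :: "real \<Rightarrow> real"
  assumes "integrable (lebesgue_on {c<..<d}) g"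
  shows "integral\<^sup>L (lebesgue_on {c<..<d}) g = integral {c..d} g" "g absolutely_integrable_on {c..d}"
proof -
  show "integral\<^sup>L (lebesgue_on {c<..<d}) g = integral {c..d} g"
    using lebesgue_integral_eq_integral[OF assms] by (simp add: integral_open_interval_real)
  have "g absolutely_integrable_on {c<..<d}"
    using assms by (simp add: integrable_restrict_space set_integrable_def)
  then show "g absolutely_integrable_on {c..d}"
    by (rule absolutely_integrable_spike_set) (auto intro: negligible_subset[of "{c,d}"])
qed

lemma continuous_imp_integrable_lebesgue_on_Ioo:
  fixes g :: "real \<Rightarrow> real"
  assumes "continuous_on {c..d} g"
  shows "integrable (lebesgue_on {c<..<d}) g"
proof -
  have "g absolutely_integrable_on {c<..<d}"
    by (rule set_integrable_subset[of _ "{c..d}"])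
      (use assms in \<open>auto intro!: absolutely_integrable_continuous_real\<close>)
  then show ?thesis
    by (simp add: integrable_restrict_space set_integrable_def)
qed

lemma integrable_lebesgue_on_mult_continuous:
  fixes g \<psi> :: "real \<Rightarrow> real"
  assumes "continuous_on {c..d} g" and \<psi>: "integrable (lebesgue_on {c<..<d}) \<psi>"
  shows "integrable (lebesgue_on {c<..<d}) (\<lambda>x. \<psi> x * g x)"
proof -
  have m: "g \<in> borel_measurable (lebesgue_on {c<..<d})"
    by (intro continuous_imp_measurable_on_sets_lebesgue continuous_on_subset[OF assms(1)]) auto
  have "bounded (g ` {c..d})"
    using assms compact_continuous_image compact_imp_bounded by blast
  then obtain B where B: "\<And>x. x \<in> {c..d} \<Longrightarrow> \<bar>g x\<bar> \<le> B"
    by (fastforce simp: bounded_iff)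
  show ?thesis
  proof (rule Bochner_Integration.integrable_bound[of _ "\<lambda>x. B * \<psi> x"])
    show "AE x in lebesgue_on {c<..<d}. norm (\<psi> x * g x) \<le> norm (B * \<psi> x)"
    proof (rule AE_I2)
      fix x assume "x \<in> space (lebesgue_on {c<..<d})"
      then have "\<bar>g x\<bar> \<le> \<bar>B\<bar>" using B[of x] by auto
      then show "norm (\<psi> x * g x) \<le> norm (B * \<psi> x)"
        by (simp add: abs_mult mult.commute[of "\<bar>B\<bar>"] mult_left_mono)
    qed
  qed (use \<psi> m in \<open>auto intro!: borel_measurable_times\<close>)
qed

lemma has_integral_indicator_Ioo:
  fixes \<psi> :: "real \<Rightarrow> real"
  assumes \<psi>: "integrable (lebesgue_on {c<..<d}) \<psi>" and st: "c \<le> s" "t \<le> d"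
  shows "(\<psi> has_integral (\<integral>x. \<psi> x * indicator {s<..<t} x \<partial>lebesgue_on {c<..<d})) {s..t}"
proof -
  let ?I = "\<integral>x. \<psi> x * indicator {s<..<t} x \<partial>lebesgue_on {c<..<d}"
  have int: "integrable (lebesgue_on {c<..<d}) (\<lambda>x. \<psi> x * indicator {s<..<t} x)"
    by (rule integrable_real_mult_indicator[OF _ \<psi>]) (use st in \<open>auto simp: sets_restrict_space_iff\<close>)
  then have "((\<lambda>x. \<psi> x * indicator {s<..<t} x) has_integral ?I) {c<..<d}"
    by (rule has_integral_integral_lebesgue_on) simp
  then have "((\<lambda>x. if x \<in> {c<..<d} then \<psi> x * indicator {s<..<t} x else 0) has_integral ?I) UNIV"
    by (simp only: has_integral_restrict_UNIV)
  also have "(\<lambda>x. if x \<in> {c<..<d} then \<psi> x * indicator {s<..<t} x else 0) = (\<lambda>x. if x \<in> {s<..<t} then \<psi> x else 0)"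
    using st by (auto simp: fun_eq_iff)
  finally have "(\<psi> has_integral ?I) {s<..<t}"
    by (simp only: has_integral_restrict_UNIV)
  then show ?thesis
    using has_integral_Icc_iff_Ioo by blast
qed

text \<open>The Newton-Leibniz form of "\<open>\<psi>\<close> is the derivative of
  \<open>\<phi>\<close>". It speaks of subintervals instead of test functions, so it restricts,
  shifts and concatenates directly. The gauge integral carries integrability with it.\<close>

definition primitive_on :: "real \<Rightarrow> (real \<Rightarrow> real) \<Rightarrow> (real \<Rightarrow> real) \<Rightarrow> bool" where
  "primitive_on T \<phi> \<psi> \<longleftrightarrow>
     (\<forall>s t. 0 \<le> s \<longrightarrow> s \<le> t \<longrightarrow> t \<le> T \<longrightarrow> (\<psi> has_integral (\<phi> t - \<phi> s)) {s..t})"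

definition distrib_deriv_on :: "real \<Rightarrow> (real \<Rightarrow> real) \<Rightarrow> (real \<Rightarrow> real) \<Rightarrow> bool" where
  "distrib_deriv_on T \<phi> \<psi> \<longleftrightarrow> (\<forall>\<theta> \<in> Cc_infty {0<..<T}.
     (\<integral>t. \<phi> t * deriv \<theta> t \<partial>lebesgue_on {0<..<T}) = - (\<integral>t. \<psi> t * \<theta> t \<partial>lebesgue_on {0<..<T}))"

lemma smooth_step:
  obtains P where "smooth P" "\<And>x. x \<le> 0 \<Longrightarrow> P x = 0" "\<And>x. x \<ge> 1 \<Longrightarrow> P x = 1"
    "\<And>x. 0 \<le> deriv P x" "\<And>x. 0 \<le> P x" "\<And>x. P x \<le> 1"
proof -
  \<comment> \<open>A bump supported in \<open>{0..1}\<close>; the step is its primitive, normalized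
    by the total mass.\<close>
  define B where "B x = flat 1 (1 * x + 0) * flat 1 (- 1 * x + 1)" for x
  have sB: "smooth B"
    unfolding B_def by (intro smooth_mult smooth_affine smooth_flat)
  have B0: "B x \<ge> 0" for x by (simp add: B_def flat_def)
  have Bz: "B x = 0" if "x \<le> 0 \<or> x \<ge> 1" for x using that by (auto simp: B_def flat_def)
  have cB: "continuous_on S B" for S using sB by (rule smooth_continuous_on)
  have iB: "B integrable_on {u..v}" for u v
    by (intro integrable_continuous_real cB)
  \<comment> \<open>The base point -1 lies strictly left of the support, so \<open>Q\<close> has a
    two-sided derivative at 0 as well; for smaller \<open>x\<close> the interval is empty and
    \<open>Q x = 0\<close>.\<close>
  define Q where "Q x = integral {-1..x} B" for x
  have Qneg: "Q x = 0" if "x \<le> 0" for x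
    unfolding Q_def by (rule integral_unique, rule has_integral_is_0) (use that Bz in auto)
  have dQ: "(Q has_field_derivative B x) (at x)" for x
  proof (cases "x < 0")
    case True
    have "(Q has_field_derivative 0) (at x)"
      by (rule has_field_derivative_transform_within_open[of "\<lambda>_. 0" _ _ "{..<0}"])
        (use True Qneg in auto)
    then show ?thesis using Bz True by simp
  next
    case False
    have "(Q has_vector_derivative B x) (at x within {-1..x+1})"
      unfolding Q_def by (rule integral_has_vector_derivative) (use False cB in auto)
    then have "(Q has_vector_derivative B x) (at x)"
      by (subst (asm) at_within_Icc_at) (use False in auto)
    then show ?thesis by (simp add: has_real_derivative_iff_has_vector_derivative)
  qed
  have derivQ: "deriv Q = B" using DERIV_imp_deriv[OF dQ] by blast
  have sQ: "smooth Q"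
    by (subst smooth_iff) (use dQ derivQ sB in \<open>auto simp: field_differentiable_def\<close>)
  have mono: "Q x \<le> Q y" if "x \<le> y" for x y
    using DERIV_nonneg_imp_nondecreasing[OF that] dQ B0 by blast
  have "B (1/2) > 0" by (simp add: B_def flat_def)
  \<comment> \<open>Otherwise monotonicity makes \<open>Q\<close> vanish up to 1, against its
    derivative \<open>B (1/2) > 0\<close>.\<close>
  have Q1: "Q 1 > 0"
  proof (rule ccontr)
    assume "\<not> Q 1 > 0"
    then have Q1: "Q 1 \<le> 0" by simp
    have "Q x = 0" if "x \<le> 1" for x
    proof -
      have "Q x \<le> Q 1" "Q (min x 0) \<le> Q x" "Q (min x 0) = 0"
        using that by (auto intro: mono Qneg)
      then show ?thesis using Q1 by linarith
    qed
    then have zero: "0 = Q x" if "x \<in> {..<1}" for x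
      using that by simp
    have "(Q has_field_derivative 0) (at (1/2))"
      by (rule has_field_derivative_transform_within_open[OF DERIV_const open_lessThan _ zero]) auto
    from DERIV_unique[OF dQ this] have "B (1/2) = 0" .
    then show False using \<open>B (1/2) > 0\<close> by simp
  qed
  have Qge1: "Q x = Q 1" if "x \<ge> 1" for x
  proof -
    have "integral {-1..1} B + integral {1..x} B = Q x"
      unfolding Q_def by (rule Henstock_Kurzweil_Integration.integral_combine) (use that iB in auto)
    moreover have "integral {1..x} B = 0"
      by (rule integral_unique, rule has_integral_is_0) (use Bz in auto)
    ultimately show ?thesis by (simp add: Q_def)
  qed
  define P where "P x = (1 / Q 1) * Q x" for x
  have dP: "(P has_field_derivative (1 / Q 1) * B x) (at x)" for x
    unfolding P_def by (rule DERIV_cmult[OF dQ])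
  show thesis
  proof
    show "smooth P" unfolding P_def by (rule smooth_mult[OF smooth_const sQ])
    show "P x = 0" if "x \<le> 0" for x using Qneg that by (simp add: P_def)
    show "P x = 1" if "x \<ge> 1" for x using Qge1[OF that] Q1 by (simp add: P_def)
    show "0 \<le> deriv P x" for x using DERIV_imp_deriv[OF dP] B0 Q1 by simp
    show "0 \<le> P x" for x
    proof -
      have "Q (min x 0) \<le> Q x" "Q (min x 0) = 0" by (auto intro: mono Qneg)
      then show ?thesis using Q1 by (simp add: P_def)
    qed
    show "P x \<le> 1" for x
    proof -
      have "Q x \<le> Q (max x 1)" "Q (max x 1) = Q 1" by (auto intro: mono Qge1)
      then show ?thesis using Q1 by (simp add: P_def)
    qed
  qed
qed

text \<open>The derivative of \<open>Q\<close> is a nonnegative weight of total mass 1 concentrated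
  on \<open>{\<alpha>..\<beta>}\<close>, so the integral is an average of \<open>\<phi>\<close> over
  that interval.\<close>

lemma integral_mult_deriv_step:
  assumes \<phi>: "continuous_on {0..T} \<phi>" and Q: "smooth Q" "\<And>x. 0 \<le> deriv Q x"
    and z: "\<And>x. x \<le> \<alpha> \<Longrightarrow> Q x = 0" "\<And>x. x \<ge> \<beta> \<Longrightarrow> Q x = 1" "0 \<le> \<alpha>" "\<alpha> < \<beta>" "\<beta> \<le> T"
    and L: "\<And>x. x \<in> {\<alpha>..\<beta>} \<Longrightarrow> \<bar>\<phi> x - L\<bar> \<le> e"
  shows "\<bar>integral {0..T} (\<lambda>x. \<phi> x * deriv Q x) - L\<bar> \<le> e"
proof -
  have cQ: "continuous_on {0..T} (deriv Q)"
    using Q smooth_deriv smooth_continuous_on by blast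
  have 1: "(deriv Q has_integral (Q T - Q 0)) {0..T}"
    by (rule fundamental_theorem_of_calculus)
      (use z smooth_DERIV[OF Q(1)] in \<open>auto simp: has_real_derivative_iff_has_vector_derivative[symmetric]
          intro: has_field_derivative_at_within\<close>)
  have d0: "deriv Q x = 0" if "x \<notin> {\<alpha>..\<beta>}" for x
  proof (cases "x < \<alpha>")
    case True
    have "(Q has_field_derivative 0) (at x)"
      by (rule has_field_derivative_transform_within_open[of "\<lambda>_. 0" _ _ "{..<\<alpha>}"]) (use True z in auto)
    then show ?thesis by (rule DERIV_imp_deriv)
  next
    case False
    then have "x > \<beta>" using that by auto
    have "(Q has_field_derivative 0) (at x)"
      by (rule has_field_derivative_transform_within_open[of "\<lambda>_. 1" _ _ "{\<beta><..}"])
        (use \<open>x > \<beta>\<close> z in auto)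
    then show ?thesis by (rule DERIV_imp_deriv)
  qed
  have Q01: "Q T - Q 0 = 1" using z by auto
  have 2: "((\<lambda>x. \<phi> x * deriv Q x) has_integral integral {0..T} (\<lambda>x. \<phi> x * deriv Q x)) {0..T}"
    by (intro integrable_integral integrable_continuous_real continuous_intros \<phi> cQ)
  have 3: "((\<lambda>x. \<phi> x * deriv Q x - L * deriv Q x) has_integral
      integral {0..T} (\<lambda>x. \<phi> x * deriv Q x) - L) {0..T}"
    using has_integral_diff[OF 2 has_integral_mult_right[OF 1, of L]] Q01 by simp
  have "norm (integral {0..T} (\<lambda>x. \<phi> x * deriv Q x - L * deriv Q x)) \<le> integral {0..T} (\<lambda>x. e * deriv Q x)"
  proof (rule integral_norm_bound_integral)
    show "(\<lambda>x. \<phi> x * deriv Q x - L * deriv Q x) integrable_on {0..T}" using 3 by blast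
    show "(\<lambda>x. e * deriv Q x) integrable_on {0..T}" using has_integral_mult_right[OF 1] by blast
    fix x assume "x \<in> {0..T}"
    show "norm (\<phi> x * deriv Q x - L * deriv Q x) \<le> e * deriv Q x"
    proof (cases "x \<in> {\<alpha>..\<beta>}")
      case True
      have "norm (\<phi> x * deriv Q x - L * deriv Q x) = \<bar>\<phi> x - L\<bar> * deriv Q x"
        using Q(2)[of x] by (simp add: abs_mult flip: left_diff_distrib)
      then show ?thesis using L[OF True] Q(2) by (simp add: mult_right_mono)
    qed (use d0 in auto)
  qed
  also have "integral {0..T} (\<lambda>x. e * deriv Q x) = e"
    using integral_unique[OF has_integral_mult_right[OF 1, of e]] Q01 by (simp del: integral_mult_right)
  finally show ?thesis using 3 by (simp add: integral_unique)
qed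

text \<open>Tested against smooth cutoffs \<open>\<theta> n = Q n - R n\<close> that tend to the indicator of \<open>(s, t)\<close>, whose derivatives
  concentrate at \<open>s\<close> and \<open>t\<close>.\<close>

lemma primitive_on_if_distrib_deriv_on:
  assumes \<phi>: "continuous_on {0..T} \<phi>" and \<psi>: "integrable (lebesgue_on {0<..<T}) \<psi>"
    and d: "distrib_deriv_on T \<phi> \<psi>"
  shows "primitive_on T \<phi> \<psi>"
  unfolding primitive_on_def
proof (intro allI impI)
  fix s t :: real assume st: "0 \<le> s" "s \<le> t" "t \<le> T"
  show "(\<psi> has_integral (\<phi> t - \<phi> s)) {s..t}"
  proof (cases "s = t")
    case False
    with st have "s < t" by simp
    obtain P where P: "smooth P" "\<And>x. x \<le> 0 \<Longrightarrow> P x = 0" "\<And>x. x \<ge> 1 \<Longrightarrow> P x = 1"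
      "\<And>x. 0 \<le> deriv P x" "\<And>x. 0 \<le> P x" "\<And>x. P x \<le> 1" by (fact smooth_step)
    \<comment> \<open>The summand \<open>3 / (t - s)\<close> gives
      \<open>k n * (t - s) \<ge> 3\<close> for every \<open>n\<close>. Hence \<open>R n\<close>
      still vanishes where \<open>k n * (x - s) \<le> 1\<close>, and \<open>Q n\<close> is already 1
      where \<open>k n * (t - x) \<le> 1\<close>, so the difference is a cutoff from the first index
      on.\<close>
    define k where "k n = real n + 1 + 3 / (t - s)" for n :: nat
    have k: "k n > 0" "k n * (t - s) \<ge> 3" for n
    proof -
      show "k n > 0" unfolding k_def using \<open>s < t\<close> by (intro add_nonneg_pos) auto
      have "k n * (t - s) = (real n + 1) * (t - s) + 3"
        using \<open>s < t\<close> by (simp add: k_def field_simps)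
      then show "k n * (t - s) \<ge> 3" using \<open>s < t\<close> by simp
    qed
    have k_large: "\<forall>\<^sub>F n in sequentially. c \<le> k n" for c
    proof -
      have "\<forall>\<^sub>F n in sequentially. c \<le> real n"
        using filterlim_real_sequentially by (auto simp: filterlim_at_top)
      then show ?thesis
        by eventually_elim (use \<open>s < t\<close> in \<open>simp add: k_def add_increasing2\<close>)
    qed
    \<comment> \<open>\<open>Q n\<close> rises between \<open>s + 1 / k n\<close> and
      \<open>s + 2 / k n\<close>, \<open>R n\<close> between \<open>t - 2 / k n\<close> and
      \<open>t - 1 / k n\<close>. Staying strictly inside \<open>(s, t)\<close> keeps the support
      compact in \<open>(0, T)\<close> even if \<open>s = 0\<close> or \<open>t = T\<close>.\<close>
    define Q R where "Q n x = P (k n * x + (- k n * s - 1))" and "R n x = P (k n * x + (- k n * t + 2))" for n x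
    have sQ: "smooth (Q n)" and sR: "smooth (R n)" for n
      unfolding Q_def R_def by (intro smooth_affine P)+
    have dQR: "0 \<le> deriv (\<lambda>x. P (k n * x + c)) x" for n c x
    proof -
      have "((\<lambda>x. P (k n * x + c)) has_field_derivative deriv P (k n * x + c) * k n) (at x)"
        by (rule DERIV_chain2[OF smooth_DERIV[OF P(1)]]) (auto intro!: derivative_eq_intros)
      then have "deriv (\<lambda>x. P (k n * x + c)) x = deriv P (k n * x + c) * k n"
        by (rule DERIV_imp_deriv)
      then show ?thesis using P(4) k(1)[of n] by simp
    qed
    have Q0: "Q n x = 0" if "k n * (x - s) \<le> 1" for n x
      unfolding Q_def using that by (intro P) (simp add: algebra_simps)
    have Q1: "Q n x = 1" if "k n * (x - s) \<ge> 2" for n x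
      unfolding Q_def using that by (intro P) (simp add: algebra_simps)
    have R0: "R n x = 0" if "k n * (t - x) \<ge> 2" for n x
      unfolding R_def using that by (intro P) (simp add: algebra_simps)
    have R1: "R n x = 1" if "k n * (t - x) \<le> 1" for n x
      unfolding R_def using that by (intro P) (simp add: algebra_simps)
    have sum: "k n * (x - s) + k n * (t - x) = k n * (t - s)" for n x
      by (simp add: algebra_simps)
    define \<theta> where "\<theta> n x = Q n x + (-1) * R n x" for n x
    have \<theta>_test: "\<theta> n \<in> Cc_infty {0<..<T}" for n
    proof -
      have "smooth (\<theta> n)"
        unfolding \<theta>_def by (intro smooth_add smooth_mult smooth_const sQ sR)
      moreover have "{s + 1 / k n..t - 1 / k n} \<subseteq> {0<..<T}"
      proof -
        have "1 / k n > 0" using k(1)[of n] by simp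
        then have "0 < x \<and> x < T" if "x \<in> {s + 1 / k n..t - 1 / k n}" for x
          using st that by (auto simp del: zero_less_divide_iff zero_less_divide_1_iff)
        then show ?thesis by auto
      qed
      moreover have "\<theta> n x = 0" if "x \<notin> {s + 1 / k n..t - 1 / k n}" for x
      proof -
        have "k n * (x - s) \<le> 1 \<or> k n * (t - x) \<le> 1"
        proof -
          have "x - s < 1 / k n \<or> t - x < 1 / k n" using that by auto
          then show ?thesis using k(1)[of n] by (auto simp: field_simps)
        qed
        then show ?thesis
        proof
          assume "k n * (x - s) \<le> 1"
          then show ?thesis using sum[of n x] k(2)[of n] Q0[of n x] R0[of n x] by (simp add: \<theta>_def)
        next
          assume "k n * (t - x) \<le> 1"
          then show ?thesis using sum[of n x] k(2)[of n] Q1[of n x] R1[of n x] by (simp add: \<theta>_def)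
        qed
      qed
      ultimately show ?thesis unfolding Cc_infty_def by blast
    qed
    have \<theta>_deriv: "deriv (\<theta> n) x = deriv (Q n) x - deriv (R n) x" for n x
    proof -
      have "(\<theta> n has_field_derivative (deriv (Q n) x + (-1) * deriv (R n) x)) (at x)"
        unfolding \<theta>_def by (intro DERIV_add DERIV_cmult smooth_DERIV sQ sR)
      then show ?thesis using DERIV_imp_deriv by force
    qed
    have local: "\<exists>d>0. \<forall>x\<in>{0..T}. \<bar>x - r\<bar> < d \<longrightarrow> \<bar>\<phi> x - \<phi> r\<bar> \<le> e" if "r \<in> {0..T}" "e > 0" for r e
      using \<phi>[unfolded continuous_on_iff, rule_format, OF that]
      by (auto simp: dist_real_def intro: less_imp_le)
    have limQ: "(\<lambda>n. integral {0..T} (\<lambda>x. \<phi> x * deriv (Q n) x)) \<longlonglongrightarrow> \<phi> s"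
    proof (rule LIMSEQ_I)
      fix e :: real assume "e > 0"
      then obtain d where d: "d > 0" "\<And>x. x \<in> {0..T} \<Longrightarrow> \<bar>x - s\<bar> < d \<Longrightarrow> \<bar>\<phi> x - \<phi> s\<bar> \<le> e / 2"
        using local[of s "e / 2"] st by auto
      from k_large[of "3 / d"] obtain N where N: "\<And>n. n \<ge> N \<Longrightarrow> 3 / d \<le> k n"
        by (auto simp: eventually_sequentially)
      have "\<bar>integral {0..T} (\<lambda>x. \<phi> x * deriv (Q n) x) - \<phi> s\<bar> \<le> e / 2" if "n \<ge> N" for n
      proof (rule integral_mult_deriv_step[OF \<phi> sQ])
        have kn: "k n > 0" "3 \<le> k n * (t - s)" "3 \<le> k n * d"
          using k[of n] N[OF that] d(1) by (auto simp: field_simps)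
        show "0 \<le> deriv (Q n) x" for x unfolding Q_def by (rule dQR)
        show "Q n x = 0" if "x \<le> s + 1 / k n" for x
          by (rule Q0) (use that kn in \<open>simp add: field_simps\<close>)
        show "Q n x = 1" if "x \<ge> s + 2 / k n" for x
          by (rule Q1) (use that kn in \<open>simp add: field_simps\<close>)
        show "0 \<le> s + 1 / k n" "s + 1 / k n < s + 2 / k n"
          using st kn by (auto simp: field_simps)
        have "2 / k n \<le> t - s" "2 / k n < d" using kn by (auto simp: field_simps)
        then show "s + 2 / k n \<le> T" using st by linarith
        fix x assume "x \<in> {s + 1 / k n..s + 2 / k n}"
        moreover have "1 / k n > 0" using kn by simp
        ultimately have "x \<in> {0..T}" "\<bar>x - s\<bar> < d"
          using \<open>2 / k n \<le> t - s\<close> \<open>2 / k n < d\<close> st by auto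
        then show "\<bar>\<phi> x - \<phi> s\<bar> \<le> e / 2" by (rule d(2))
      qed
      then show "\<exists>no. \<forall>n\<ge>no. norm (integral {0..T} (\<lambda>x. \<phi> x * deriv (Q n) x) - \<phi> s) < e"
        using \<open>e > 0\<close> by (intro exI[of _ N]) (force simp del: integral_mult_right)
    qed
    have limR: "(\<lambda>n. integral {0..T} (\<lambda>x. \<phi> x * deriv (R n) x)) \<longlonglongrightarrow> \<phi> t"
    proof (rule LIMSEQ_I)
      fix e :: real assume "e > 0"
      then obtain d where d: "d > 0" "\<And>x. x \<in> {0..T} \<Longrightarrow> \<bar>x - t\<bar> < d \<Longrightarrow> \<bar>\<phi> x - \<phi> t\<bar> \<le> e / 2"
        using local[of t "e / 2"] st by auto
      from k_large[of "3 / d"] obtain N where N: "\<And>n. n \<ge> N \<Longrightarrow> 3 / d \<le> k n"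
        by (auto simp: eventually_sequentially)
      have "\<bar>integral {0..T} (\<lambda>x. \<phi> x * deriv (R n) x) - \<phi> t\<bar> \<le> e / 2" if "n \<ge> N" for n
      proof (rule integral_mult_deriv_step[OF \<phi> sR])
        have kn: "k n > 0" "3 \<le> k n * (t - s)" "3 \<le> k n * d"
          using k[of n] N[OF that] d(1) by (auto simp: field_simps)
        show "0 \<le> deriv (R n) x" for x unfolding R_def by (rule dQR)
        show "R n x = 0" if "x \<le> t - 2 / k n" for x
          by (rule R0) (use that kn in \<open>simp add: field_simps\<close>)
        show "R n x = 1" if "x \<ge> t - 1 / k n" for x
          by (rule R1) (use that kn in \<open>simp add: field_simps\<close>)
        have pos: "1 / k n > 0" using kn by simp
        show "t - 2 / k n < t - 1 / k n" using kn by (auto simp: field_simps)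
        have "2 / k n \<le> t - s" "2 / k n < d" using kn by (auto simp: field_simps)
        then show "0 \<le> t - 2 / k n" "t - 1 / k n \<le> T" using st pos by linarith+
        fix x assume "x \<in> {t - 2 / k n..t - 1 / k n}"
        with pos have "x \<in> {0..T}" "\<bar>x - t\<bar> < d"
          using \<open>2 / k n \<le> t - s\<close> \<open>2 / k n < d\<close> st by auto
        then show "\<bar>\<phi> x - \<phi> t\<bar> \<le> e / 2" by (rule d(2))
      qed
      then show "\<exists>no. \<forall>n\<ge>no. norm (integral {0..T} (\<lambda>x. \<phi> x * deriv (R n) x) - \<phi> t) < e"
        using \<open>e > 0\<close> by (intro exI[of _ N]) (force simp del: integral_mult_right)
    qed
    have c: "continuous_on {0..T} (\<lambda>x. \<phi> x * deriv (Q n) x)" "continuous_on {0..T} (\<lambda>x. \<phi> x * deriv (R n) x)" for n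
      by (intro continuous_on_mult \<phi> smooth_continuous_on smooth_deriv sQ sR)+
    have "(\<integral>x. \<phi> x * deriv (\<theta> n) x \<partial>lebesgue_on {0<..<T}) =
        integral {0..T} (\<lambda>x. \<phi> x * deriv (Q n) x) - integral {0..T} (\<lambda>x. \<phi> x * deriv (R n) x)" for n
      unfolding \<theta>_deriv right_diff_distrib
      by (subst Bochner_Integration.integral_diff)
        (simp_all only: integral_lebesgue_on_Ioo_eq(1) continuous_imp_integrable_lebesgue_on_Ioo c)
    then have lhs: "(\<lambda>n. - (\<integral>x. \<psi> x * \<theta> n x \<partial>lebesgue_on {0<..<T})) \<longlonglongrightarrow> \<phi> s - \<phi> t"
      using tendsto_diff[OF limQ limR] d[unfolded distrib_deriv_on_def] \<theta>_test by simp
    have rhs: "(\<lambda>n. \<integral>x. \<psi> x * \<theta> n x \<partial>lebesgue_on {0<..<T}) \<longlonglongrightarrow>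
        (\<integral>x. \<psi> x * indicator {s<..<t} x \<partial>lebesgue_on {0<..<T})"
    proof (rule integral_dominated_convergence[where w = "\<lambda>x. \<bar>\<psi> x\<bar>"])
      have m: "\<psi> \<in> borel_measurable (lebesgue_on {0<..<T})" using \<psi> by auto
      show "(\<lambda>x. \<psi> x * indicat_real {s<..<t} x) \<in> borel_measurable (lebesgue_on {0<..<T})"
        by (intro borel_measurable_times m measurable_restrict_space1 borel_measurable_indicator) auto
      show "(\<lambda>x. \<psi> x * \<theta> n x) \<in> borel_measurable (lebesgue_on {0<..<T})" for n
        by (intro borel_measurable_times m continuous_imp_measurable_on_sets_lebesgue
            smooth_continuous_on Cc_inftyD[OF \<theta>_test]) auto
      show "AE x in lebesgue_on {0<..<T}. (\<lambda>n. \<psi> x * \<theta> n x) \<longlonglongrightarrow> \<psi> x * indicat_real {s<..<t} x"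
      proof (intro AE_I2 tendsto_mult tendsto_const)
        fix x :: real
        have "\<forall>\<^sub>F n in sequentially. \<theta> n x = indicat_real {s<..<t} x"
        proof (cases "x \<in> {s<..<t}")
          case True
          have "\<forall>\<^sub>F n in sequentially. 2 / (x - s) \<le> k n \<and> 2 / (t - x) \<le> k n"
            by (intro eventually_conj k_large)
          then show ?thesis
            by eventually_elim (use True Q1 R0 in \<open>simp add: \<theta>_def field_simps\<close>)
        next
          case False
          have "\<theta> n x = 0" for n
          proof -
            consider "x \<le> s" | "t \<le> x" using False by force
            then have "k n * (x - s) \<le> 0 \<or> k n * (t - x) \<le> 0"
              using k(1)[of n] by cases (auto simp: mult_le_0_iff)
            then show ?thesis
              using sum[of n x] k(2)[of n] Q0[of n x] R0[of n x] Q1[of n x] R1[of n x]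
              by (auto simp: \<theta>_def)
          qed
          then show ?thesis using False by simp
        qed
        then show "(\<lambda>n. \<theta> n x) \<longlonglongrightarrow> indicat_real {s<..<t} x"
          by (rule tendsto_eventually)
      qed
      have "\<bar>\<theta> n x\<bar> \<le> 1" for n x
      proof -
        have "0 \<le> Q n x" "Q n x \<le> 1" "0 \<le> R n x" "R n x \<le> 1" by (simp_all add: Q_def R_def P)
        then show ?thesis by (simp add: \<theta>_def)
      qed
      then show "AE x in lebesgue_on {0<..<T}. norm (\<psi> x * \<theta> n x) \<le> \<bar>\<psi> x\<bar>" for n
        by (auto simp: abs_mult intro!: mult_left_le)
    qed (use \<psi> in auto)
    have "(\<integral>x. \<psi> x * indicator {s<..<t} x \<partial>lebesgue_on {0<..<T}) = \<phi> t - \<phi> s"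
      using LIMSEQ_unique[OF tendsto_minus[OF lhs]] rhs by simp
    then show ?thesis
      using has_integral_indicator_Ioo[OF \<psi>, of s t] st by simp
  qed auto
qed

text \<open>Integration by parts, with \<open>\<psi>\<close> only integrable. On a short interval
  the increment of the product \<open>\<phi> \<theta>\<close> agrees with the integral of
  \<open>?g\<close> up to \<open>e\<close> times the integral of
  \<open>\<bar>\<psi>\<bar> + 1\<close>, and \<open>le_if_no_last_record\<close> sums these local
  estimates.\<close>

lemma primitive_on_imp_distrib_deriv_on:
  assumes \<phi>: "continuous_on {0..T} \<phi>" and \<psi>: "integrable (lebesgue_on {0<..<T}) \<psi>"
    and p: "primitive_on T \<phi> \<psi>"
  shows "distrib_deriv_on T \<phi> \<psi>"
  unfolding distrib_deriv_on_def
proof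
  fix \<theta> assume t: "\<theta> \<in> Cc_infty {0<..<T}"
  then have s: "smooth \<theta>" and [simp]: "\<theta> 0 = 0" "\<theta> T = 0"
    by (auto simp: Cc_inftyD)
  show "(\<integral>t. \<phi> t * deriv \<theta> t \<partial>lebesgue_on {0<..<T}) = - (\<integral>t. \<psi> t * \<theta> t \<partial>lebesgue_on {0<..<T})"
  proof (cases "T > 0")
    case True
    have ct: "continuous_on S \<theta>" "continuous_on S (deriv \<theta>)" for S
      using s smooth_deriv smooth_continuous_on by blast+
    note i1 = continuous_imp_integrable_lebesgue_on_Ioo[OF continuous_on_mult[OF \<phi> ct(2)]]
    note i2 = integrable_lebesgue_on_mult_continuous[OF ct(1) \<psi>]
    let ?g = "\<lambda>\<phi> \<psi> x. \<phi> x * deriv \<theta> x + \<psi> x * \<theta> x"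
    have main: "0 \<le> - integral {0..T} (?g \<phi> \<psi>)"
      if \<phi>: "continuous_on {0..T} \<phi>" and \<psi>: "integrable (lebesgue_on {0<..<T}) \<psi>"
        and p: "primitive_on T \<phi> \<psi>" for \<phi> \<psi>
    proof (rule field_le_epsilon)
      fix e' :: real assume "e' > 0"
      note i1 = continuous_imp_integrable_lebesgue_on_Ioo[OF continuous_on_mult[OF \<phi> ct(2)]]
      note i2 = integrable_lebesgue_on_mult_continuous[OF ct(1) \<psi>]
      have ig: "?g \<phi> \<psi> integrable_on {0..T}"
        using integral_lebesgue_on_Ioo_eq(2)[OF Bochner_Integration.integrable_add[OF i1 i2]]
        by (simp add: set_lebesgue_integral_eq_integral(1))
      have ia: "(\<lambda>x. \<bar>\<psi> x\<bar>) integrable_on {0..T}"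
        using integral_lebesgue_on_Ioo_eq(2)[OF integrable_abs[OF \<psi>]]
        by (simp add: set_lebesgue_integral_eq_integral(1))
      define M where "M t = integral {0..t} (\<lambda>x. \<bar>\<psi> x\<bar>)" for t
      have "M T \<ge> 0" unfolding M_def by (rule integral_nonneg[OF ia]) auto
      define e where "e = e' / (M T + T)"
      have "e > 0" using \<open>e' > 0\<close> \<open>M T \<ge> 0\<close> True by (simp add: e_def)
      \<comment> \<open>The first two terms should cancel up to a constant; the last one grows fast
        enough to absorb the local errors, and \<open>e\<close> is scaled so that it contributes
        exactly \<open>e'\<close> at time \<open>T\<close>.\<close>
      define K where "K t = \<phi> t * \<theta> t - integral {0..t} (?g \<phi> \<psi>) + e * (M t + t)" for t
      have "K 0 \<le> K T"
      proof (rule le_if_no_last_record[of 0 T K])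
        show "continuous_on {0..T} K" unfolding K_def M_def
          by (intro continuous_intros \<phi> ct indefinite_integral_continuous_1 ig ia)
        fix t assume t: "0 \<le> t" "t < T"
        have "bounded (deriv \<theta> ` {0..T})"
          by (intro compact_imp_bounded compact_continuous_image ct) auto
        then obtain B where "\<forall>x\<in>{0..T}. \<bar>deriv \<theta> x\<bar> \<le> B" by (auto simp: bounded_iff)
        \<comment> \<open>Adding 1 makes the bound positive, so that it may be divided by.\<close>
        then have B: "\<bar>deriv \<theta> x\<bar> \<le> \<bar>B\<bar> + 1" if "x \<in> {0..T}" for x using that by force
        have "e / (\<bar>B\<bar> + 1) > 0" using \<open>e > 0\<close> by simp
        then obtain d1 where d1: "d1 > 0" "\<And>x. x \<in> {0..T} \<Longrightarrow> \<bar>x - t\<bar> < d1 \<Longrightarrow> \<bar>\<phi> x - \<phi> t\<bar> < e / (\<bar>B\<bar> + 1)"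
          using \<phi>[unfolded continuous_on_iff, rule_format, of t "e / (\<bar>B\<bar> + 1)"] t
          by (auto simp: dist_real_def)
        obtain d2 where d2: "d2 > 0" "\<And>x. x \<in> {0..T} \<Longrightarrow> \<bar>x - t\<bar> < d2 \<Longrightarrow> \<bar>\<theta> x - \<theta> t\<bar> < e / 2"
          using ct(1)[of "{0..T}", unfolded continuous_on_iff, rule_format, of t "e / 2"] t \<open>e > 0\<close>
          by (auto simp: dist_real_def)
        define r where "r = t + min ((d1 / 2)) (min (d2 / 2) (T - t))"
        have r: "t < r" "r \<le> T" "r - t < d1" "r - t < d2"
          using d1(1) d2(1) t by (auto simp: r_def)
        have sub: "{t..r} \<subseteq> {0..T}" using t r by auto
        have h1: "(deriv \<theta> has_integral (\<theta> r - \<theta> t)) {t..r}"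
          by (rule fundamental_theorem_of_calculus)
            (use r smooth_DERIV[OF s] in \<open>auto simp: has_real_derivative_iff_has_vector_derivative[symmetric]
                intro: has_field_derivative_at_within\<close>)
        have h2: "(\<psi> has_integral (\<phi> r - \<phi> t)) {t..r}"
          using p t r by (simp add: primitive_on_def)
        have h3: "(?g \<phi> \<psi> has_integral (integral {0..r} (?g \<phi> \<psi>) - integral {0..t} (?g \<phi> \<psi>))) {t..r}"
        proof -
          have eq: "integral {0..t} (?g \<phi> \<psi>) + integral {t..r} (?g \<phi> \<psi>) = integral {0..r} (?g \<phi> \<psi>)"
            by (rule Henstock_Kurzweil_Integration.integral_combine)
              (use t r ig in \<open>auto intro: integrable_on_subinterval\<close>)
          have "(?g \<phi> \<psi> has_integral integral {t..r} (?g \<phi> \<psi>)) {t..r}"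
            by (rule integrable_integral, rule integrable_on_subinterval[OF ig sub])
          then show ?thesis by (rule has_integral_eq_rhs) (use eq in linarith)
        qed
        have h4: "((\<lambda>x. \<bar>\<psi> x\<bar>) has_integral (M r - M t)) {t..r}"
        proof -
          have eq: "M t + integral {t..r} (\<lambda>x. \<bar>\<psi> x\<bar>) = M r" unfolding M_def
            by (rule Henstock_Kurzweil_Integration.integral_combine)
              (use t r ia in \<open>auto intro: integrable_on_subinterval\<close>)
          have "((\<lambda>x. \<bar>\<psi> x\<bar>) has_integral integral {t..r} (\<lambda>x. \<bar>\<psi> x\<bar>)) {t..r}"
            by (rule integrable_integral, rule integrable_on_subinterval[OF ia sub])
          then show ?thesis by (rule has_integral_eq_rhs) (use eq in linarith)
        qed
        \<comment> \<open>The product rule with frozen factors: the increment of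
          \<open>\<phi> \<theta>\<close> is \<open>\<phi> t * (\<theta> r - \<theta> t) + \<theta> r
          * (\<phi> r - \<phi> t)\<close>. What remains under the integral contains only
          \<open>\<phi> x - \<phi> t\<close> and \<open>\<theta> r - \<theta> x\<close>, which are
          small.\<close>
        have h5: "((\<lambda>x. \<phi> t * deriv \<theta> x + \<theta> r * \<psi> x - ?g \<phi> \<psi> x + (e * \<bar>\<psi> x\<bar> + e)) has_integral (K r - K t)) {t..r}"
        proof -
          have "((\<lambda>x. e * \<bar>\<psi> x\<bar> + e) has_integral (e * (M r - M t) + e * (r - t))) {t..r}"
            using has_integral_add[OF has_integral_mult_right[OF h4, of e] has_integral_const_real[of e t r]] r
            by (simp add: mult.commute)
          note h = has_integral_add[OF has_integral_diff[OF has_integral_add[OF has_integral_mult_right[OF h1, of "\<phi> t"]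
            has_integral_mult_right[OF h2, of "\<theta> r"]] h3] this]
          show ?thesis
          proof (rule has_integral_eq_rhs[OF h])
            have "e * (M r - M t) + e * (r - t) = e * (M r + r) - e * (M t + t)"
              "\<phi> t * (\<theta> r - \<theta> t) + \<theta> r * (\<phi> r - \<phi> t) = \<phi> r * \<theta> r - \<phi> t * \<theta> t"
              by algebra+
            then show "K r - K t = \<phi> t * (\<theta> r - \<theta> t) + \<theta> r * (\<phi> r - \<phi> t) -
              (integral {0..r} (?g \<phi> \<psi>) - integral {0..t} (?g \<phi> \<psi>)) + (e * (M r - M t) + e * (r - t))"
              unfolding K_def by linarith
          qed
        qed
        have "0 \<le> K r - K t"
        proof (rule has_integral_nonneg[OF h5])
          fix x assume x: "x \<in> {t..r}"
          have "\<bar>(\<phi> x - \<phi> t) * deriv \<theta> x\<bar> \<le> e / (\<bar>B\<bar> + 1) * (\<bar>B\<bar> + 1)"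
            unfolding abs_mult by (intro mult_mono less_imp_le[OF d1(2)] B) (use x sub r \<open>e > 0\<close> in auto)
          moreover have "e / (\<bar>B\<bar> + 1) * (\<bar>B\<bar> + 1) = e" by simp
          ultimately have 1: "\<bar>(\<phi> x - \<phi> t) * deriv \<theta> x\<bar> \<le> e" by simp
          have "\<bar>\<theta> r - \<theta> x\<bar> \<le> e"
          proof -
            have "\<bar>\<theta> x - \<theta> t\<bar> < e / 2" "\<bar>\<theta> r - \<theta> t\<bar> < e / 2"
              by (rule d2(2); use x t r in simp)+
            then show ?thesis by linarith
          qed
          then have 2: "\<bar>(\<theta> r - \<theta> x) * \<psi> x\<bar> \<le> e * \<bar>\<psi> x\<bar>"
            unfolding abs_mult by (rule mult_right_mono) simp
          have "\<phi> t * deriv \<theta> x + \<theta> r * \<psi> x - ?g \<phi> \<psi> x = (\<theta> r - \<theta> x) * \<psi> x - (\<phi> x - \<phi> t) * deriv \<theta> x"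
            by (simp add: algebra_simps)
          then show "0 \<le> \<phi> t * deriv \<theta> x + \<theta> r * \<psi> x - ?g \<phi> \<psi> x + (e * \<bar>\<psi> x\<bar> + e)"
            using 1 2 by linarith
        qed
        then show "\<exists>r>t. r \<le> T \<and> K t \<le> K r" using r by auto
      qed (use True in auto)
      moreover have "K 0 = 0" by (simp add: K_def M_def)
      moreover have "e * (M T + T) = e'" using True \<open>M T \<ge> 0\<close> by (simp add: e_def)
      moreover have "K T = - integral {0..T} (?g \<phi> \<psi>) + e * (M T + T)" by (simp add: K_def)
      ultimately show "0 \<le> - integral {0..T} (?g \<phi> \<psi>) + e'" by linarith
    qed
    \<comment> \<open>\<open>main\<close> is one-sided; applied to the negated pair it gives the
      opposite inequality.\<close>
    have "primitive_on T (\<lambda>x. - \<phi> x) (\<lambda>x. - \<psi> x)"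
      unfolding primitive_on_def
    proof (intro allI impI)
      fix s t assume "0 \<le> s" "s \<le> t" "t \<le> T"
      then have "(\<psi> has_integral (\<phi> t - \<phi> s)) {s..t}" using p by (simp add: primitive_on_def)
      from has_integral_neg[OF this] show "((\<lambda>x. - \<psi> x) has_integral - \<phi> t - - \<phi> s) {s..t}" by simp
    qed
    then have "0 \<le> - integral {0..T} (?g (\<lambda>x. - \<phi> x) (\<lambda>x. - \<psi> x))"
      by (intro main) (use \<phi> \<psi> in \<open>auto intro!: continuous_intros\<close>)
    moreover have "?g (\<lambda>x. - \<phi> x) (\<lambda>x. - \<psi> x) = (\<lambda>x. - ?g \<phi> \<psi> x)" by auto
    then have "integral {0..T} (?g (\<lambda>x. - \<phi> x) (\<lambda>x. - \<psi> x)) = - integral {0..T} (?g \<phi> \<psi>)"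
      by (simp only: Henstock_Kurzweil_Integration.integral_neg)
    ultimately have "integral {0..T} (?g \<phi> \<psi>) = 0"
      using main[OF \<phi> \<psi> p] by linarith
    moreover have "integral {0..T} (?g \<phi> \<psi>) =
      (\<integral>t. \<phi> t * deriv \<theta> t \<partial>lebesgue_on {0<..<T}) + (\<integral>t. \<psi> t * \<theta> t \<partial>lebesgue_on {0<..<T})"
      using integral_lebesgue_on_Ioo_eq(1)[OF Bochner_Integration.integrable_add[OF i1 i2]]
        Bochner_Integration.integral_add[OF i1 i2] by simp
    ultimately show ?thesis by simp
  next
    case False
    then have "{0<..<T} = {}" by auto
    then show ?thesis by (simp add: integral_restrict_space)
  qed
qed

section \<open>The spaces on the unit interval\<close>

lemma L2_of_in_H1: "L2_of u \<in> H1"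
  using L2_of by (auto simp: H1_zero_def)

lemma inner_H01_eq: "inner u v = inner (H01_deriv u) (H01_deriv v)"
  by (simp add: inner_H01_def)

lemma L2_of_simps: "L2_of (u + v) = L2_of u + L2_of v" "L2_of (u - v) = L2_of u - L2_of v"
  "L2_of (c *\<^sub>R u) = c *\<^sub>R L2_of u" "L2_of 0 = 0"
  by (simp_all add: plus_H01.rep_eq minus_H01.rep_eq scaleR_H01.rep_eq zero_H01.rep_eq)

lemma bounded_linear_L2_of: "bounded_linear L2_of"
proof (rule bounded_linear_intro)
  show "norm (L2_of u) \<le> norm u * 2" for u
    using Poincare[OF L2_of[of u]] by (simp add: norm_H01_def H01_deriv_def mult.commute)
qed (simp_all add: L2_of_simps)

lemma bounded_linear_H01_deriv: "bounded_linear H01_deriv"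
proof (rule bounded_linear_intro)
  show "norm (H01_deriv u) \<le> norm u * 1" for u by (simp add: norm_H01_def)
qed (simp_all add: H01_deriv_def L2_of_simps H1_add H1_scaleR L2_of_in_H1)

lemmas continuous_on_L2_of [continuous_intros] = bounded_linear.continuous_on[OF bounded_linear_L2_of]
lemmas continuous_on_H01_deriv [continuous_intros] = bounded_linear.continuous_on[OF bounded_linear_H01_deriv]

lemma H01_test_dense:
  assumes "e > 0"
  obtains \<phi> where "\<phi> \<in> Cc_infty {0<..<1}" "norm (L2_of u - abs_L2 \<phi>) < e"
    "norm (H01_deriv u - abs_L2 (deriv \<phi>)) < e"
proof -
  obtain \<phi> where t: "\<phi> \<in> Cc_infty {0<..<1}" and n: "H1_norm (L2_of u - abs_L2 \<phi>) < e"
    using L2_of[of u] assms unfolding H1_zero_def by blast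
  have "weak_deriv (L2_of u - abs_L2 \<phi>) = H01_deriv u - abs_L2 (deriv \<phi>)"
    using t H1_test H1_diff L2_of_in_H1 by (simp add: H01_deriv_def)
  then have "norm (L2_of u - abs_L2 \<phi>) < e" "norm (H01_deriv u - abs_L2 (deriv \<phi>)) < e"
    using n norm_fst_le[of "L2_of u - abs_L2 \<phi>" "weak_deriv (L2_of u - abs_L2 \<phi>)"]
      norm_snd_le[of "weak_deriv (L2_of u - abs_L2 \<phi>)" "L2_of u - abs_L2 \<phi>"]
    unfolding H1_norm_eq by auto
  then show thesis using t that by blast
qed

lemma H01_test:
  assumes "\<phi> \<in> Cc_infty {0<..<1}"
  shows "L2_of (H01_of (abs_L2 \<phi>)) = abs_L2 \<phi>" "H01_deriv (H01_of (abs_L2 \<phi>)) = abs_L2 (deriv \<phi>)"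
  using H01_of_inverse[OF H1_zero_test[OF assms]] H1_test[OF assms] by (auto simp: H01_deriv_def)

text \<open>For test functions this is the definition of the weak derivative of
  \<open>H01_deriv u\<close>. Both sides are continuous in \<open>v\<close>, and test functions are
  dense.\<close>

lemma inner_H01_H2:
  assumes "L2_of u \<in> H2"
  shows "inner u v = - inner (weak_deriv (H01_deriv u)) (L2_of v)"
proof -
  let ?g = "weak_deriv (H01_deriv u)"
  have w: "has_weak_deriv (H01_deriv u) ?g"
    using assms by (auto simp: H2_def H01_deriv_def intro: has_weak_deriv_weak_deriv)
  have "\<bar>inner (H01_deriv u) (H01_deriv v) + inner ?g (L2_of v)\<bar> \<le> 0 + e" if "e > 0" for e
  proof -
    let ?N = "norm (H01_deriv u) + norm ?g + 1"
    have N: "?N > 0" by (simp add: add_nonneg_pos)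
    then have "e / ?N > 0" using that by simp
    then obtain \<phi> where \<phi>: "\<phi> \<in> Cc_infty {0<..<1}" "norm (L2_of v - abs_L2 \<phi>) < e / ?N"
      "norm (H01_deriv v - abs_L2 (deriv \<phi>)) < e / ?N"
      by (rule H01_test_dense)
    have "inner (H01_deriv u) (abs_L2 (deriv \<phi>)) = - inner ?g (abs_L2 \<phi>)"
      using w \<phi>(1) by (simp add: has_weak_deriv_def)
    then have "inner (H01_deriv u) (H01_deriv v) + inner ?g (L2_of v) =
      inner (H01_deriv u) (H01_deriv v - abs_L2 (deriv \<phi>)) + inner ?g (L2_of v - abs_L2 \<phi>)"
      by (simp add: inner_diff_right)
    also have "\<bar>\<dots>\<bar> \<le> norm (H01_deriv u) * (e / ?N) + norm ?g * (e / ?N)"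
      by (intro order.trans[OF abs_triangle_ineq] add_mono order.trans[OF Cauchy_Schwarz_ineq2]
          mult_left_mono less_imp_le[OF \<phi>(2)] less_imp_le[OF \<phi>(3)]) auto
    also have "\<dots> = (norm (H01_deriv u) + norm ?g) * (e / ?N)" by (simp only: distrib_right)
    also have "\<dots> \<le> ?N * (e / ?N)"
      by (rule mult_right_mono) (use that N in auto)
    also have "\<dots> = e" using N by simp
    finally show ?thesis by simp
  qed
  then have "\<bar>inner (H01_deriv u) (H01_deriv v) + inner ?g (L2_of v)\<bar> \<le> 0"
    by (rule field_le_epsilon)
  then show ?thesis by (simp add: inner_H01_def)
qed

text \<open>Regularity is immediate in one dimension: read on test functions, the hypothesis says
  that \<open>- g\<close> is the weak derivative of \<open>H01_deriv u\<close>.\<close>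

lemma weak_equation_imp_H2:
  assumes "\<And>v::H01. inner u v = inner g (L2_of v)"
  shows "L2_of u \<in> H2" "weak_deriv (H01_deriv u) = - g"
proof -
  have w: "has_weak_deriv (H01_deriv u) (- g)"
    unfolding has_weak_deriv_def
  proof
    fix \<phi> assume "\<phi> \<in> Cc_infty {0<..<1}"
    from assms[of "H01_of (abs_L2 \<phi>)"] H01_test[OF this]
    show "inner (H01_deriv u) (abs_L2 (deriv \<phi>)) = - inner (- g) (abs_L2 \<phi>)"
      by (simp add: inner_H01_def)
  qed
  show "weak_deriv (H01_deriv u) = - g" by (rule weak_deriv_eqI[OF w])
  show "L2_of u \<in> H2"
    using w L2_of_in_H1 by (auto simp: H2_def H1_def H01_deriv_def)
qed

section \<open>Essential boundedness and the superposition operator\<close>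

lemma emeasure_Omega: "emeasure Omega (space Omega) = 1"
  by (simp add: space_restrict_space emeasure_restrict_space)

lemma finite_measure_Omega: "finite_measure Omega"
  by (rule finite_measureI) (simp only: emeasure_Omega, simp)

lemma square_integrable_bounded:
  assumes m: "g \<in> borel_measurable Omega" and b: "AE x in Omega. \<bar>g x\<bar> \<le> B"
  shows "square_integrable g" "norm (abs_L2 g) \<le> \<bar>B\<bar>"
proof -
  interpret finite_measure Omega by (rule finite_measure_Omega)
  have b2: "AE x in Omega. (g x)\<^sup>2 \<le> B\<^sup>2"
    using b by eventually_elim (rule abs_le_square_iff[THEN iffD1], simp)
  have i: "integrable Omega (\<lambda>x. (g x)\<^sup>2)"
    by (rule integrable_const_bound[of _ "B\<^sup>2"]) (use b2 m in auto)
  with m show s: "square_integrable g" by (simp add: square_integrable_def)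
  have "(norm (abs_L2 g))\<^sup>2 = (\<integral>x. (g x)\<^sup>2 \<partial>Omega)"
    using s by (simp add: power2_norm_eq_inner abs_L2_simps(1) flip: power2_eq_square)
  also have "\<dots> \<le> (\<integral>x. B\<^sup>2 \<partial>Omega)"
    by (rule integral_mono_AE[OF i _ b2]) simp
  also have "\<dots> = B\<^sup>2" using emeasure_Omega by (simp add: measure_def)
  finally have "(norm (abs_L2 g))\<^sup>2 \<le> \<bar>B\<bar>\<^sup>2" by simp
  then show "norm (abs_L2 g) \<le> \<bar>B\<bar>" by (rule power2_le_imp_le) simp
qed

lemma square_integrable_indicator:
  assumes "S \<in> sets Omega"
  shows "square_integrable (indicator S)" "norm (abs_L2 (indicator S)) \<le> 1"
  using square_integrable_bounded[of "indicator S" 1] assms by (auto simp: indicator_def)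

text \<open>The value at \<open>x\<close> is the integral of the derivative over
  \<open>(0, x)\<close>, that is, its \<open>L2\<close> product with an indicator of norm at most
  1.\<close>

lemma test_pointwise_bound:
  assumes t: "\<phi> \<in> Cc_infty {0<..<1}" and x: "0 < x" "x < 1"
  shows "\<bar>\<phi> x\<bar> \<le> norm (abs_L2 (deriv \<phi>))"
proof -
  note s = Cc_inftyD(1)[OF t]
  have sd: "square_integrable (deriv \<phi>)"
    by (intro square_integrable_smooth smooth_deriv s)
  have S: "{0<..<x} \<in> sets Omega" using x by (auto simp: sets_restrict_space_iff)
  have i: "integrable Omega (deriv \<phi>)"
    using square_integrable_mult[OF sd square_integrable_smooth[OF smooth_const[of 1]]] by simp
  have "(deriv \<phi> has_integral (\<phi> x - \<phi> 0)) {0..x}"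
    by (rule fundamental_theorem_of_calculus)
      (use x smooth_DERIV[OF s] in \<open>auto simp: has_real_derivative_iff_has_vector_derivative[symmetric]
          intro: has_field_derivative_at_within\<close>)
  moreover have "(deriv \<phi> has_integral (\<integral>y. deriv \<phi> y * indicator {0<..<x} y \<partial>Omega)) {0..x}"
    using has_integral_indicator_Ioo[OF i, of 0 x] x by simp
  ultimately have "\<phi> x - \<phi> 0 = (\<integral>y. deriv \<phi> y * indicator {0<..<x} y \<partial>Omega)"
    by (rule has_integral_unique)
  then have "\<phi> x = inner (abs_L2 (deriv \<phi>)) (abs_L2 (indicator {0<..<x}))"
    using Cc_inftyD(2)[OF t, of 0] by (simp add: abs_L2_simps(1)[OF sd square_integrable_indicator(1)[OF S]])
  also have "\<bar>\<dots>\<bar> \<le> norm (abs_L2 (deriv \<phi>)) * 1"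
    by (rule order.trans[OF Cauchy_Schwarz_ineq2 mult_left_mono[OF square_integrable_indicator(2)[OF S]]]) simp
  finally show ?thesis by simp
qed

text \<open>Test functions approximate \<open>u\<close> only in mean square, so the pointwise bound
  is passed on through an integral: over the set \<open>S\<close> where it fails, \<open>u\<close>
  integrates to at most \<open>norm u * measure Omega S\<close>, which forces \<open>S\<close> to be
  null. The lower bound follows by exchanging the two functions in a difference.\<close>

lemma AE_rep_L2_le:
  fixes u :: H01
  shows "AE x in Omega. rep_L2 (L2_of u) x \<le> norm u"
proof -
  interpret finite_measure Omega by (rule finite_measure_Omega)
  let ?v = "rep_L2 (L2_of u)"
  have sv: "square_integrable ?v" by (rule square_integrable_rep)
  then have [measurable]: "?v \<in> borel_measurable Omega" by (simp add: square_integrable_def)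
  define S where "S = {x \<in> space Omega. norm u < ?v x}"
  have S: "S \<in> sets Omega" unfolding S_def by measurable
  note si = square_integrable_indicator[OF S]
  have iS: "integrable Omega (indicator S :: real \<Rightarrow> real)"
    using square_integrable_mult[OF si(1) square_integrable_smooth[OF smooth_const[of 1]]] by simp
  have mS: "(\<integral>x. indicator S x \<partial>Omega) = measure Omega S" using sets.sets_into_space[OF S] by (simp add: Int_absorb2)
  have m1: "measure Omega S \<le> 1"
    using bounded_measure[of S] emeasure_Omega by (simp add: measure_def)
  have "(\<integral>x. ?v x * indicator S x \<partial>Omega) \<le> norm u * measure Omega S + e" if "e > 0" for e
  proof -
    have "e / 2 > 0" using that by simp
    then obtain \<phi> where \<phi>: "\<phi> \<in> Cc_infty {0<..<1}" "norm (L2_of u - abs_L2 \<phi>) < e / 2"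
      "norm (H01_deriv u - abs_L2 (deriv \<phi>)) < e / 2"
      by (rule H01_test_dense)
    have s\<phi>: "square_integrable \<phi>" using \<phi>(1) Cc_inftyD square_integrable_smooth by blast
    have nd: "norm (abs_L2 (deriv \<phi>)) \<le> norm u + e / 2"
      using \<phi>(3) norm_triangle_ineq2[of "abs_L2 (deriv \<phi>)" "H01_deriv u"]
      by (simp add: norm_H01_def norm_minus_commute)
    have "inner (abs_L2 \<phi>) (abs_L2 (indicator S)) = (\<integral>x. \<phi> x * indicator S x \<partial>Omega)"
      by (rule abs_L2_simps(1)[OF s\<phi> si(1)])
    also have "\<dots> \<le> (\<integral>x. (norm u + e / 2) * indicator S x \<partial>Omega)"
    proof (rule integral_mono)
      show "integrable Omega (\<lambda>x. \<phi> x * indicator S x)" by (rule square_integrable_mult[OF s\<phi> si(1)])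
      show "integrable Omega (\<lambda>x. (norm u + e / 2) * indicator S x)" using iS by simp
      fix x assume "x \<in> space Omega"
      then have "\<phi> x \<le> norm u + e / 2"
        using test_pointwise_bound[OF \<phi>(1), of x] nd by auto
      then show "\<phi> x * indicator S x \<le> (norm u + e / 2) * indicator S x"
        by (simp add: indicator_def)
    qed
    also have "\<dots> = (norm u + e / 2) * measure Omega S" using mS by simp
    also have "\<dots> \<le> norm u * measure Omega S + e / 2"
      using m1 that by (simp add: distrib_right)
    finally have 1: "inner (abs_L2 \<phi>) (abs_L2 (indicator S)) \<le> norm u * measure Omega S + e / 2" .
    have "inner (L2_of u - abs_L2 \<phi>) (abs_L2 (indicator S)) \<le> e / 2 * 1"
      by (rule order.trans[OF norm_cauchy_schwarz mult_mono[OF less_imp_le[OF \<phi>(2)] si(2)]]) (use that in auto)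
    moreover have "(\<integral>x. ?v x * indicator S x \<partial>Omega) = inner (L2_of u) (abs_L2 (indicator S))"
      using abs_L2_simps(1)[OF sv si(1)] by (simp add: abs_rep_L2)
    ultimately show ?thesis using 1 by (simp add: inner_diff_left)
  qed
  then have "(\<integral>x. ?v x * indicator S x \<partial>Omega) \<le> norm u * measure Omega S"
    by (rule field_le_epsilon)
  moreover have i: "integrable Omega (\<lambda>x. ?v x * indicator S x)" by (rule square_integrable_mult[OF sv si(1)])
  moreover have i2: "integrable Omega (\<lambda>x. norm u * indicator S x)" using iS by simp
  ultimately have le0: "(\<integral>x. ?v x * indicator S x - norm u * indicator S x \<partial>Omega) \<le> 0"
    using mS by simp
  have nn: "0 \<le> ?v x * indicator S x - norm u * indicator S x" for x
    by (auto simp: S_def indicator_def)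
  have "AE x in Omega. ?v x * indicator S x - norm u * indicator S x = 0"
  proof (subst integral_nonneg_eq_0_iff_AE[symmetric])
    show "(\<integral>x. ?v x * indicator S x - norm u * indicator S x \<partial>Omega) = 0"
      by (rule antisym[OF le0 integral_nonneg_AE[OF AE_I2[OF nn]]])
    show "AE x in Omega. 0 \<le> ?v x * indicator S x - norm u * indicator S x" by (intro AE_I2 nn)
  qed (use i i2 in auto)
  then show ?thesis
    by (rule AE_mp) (auto intro!: AE_I2 simp: S_def indicator_def split: if_splits)
qed

lemma AE_rep_L2_diff: "AE x in Omega. rep_L2 (u - v) x = rep_L2 u x - rep_L2 v x"
proof -
  have "abs_L2 (rep_L2 (u - v)) = abs_L2 (\<lambda>x. rep_L2 u x - rep_L2 v x)"
    using minus_L2.abs_eq[of "rep_L2 u" "rep_L2 v"] square_integrable_rep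
    by (simp add: abs_rep_L2 L2_eq_def)
  then show ?thesis
    by (subst (asm) abs_L2_eq_iff) (auto intro: square_integrable_rep square_integrable_diff)
qed

lemma AE_abs_rep_L2_diff_le:
  fixes u v :: H01
  shows "AE x in Omega. \<bar>rep_L2 (L2_of u) x - rep_L2 (L2_of v) x\<bar> \<le> norm (u - v)"
  using AE_rep_L2_le[of "u - v"] AE_rep_L2_le[of "v - u"] AE_rep_L2_diff[of "L2_of u" "L2_of v"]
    AE_rep_L2_diff[of "L2_of v" "L2_of u"]
  by eventually_elim (simp add: L2_of_simps norm_minus_commute abs_le_iff)

lemma AE_abs_rep_L2_le:
  fixes u :: H01
  shows "AE x in Omega. \<bar>rep_L2 (L2_of u) x\<bar> \<le> norm u"
proof -
  have "AE x in Omega. rep_L2 (0::L2) x = 0"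
    using AE_rep_L2_diff[of 0 0] by simp
  then show ?thesis
    using AE_abs_rep_L2_diff_le[of u 0] by eventually_elim (simp add: L2_of_simps)
qed

lemma rep_L2_measurable [measurable]: "rep_L2 u \<in> borel_measurable Omega"
  using square_integrable_rep by (simp add: square_integrable_def)

lemma square_integrable_superposition:
  assumes f: "continuous_on UNIV f"
  shows "square_integrable (\<lambda>x. f (rep_L2 (L2_of u) x))"
proof -
  have "bounded (f ` {- norm u..norm u})"
    by (intro compact_imp_bounded compact_continuous_image continuous_on_subset[OF f]) auto
  then obtain B where "\<forall>x\<in>{- norm u..norm u}. \<bar>f x\<bar> \<le> B" by (auto simp: bounded_iff)
  then have "AE x in Omega. \<bar>f (rep_L2 (L2_of u) x)\<bar> \<le> B"
    by (intro eventually_mono[OF AE_abs_rep_L2_le[of u]]) (auto simp: abs_le_iff)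
  then show ?thesis
    by (rule square_integrable_bounded(1)[rotated])
      (rule measurable_compose[OF rep_L2_measurable borel_measurable_continuous_onI[OF f]])
qed

lemma uniform_continuity_Icc:
  fixes f :: "real \<Rightarrow> real"
  assumes "continuous_on UNIV f" "e > 0"
  obtains d where "d > 0" "\<And>x y. \<bar>x\<bar> \<le> R \<Longrightarrow> \<bar>y\<bar> \<le> R \<Longrightarrow> \<bar>x - y\<bar> < d \<Longrightarrow> \<bar>f x - f y\<bar> \<le> e"
proof -
  have "uniformly_continuous_on {-R..R} f"
    by (rule compact_uniformly_continuous[OF continuous_on_subset[OF assms(1)]]) auto
  then obtain d where d: "d > 0" "\<And>x y. x \<in> {-R..R} \<Longrightarrow> y \<in> {-R..R} \<Longrightarrow> dist x y < d \<Longrightarrow> dist (f x) (f y) < e"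
    using assms(2) unfolding uniformly_continuous_on_def by metis
  show thesis
  proof (rule that[OF d(1)])
    fix x y assume "\<bar>x\<bar> \<le> R" "\<bar>y\<bar> \<le> R" "\<bar>x - y\<bar> < d"
    then have "dist (f x) (f y) < e" by (intro d(2)) (auto simp: dist_real_def)
    then show "\<bar>f x - f y\<bar> \<le> e" by (simp add: dist_real_def)
  qed
qed

text \<open>Elements of a ball of \<open>H01\<close> take almost all their values in one compact
  interval, on which \<open>f\<close> is uniformly continuous, and closeness in \<open>H01\<close>
  is almost everywhere uniform closeness.\<close>

lemma continuous_nemytskii:
  assumes f: "continuous_on UNIV f"
  shows "continuous_on S (nemytskii f)"
  unfolding continuous_on_iff
proof (intro ballI allI impI)
  fix u :: H01 and e :: real assume "e > 0"
  then have "e / 2 > 0" by simp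
  then obtain d where d: "d > 0" "\<And>x y. \<bar>x\<bar> \<le> norm u + 1 \<Longrightarrow> \<bar>y\<bar> \<le> norm u + 1 \<Longrightarrow> \<bar>x - y\<bar> < d \<Longrightarrow> \<bar>f x - f y\<bar> \<le> e / 2"
    by (rule uniform_continuity_Icc[OF f, where R = "norm u + 1"]) blast
  have "dist (nemytskii f v) (nemytskii f u) < e" if "dist v u < min 1 d" for v
  proof -
    have v: "norm (v - u) < 1" "norm (v - u) < d" "norm v \<le> norm u + 1"
      using that norm_triangle_ineq2[of v u] by (auto simp: dist_norm)
    let ?g = "\<lambda>x. f (rep_L2 (L2_of v) x) - f (rep_L2 (L2_of u) x)"
    have m: "(\<lambda>x. f (rep_L2 (L2_of w) x)) \<in> borel_measurable Omega" for w
      by (rule measurable_compose[OF rep_L2_measurable borel_measurable_continuous_onI[OF f]])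
    have "AE x in Omega. \<bar>?g x\<bar> \<le> e / 2"
      using AE_abs_rep_L2_diff_le[of v u] AE_abs_rep_L2_le[of v] AE_abs_rep_L2_le[of u]
    proof eventually_elim
      case (elim x)
      then show ?case using v by (intro d) auto
    qed
    then have "norm (abs_L2 ?g) \<le> \<bar>e / 2\<bar>"
      by (intro square_integrable_bounded borel_measurable_diff m)
    moreover have "abs_L2 ?g = nemytskii f v - nemytskii f u"
      unfolding nemytskii_def using square_integrable_superposition[OF f]
      by (subst minus_L2.abs_eq) (simp_all add: L2_eq_def)
    ultimately show ?thesis using \<open>e > 0\<close> by (simp add: dist_norm)
  qed
  then show "\<exists>d>0. \<forall>v\<in>S. dist v u < d \<longrightarrow> dist (nemytskii f v) (nemytskii f u) < e"
    using d(1) by (intro exI[of _ "min 1 d"]) auto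
qed

section \<open>Antiderivatives and the potential of the nonlinearity\<close>

lemma antiderivative_exists:
  fixes f :: "real \<Rightarrow> real"
  assumes f: "continuous_on UNIV f"
  obtains F where "\<And>x. (F has_field_derivative f x) (at x)"
proof -
  \<comment> \<open>The oriented integral from 0 to \<open>x\<close>: one of the two intervals is
    empty or a point.\<close>
  define F where "F x = integral {0..x} f - integral {x..0} f" for x
  have i: "f integrable_on {a..b}" for a b
    by (intro integrable_continuous_real continuous_on_subset[OF f]) auto
  have F: "F x = integral {R..x} f - integral {R..0} f" if "R \<le> x" "R \<le> 0" for x R
  proof (cases "x \<ge> 0")
    case True
    then have "integral {R..0} f + integral {0..x} f = integral {R..x} f"
      by (intro Henstock_Kurzweil_Integration.integral_combine i that)
    moreover have "integral {x..0} f = 0" using True by (cases "x = 0") auto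
    ultimately show ?thesis by (simp add: F_def)
  next
    case False
    then have "integral {R..x} f + integral {x..0} f = integral {R..0} f"
      by (intro Henstock_Kurzweil_Integration.integral_combine i that) auto
    then show ?thesis using False by (simp add: F_def)
  qed
  have "(F has_field_derivative f x) (at x)" for x
  proof -
    \<comment> \<open>A base point left of both 0 and \<open>x\<close>, so that near
      \<open>x\<close> the function \<open>F\<close> is a single integral up to a constant.\<close>
    define R where "R = min 0 x - 1"
    have "((\<lambda>y. integral {R..y} f) has_vector_derivative f x) (at x within {R..x+1})"
      by (rule integral_has_vector_derivative) (use continuous_on_subset[OF f] in \<open>auto simp: R_def\<close>)
    then have "((\<lambda>y. integral {R..y} f) has_real_derivative f x) (at x)"
      by (subst (asm) at_within_Icc_at) (auto simp: R_def has_real_derivative_iff_has_vector_derivative)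
    then have "((\<lambda>y. integral {R..y} f - integral {R..0} f) has_real_derivative f x) (at x)"
      using DERIV_diff[OF _ DERIV_const, of _ "f x" x UNIV "integral {R..0} f"] by simp
    then show ?thesis
      by (rule has_field_derivative_transform_within_open[of _ _ _ "{R<..}"]) (use F[of R] in \<open>auto simp: R_def\<close>)
  qed
  then show thesis by (rule that)
qed

definition potential :: "(real \<Rightarrow> real) \<Rightarrow> H01 \<Rightarrow> real" where
  "potential F u = (\<integral>x. F (rep_L2 (L2_of u) x) \<partial>Omega)"

text \<open>\<open>nemytskii f\<close> is the \<open>L2\<close> gradient of the potential, by the
  mean value theorem at almost every point. The gradient is taken at a third element
  \<open>w\<close>, since the energy estimate needs it at the later time. The error is measured by
  the \<open>L2\<close> distance, the quantity later dominated by a function of bounded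
  variation.\<close>

lemma potential_first_order:
  assumes f: "continuous_on UNIV f" and F: "\<And>x. (F has_field_derivative f x) (at x)" and "e > 0"
  obtains d where "d > 0" "\<And>u v w :: H01. norm u \<le> R \<Longrightarrow> norm v \<le> R \<Longrightarrow> norm w \<le> R \<Longrightarrow>
    norm (v - u) < d \<Longrightarrow> norm (w - u) < d \<Longrightarrow>
    \<bar>potential F v - potential F u - inner (nemytskii f w) (L2_of v - L2_of u)\<bar> \<le> e * norm (L2_of v - L2_of u)"
proof -
  obtain d where d: "d > 0" "\<And>x y. \<bar>x\<bar> \<le> R \<Longrightarrow> \<bar>y\<bar> \<le> R \<Longrightarrow> \<bar>x - y\<bar> < d \<Longrightarrow> \<bar>f x - f y\<bar> \<le> e"
    by (rule uniform_continuity_Icc[OF f \<open>e > 0\<close>, where R = R]) blast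
  show thesis
  \<comment> \<open>The intermediate value and the value of \<open>w\<close> both differ from that
    of \<open>u\<close> by less than \<open>d / 2\<close>, hence from each other by less than
    \<open>d\<close>.\<close>
  proof (rule that[of "d / 2"])
    fix u v w :: H01
    assume n: "norm u \<le> R" "norm v \<le> R" "norm w \<le> R" "norm (v - u) < d / 2" "norm (w - u) < d / 2"
    let ?r = "\<lambda>u. rep_L2 (L2_of u)"
    let ?z = "\<lambda>x. ?r v x - ?r u x"
    have cF: "continuous_on UNIV F"
      using F by (meson DERIV_continuous_on has_field_derivative_at_within)
    have one: "square_integrable (\<lambda>x. 1)" "norm (abs_L2 (\<lambda>x. 1)) \<le> 1"
      using square_integrable_bounded[of "\<lambda>x. 1" 1] by auto
    have sF: "square_integrable (\<lambda>x. F (?r u x))" and sf: "square_integrable (\<lambda>x. f (?r u x))" for u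
      by (rule square_integrable_superposition[OF cF] square_integrable_superposition[OF f])+
    have iF: "integrable Omega (\<lambda>x. F (?r u x))" for u
      using square_integrable_mult[OF sF one(1)] by simp
    have sz: "square_integrable ?z" by (intro square_integrable_diff square_integrable_rep)
    then have sa: "square_integrable (\<lambda>x. \<bar>?z x\<bar>)" by (simp add: square_integrable_def)
    have zabs: "abs_L2 ?z = L2_of v - L2_of u"
      using minus_L2.abs_eq[of "?r v" "?r u"] by (simp add: square_integrable_rep L2_eq_def abs_rep_L2)
    have ia: "integrable Omega (\<lambda>x. \<bar>?z x\<bar>)"
      using square_integrable_mult[OF sa one(1)] by simp
    have ifz: "integrable Omega (\<lambda>x. f (?r w x) * ?z x)" by (rule square_integrable_mult[OF sf sz])
    have "AE x in Omega. \<bar>F (?r v x) - F (?r u x) - f (?r w x) * ?z x\<bar> \<le> e * \<bar>?z x\<bar>"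
      using AE_abs_rep_L2_diff_le[of v u] AE_abs_rep_L2_diff_le[of w u]
        AE_abs_rep_L2_le[of u] AE_abs_rep_L2_le[of v] AE_abs_rep_L2_le[of w]
    proof eventually_elim
      case (elim x)
      obtain \<xi> where \<xi>: "min (?r u x) (?r v x) \<le> \<xi>" "\<xi> \<le> max (?r u x) (?r v x)" "F (?r v x) - F (?r u x) = f \<xi> * ?z x"
      proof (cases "?r u x" "?r v x" rule: linorder_cases)
        case less
        from MVT2[OF this, of F f] F obtain z where "z > ?r u x" "z < ?r v x"
          "F (?r v x) - F (?r u x) = ?z x * f z" by blast
        then show ?thesis using less that[of z] by simp
      next
        case equal
        then show ?thesis using that[of "?r u x"] by simp
      next
        case greater
        from MVT2[OF this, of F f] F obtain z where "z > ?r v x" "z < ?r u x"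
          "F (?r u x) - F (?r v x) = (?r u x - ?r v x) * f z" by blast
        then show ?thesis using greater that[of z] by (simp add: algebra_simps)
      qed
      have "\<bar>f \<xi> - f (?r w x)\<bar> \<le> e"
        using elim n \<xi>(1,2) by (intro d(2)) auto
      then have "\<bar>(f \<xi> - f (?r w x)) * ?z x\<bar> \<le> e * \<bar>?z x\<bar>"
        unfolding abs_mult by (rule mult_right_mono) simp
      then show ?case using \<xi>(3) by (simp add: left_diff_distrib)
    qed
    then have "(\<integral>x. norm (F (?r v x) - F (?r u x) - f (?r w x) * ?z x) \<partial>Omega) \<le> (\<integral>x. e * \<bar>?z x\<bar> \<partial>Omega)"
      by (intro integral_mono_AE) (use ia ifz iF in auto)
    with integral_norm_bound
    have "norm (\<integral>x. F (?r v x) - F (?r u x) - f (?r w x) * ?z x \<partial>Omega) \<le> (\<integral>x. e * \<bar>?z x\<bar> \<partial>Omega)"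
      by (rule order.trans)
    also have "(\<integral>x. F (?r v x) - F (?r u x) - f (?r w x) * ?z x \<partial>Omega) =
      potential F v - potential F u - inner (nemytskii f w) (L2_of v - L2_of u)"
      using iF ifz abs_L2_simps(1)[OF sf sz] by (simp add: potential_def nemytskii_def zabs)
    also have "(\<integral>x. e * \<bar>?z x\<bar> \<partial>Omega) = e * inner (abs_L2 (\<lambda>x. \<bar>?z x\<bar>)) (abs_L2 (\<lambda>x. 1))"
      by (simp add: abs_L2_simps(1)[OF sa one(1)])
    also have "\<dots> \<le> e * (norm (abs_L2 (\<lambda>x. \<bar>?z x\<bar>)) * 1)"
      by (intro mult_left_mono order.trans[OF norm_cauchy_schwarz] one) (use \<open>e > 0\<close> in auto)
    also have "norm (abs_L2 (\<lambda>x. \<bar>?z x\<bar>)) = norm (L2_of v - L2_of u)"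
      unfolding zabs[symmetric] norm_eq_sqrt_inner abs_L2_simps(1)[OF sa sa] abs_L2_simps(1)[OF sz sz] by simp
    finally show "\<bar>potential F v - potential F u - inner (nemytskii f w) (L2_of v - L2_of u)\<bar> \<le> e * norm (L2_of v - L2_of u)"
      by simp
  qed (use d in auto)
qed

lemma continuous_potential:
  assumes f: "continuous_on UNIV f" and F: "\<And>x. (F has_field_derivative f x) (at x)"
  shows "continuous_on S (potential F)"
  unfolding continuous_on_iff
proof (intro ballI allI impI)
  fix u :: H01 and e :: real assume "e > 0"
  obtain d where d: "d > 0" "\<And>u' v w :: H01. norm u' \<le> norm u + 1 \<Longrightarrow> norm v \<le> norm u + 1 \<Longrightarrow> norm w \<le> norm u + 1 \<Longrightarrow>
    norm (v - u') < d \<Longrightarrow> norm (w - u') < d \<Longrightarrow>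
    \<bar>potential F v - potential F u' - inner (nemytskii f w) (L2_of v - L2_of u')\<bar> \<le> 1 * norm (L2_of v - L2_of u')"
    by (rule potential_first_order[OF f F zero_less_one, where R = "norm u + 1"]) blast
  let ?N = "2 * (1 + norm (nemytskii f u))"
  have N: "?N > 0" by (simp add: add_pos_nonneg)
  have "dist (potential F v) (potential F u) < e" if "dist v u < min (min 1 d) (e / ?N)" for v
  proof -
    have v: "norm (v - u) < 1" "norm (v - u) < d" "norm (v - u) * ?N < e" "norm v \<le> norm u + 1"
      using that norm_triangle_ineq2[of v u] N by (auto simp: dist_norm field_simps)
    have "\<bar>potential F v - potential F u - inner (nemytskii f u) (L2_of v - L2_of u)\<bar> \<le> 1 * norm (L2_of v - L2_of u)"
      by (rule d(2)) (use v d(1) in auto)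
    moreover have "\<bar>inner (nemytskii f u) (L2_of v - L2_of u)\<bar> \<le> norm (nemytskii f u) * norm (L2_of v - L2_of u)"
      by (rule Cauchy_Schwarz_ineq2)
    ultimately have "\<bar>potential F v - potential F u\<bar> \<le> (1 + norm (nemytskii f u)) * norm (L2_of v - L2_of u)"
      by (simp add: distrib_right)
    also have "\<dots> \<le> (1 + norm (nemytskii f u)) * (2 * norm (v - u))"
      using Poincare[OF L2_of[of "v - u"]] by (intro mult_left_mono) (simp_all add: norm_H01_def H01_deriv_def L2_of_simps)
    also have "\<dots> < e" using v(3) by (simp add: algebra_simps)
    finally show ?thesis by (simp add: dist_real_def)
  qed
  then show "\<exists>d>0. \<forall>v\<in>S. dist v u < d \<longrightarrow> dist (potential F v) (potential F u) < e"
    using d(1) \<open>e > 0\<close> N by (intro exI[of _ "min (min 1 d) (e / ?N)"]) auto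
qed

section \<open>Strong solutions in integrated form\<close>

lemma distr_lebesgue_plus: "distr lebesgue lebesgue (\<lambda>t::real. c + t) = lebesgue"
  using lebesgue_real_affine[of 1 c] by (simp add: density_1)

lemma measurable_lebesgue_plus: "(\<lambda>t::real. c + t) \<in> lebesgue \<rightarrow>\<^sub>M lebesgue"
  using lebesgue_affine_measurable[of "\<lambda>_::real. 1" c] by simp

lemma AE_lebesgue_plus:
  assumes "AE t in lebesgue. P (t::real)"
  shows "AE t in lebesgue. P (c + t)"
  using AE_distrD[OF measurable_lebesgue_plus[of c], of P] assms unfolding distr_lebesgue_plus .

lemma integrable_lebesgue_plus:
  fixes g :: "real \<Rightarrow> real"
  assumes "integrable lebesgue g"
  shows "integrable lebesgue (\<lambda>t. g (c + t))"
  using integrable_distr[OF measurable_lebesgue_plus[of c]] assms by (simp add: distr_lebesgue_plus)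

lemma AE_lebesgue_neq: "AE t in lebesgue. t \<noteq> (c::real)"
  using AE_not_in[of "{c}" lebesgue] by (simp add: negligible_iff_null_sets[symmetric])

lemma AE_lebesgue_on_Ioo: "(AE t in lebesgue_on {c<..<d::real}. P t) \<longleftrightarrow> (AE t in lebesgue. t \<in> {c<..<d} \<longrightarrow> P t)"
  by (rule AE_restrict_space_iff) simp

text \<open>Extension by zero moves the condition to the whole line, where Lebesgue measure is
  translation invariant.\<close>

lemma L2_time_iff:
  "L2_time T w \<longleftrightarrow> (\<lambda>t. indicator {0<..<T} t *\<^sub>R w t) \<in> borel_measurable lebesgue \<and>
     integrable lebesgue (\<lambda>t. (norm (indicator {0<..<T} t *\<^sub>R w t))\<^sup>2)"
proof -
  have "(\<lambda>t. (norm (indicator {0<..<T} t *\<^sub>R w t))\<^sup>2) = (\<lambda>t. indicator {0<..<T} t *\<^sub>R (norm (w t))\<^sup>2)"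
    by (auto simp: fun_eq_iff indicator_def)
  then show ?thesis
    by (simp add: L2_time_def borel_measurable_restrict_space_iff integrable_restrict_space)
qed

lemma borel_measurable_norm_square:
  fixes W :: "'a \<Rightarrow> 'b::real_normed_vector"
  assumes "W \<in> borel_measurable M"
  shows "(\<lambda>t. (norm (W t))\<^sup>2) \<in> borel_measurable M"
  by (rule measurable_compose[OF assms borel_measurable_continuous_onI]) (intro continuous_intros)

lemma L2_time_subset:
  assumes w: "L2_time T w" and "T' \<le> T"
  shows "L2_time T' w"
proof -
  let ?W = "\<lambda>t. indicator {0<..<T} t *\<^sub>R w t"
  have W: "?W \<in> borel_measurable lebesgue" "integrable lebesgue (\<lambda>t. (norm (?W t))\<^sup>2)"
    using w by (auto simp: L2_time_iff)
  have eq: "(\<lambda>t. indicator {0<..<T'} t *\<^sub>R w t) = (\<lambda>t. if t \<in> {0<..<T'} then ?W t else 0)"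
    using assms(2) by (auto simp: fun_eq_iff indicator_def)
  have m: "(\<lambda>t. indicator {0<..<T'} t *\<^sub>R w t) \<in> borel_measurable lebesgue"
    unfolding eq by (rule measurable_If_set) (use W in auto)
  moreover have "integrable lebesgue (\<lambda>t. (norm (indicator {0<..<T'} t *\<^sub>R w t))\<^sup>2)"
    by (rule Bochner_Integration.integrable_bound[OF W(2)])
      (use borel_measurable_norm_square[OF m] assms(2) in \<open>auto intro!: AE_I2 simp: indicator_def\<close>)
  ultimately show ?thesis by (simp add: L2_time_iff)
qed

lemma L2_time_shift:
  assumes w: "L2_time (T + s) w" and "0 \<le> s"
  shows "L2_time T (\<lambda>t. w (t + s))"
proof -
  let ?W = "\<lambda>t. indicator {0<..<T + s} t *\<^sub>R w t"
  have W: "?W \<in> borel_measurable lebesgue" "integrable lebesgue (\<lambda>t. (norm (?W t))\<^sup>2)"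
    using w by (auto simp: L2_time_iff)
  have eq: "(\<lambda>t. indicator {0<..<T} t *\<^sub>R w (t + s)) = (\<lambda>t. if t \<in> {0<..<T} then ?W (s + t) else 0)"
    using assms(2) by (auto simp: fun_eq_iff indicator_def add.commute)
  have m: "(\<lambda>t. indicator {0<..<T} t *\<^sub>R w (t + s)) \<in> borel_measurable lebesgue"
    unfolding eq by (rule measurable_If_set[OF measurable_compose[OF measurable_lebesgue_plus W(1)]]) auto
  moreover have "integrable lebesgue (\<lambda>t. (norm (indicator {0<..<T} t *\<^sub>R w (t + s)))\<^sup>2)"
    by (rule Bochner_Integration.integrable_bound[OF integrable_lebesgue_plus[OF W(2), of s]])
      (use borel_measurable_norm_square[OF m] assms(2) in \<open>auto intro!: AE_I2 simp: indicator_def add.commute\<close>)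
  ultimately show ?thesis by (simp add: L2_time_iff)
qed

lemma L2_time_glue:
  assumes w1: "L2_time \<tau> w1" and w2: "L2_time T w2" and "0 \<le> \<tau>" and T: "0 < T"
    and w: "\<And>t. 0 < t \<Longrightarrow> t < \<tau> \<Longrightarrow> w t = w1 t" "\<And>t. \<tau> < t \<Longrightarrow> t < T + \<tau> \<Longrightarrow> w t = w2 (t - \<tau>)"
  shows "L2_time (T + \<tau>) w"
proof -
  let ?W = "\<lambda>t. indicator {0<..<T + \<tau>} t *\<^sub>R w t"
  let ?W1 = "\<lambda>t. indicator {0<..<\<tau>} t *\<^sub>R w1 t" and ?W2 = "\<lambda>t. indicator {0<..<T} t *\<^sub>R w2 t"
  have W: "?W1 \<in> borel_measurable lebesgue" "integrable lebesgue (\<lambda>t. (norm (?W1 t))\<^sup>2)"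
    "?W2 \<in> borel_measurable lebesgue" "integrable lebesgue (\<lambda>t. (norm (?W2 t))\<^sup>2)"
    using w1 w2 by (auto simp: L2_time_iff)
  \<comment> \<open>The value of \<open>w\<close> at the junction \<open>\<tau>\<close> is
    arbitrary, hence the singleton branch.\<close>
  have eq: "?W = (\<lambda>t. if t \<in> {..<\<tau>} then ?W1 t else if t \<in> {\<tau>} then ?W \<tau> else ?W2 (- \<tau> + t))"
    using assms(3) w T by (auto simp: fun_eq_iff indicator_def)
  have m: "?W \<in> borel_measurable lebesgue"
    by (subst eq, intro measurable_If_set W(1) measurable_compose[OF measurable_lebesgue_plus W(3)]) auto
  moreover have "integrable lebesgue (\<lambda>t. (norm (?W t))\<^sup>2)"
  proof (rule Bochner_Integration.integrable_bound[OF
        Bochner_Integration.integrable_add[OF W(2) integrable_lebesgue_plus[OF W(4), of "- \<tau>"]]])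
    show "(\<lambda>t. (norm (?W t))\<^sup>2) \<in> borel_measurable lebesgue"
      by (rule borel_measurable_norm_square[OF m])
    show "AE t in lebesgue. norm ((norm (?W t))\<^sup>2) \<le> norm ((norm (?W1 t))\<^sup>2 + (norm (?W2 (- \<tau> + t)))\<^sup>2)"
      using AE_lebesgue_neq[of \<tau>]
    proof eventually_elim
      case (elim t)
      then have "norm (?W t) = norm (?W1 t) \<or> norm (?W t) = norm (?W2 (- \<tau> + t))"
        using fun_cong[OF eq, of t] by (cases "t < \<tau>") simp_all
      then have "(norm (?W t))\<^sup>2 \<le> (norm (?W1 t))\<^sup>2 + (norm (?W2 (- \<tau> + t)))\<^sup>2"
        by (elim disjE) (simp_all only: le_add_same_cancel1 le_add_same_cancel2 zero_le_power2)
      then show ?case by (simp only: real_norm_def abs_of_nonneg zero_le_power2 add_nonneg_nonneg)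
    qed
  qed
  ultimately show ?thesis by (simp add: L2_time_iff)
qed

lemma L2_time_continuous:
  assumes "continuous_on {0..T} w"
  shows "L2_time T w"
  unfolding L2_time_def
proof
  show "w \<in> borel_measurable (lebesgue_on {0<..<T})"
    by (intro continuous_imp_measurable_on_sets_lebesgue continuous_on_subset[OF assms]) auto
  show "integrable (lebesgue_on {0<..<T}) (\<lambda>t. (norm (w t))\<^sup>2)"
    by (intro continuous_imp_integrable_lebesgue_on_Ioo continuous_intros assms)
qed

lemma Linf_time_continuous:
  assumes "continuous_on {0..T} w"
  shows "Linf_time T w"
  unfolding Linf_time_def
proof
  show "w \<in> borel_measurable (lebesgue_on {0<..<T})"
    by (intro continuous_imp_measurable_on_sets_lebesgue continuous_on_subset[OF assms]) auto
  have "bounded (w ` {0..T})"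
    by (intro compact_imp_bounded compact_continuous_image assms) auto
  then obtain B where "\<forall>x\<in>{0..T}. norm (w x) \<le> B" by (auto simp: bounded_iff)
  then show "\<exists>C. AE t in lebesgue_on {0<..<T}. norm (w t) \<le> C"
    by (intro exI[of _ B] AE_I2) auto
qed

lemma L2_time_integrable:
  assumes w: "L2_time T (w :: real \<Rightarrow> 'a::real_inner)"
  shows "integrable (lebesgue_on {0<..<T}) (\<lambda>t. norm (w t))"
    "integrable (lebesgue_on {0<..<T}) (\<lambda>t. inner (w t) v)"
proof -
  have m: "w \<in> borel_measurable (lebesgue_on {0<..<T})"
    and i: "integrable (lebesgue_on {0<..<T}) (\<lambda>t. (norm (w t))\<^sup>2)"
    using w by (auto simp: L2_time_def)
  have le: "norm (w t) \<le> 1 + (norm (w t))\<^sup>2" for t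
  proof -
    have "0 \<le> (norm (w t) - 1)\<^sup>2" by simp
    then show ?thesis by (simp add: power2_eq_square algebra_simps) (smt (verit) norm_ge_zero)
  qed
  have c: "integrable (lebesgue_on {0<..<T}) (\<lambda>t. 1 + (norm (w t))\<^sup>2)"
    by (rule Bochner_Integration.integrable_add[OF continuous_imp_integrable_lebesgue_on_Ioo i]) auto
  show n: "integrable (lebesgue_on {0<..<T}) (\<lambda>t. norm (w t))"
    by (rule Bochner_Integration.integrable_bound[OF c]) (use m le in auto)
  show "integrable (lebesgue_on {0<..<T}) (\<lambda>t. inner (w t) v)"
  proof (rule Bochner_Integration.integrable_bound[OF integrable_mult_left[OF n, of "norm v"]])
    show "(\<lambda>t. inner (w t) v) \<in> borel_measurable (lebesgue_on {0<..<T})"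
      by (rule measurable_compose[OF m borel_measurable_continuous_onI]) (intro continuous_intros)
    show "AE t in lebesgue_on {0<..<T}. norm (inner (w t) v) \<le> norm (norm (w t) * norm v)"
      by (intro AE_I2) (simp add: Cauchy_Schwarz_ineq2)
  qed
qed

lemma primitive_on_subset: "primitive_on T \<phi> \<psi> \<Longrightarrow> T' \<le> T \<Longrightarrow> primitive_on T' \<phi> \<psi>"
  by (auto simp: primitive_on_def)

lemma primitive_on_shift:
  assumes "primitive_on (T + s) \<phi> \<psi>" "0 \<le> s"
  shows "primitive_on T (\<lambda>t. \<phi> (t + s)) (\<lambda>t. \<psi> (t + s))"
  unfolding primitive_on_def
proof (intro allI impI)
  fix r t assume "0 \<le> r" "r \<le> t" "t \<le> T"
  then have "(\<psi> has_integral (\<phi> (t + s) - \<phi> (r + s))) {r + s..t + s}"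
    using assms by (simp add: primitive_on_def)
  then show "((\<lambda>t. \<psi> (t + s)) has_integral (\<phi> (t + s) - \<phi> (r + s))) {r..t}"
    by (subst (asm) has_integral_shift_Icc_real[symmetric]) (simp add: o_def add.commute)
qed

lemma primitive_on_glue:
  assumes p1: "primitive_on \<tau> \<phi>1 \<psi>1" and p2: "primitive_on T \<phi>2 \<psi>2" and "0 \<le> \<tau>"
    and \<phi>: "\<And>t. 0 \<le> t \<Longrightarrow> t \<le> \<tau> \<Longrightarrow> \<phi> t = \<phi>1 t" "\<And>t. \<tau> \<le> t \<Longrightarrow> t \<le> T + \<tau> \<Longrightarrow> \<phi> t = \<phi>2 (t - \<tau>)"
    and \<psi>: "\<And>t. 0 < t \<Longrightarrow> t < \<tau> \<Longrightarrow> \<psi> t = \<psi>1 t" "\<And>t. \<tau> < t \<Longrightarrow> t < T + \<tau> \<Longrightarrow> \<psi> t = \<psi>2 (t - \<tau>)"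
  shows "primitive_on (T + \<tau>) \<phi> \<psi>"
  unfolding primitive_on_def
proof (intro allI impI)
  have A: "(\<psi> has_integral (\<phi> t - \<phi> s)) {s..t}" if "0 \<le> s" "s \<le> t" "t \<le> \<tau>" for s t
  proof (rule has_integral_spike_finite[of "{s, t}"])
    show "(\<psi>1 has_integral (\<phi> t - \<phi> s)) {s..t}"
      using p1 that \<phi>(1) by (simp add: primitive_on_def)
  qed (use that \<psi>(1) in auto)
  have B: "(\<psi> has_integral (\<phi> t - \<phi> s)) {s..t}" if "\<tau> \<le> s" "s \<le> t" "t \<le> T + \<tau>" for s t
  proof (rule has_integral_spike_finite[of "{s, t}"])
    have "(\<psi>2 has_integral (\<phi> t - \<phi> s)) {s - \<tau>..t - \<tau>}"
      using p2 that \<phi>(2) by (simp add: primitive_on_def)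
    then have "((\<lambda>t. \<psi>2 (t - \<tau>)) \<circ> (+) \<tau> has_integral (\<phi> t - \<phi> s)) {s - \<tau>..t - \<tau>}"
      by (simp add: o_def)
    then show "((\<lambda>t. \<psi>2 (t - \<tau>)) has_integral (\<phi> t - \<phi> s)) {s..t}"
      by (subst (asm) has_integral_shift_Icc_real) simp
  qed (use that \<psi>(2) in auto)
  fix s t assume st: "0 \<le> s" "s \<le> t" "t \<le> T + \<tau>"
  consider "t \<le> \<tau>" | "\<tau> \<le> s" | "s < \<tau>" "\<tau> < t" by linarith
  then show "(\<psi> has_integral (\<phi> t - \<phi> s)) {s..t}"
  proof cases
    case 3
    have "(\<psi> has_integral (\<phi> \<tau> - \<phi> s + (\<phi> t - \<phi> \<tau>))) {s..t}"
      by (rule has_integral_combine[OF _ _ A B]) (use 3 st in auto)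
    then show ?thesis by simp
  qed (use A B st in auto)
qed

text \<open>What the equation prescribes for the time derivative of \<open>(u, v)\<close>. Here
  \<open>inner u v\<close> is the product of \<open>H01\<close>, so the first term is the
  diffusion.\<close>

definition weak_rhs :: "(real \<Rightarrow> real) \<Rightarrow> (real \<Rightarrow> real) \<Rightarrow> real \<Rightarrow> L2 \<Rightarrow> H01 \<Rightarrow> H01 \<Rightarrow> real" where
  "weak_rhs a f lam h u v = - (a ((norm u)\<^sup>2) * inner u v) + (lam * inner (nemytskii f u) (L2_of v) + inner h (L2_of v))"

locale continuous_coefficients =
  fixes a f :: "real \<Rightarrow> real" and lam :: real and h :: L2
  assumes f_cont: "continuous_on UNIV f" and a_cont: "continuous_on {0..} a"
begin

lemma continuous_on_a_norm [continuous_intros]: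
  fixes u :: "_ \<Rightarrow> 'b::real_normed_vector"
  assumes "continuous_on S u"
  shows "continuous_on S (\<lambda>t. a ((norm (u t))\<^sup>2))"
  by (rule continuous_on_compose2[OF a_cont]) (auto intro!: continuous_intros assms)

lemma continuous_on_nemytskii [continuous_intros]:
  "continuous_on S u \<Longrightarrow> continuous_on S (\<lambda>t. nemytskii f (u t))"
  by (rule continuous_on_compose2[OF continuous_nemytskii[OF f_cont]]) auto

lemma continuous_on_weak_rhs [continuous_intros]:
  "continuous_on S u \<Longrightarrow> continuous_on S v \<Longrightarrow> continuous_on S (\<lambda>t. weak_rhs a f lam h (u t) (v t))"
  unfolding weak_rhs_def by (intro continuous_intros)

text \<open>For continuous \<open>u\<close> the bounds on \<open>u\<close> and its first space
  derivative are automatic, and both distributional identities become statements about primitives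
  because the pairings are continuous in time. In this form solutions can be shifted and
  concatenated.\<close>

lemma strong_solutions_iff:
  "u \<in> strong_solutions a f lam h \<longleftrightarrow> continuous_on {0..} u \<and>
     (\<forall>T>0. (AE t in lebesgue_on {0<..<T}. L2_of (u t) \<in> H2) \<and>
       L2_time T (\<lambda>t. weak_deriv (H01_deriv (u t))) \<and>
       (\<exists>w. L2_time T w \<and> (\<forall>v. primitive_on T (\<lambda>t. inner (L2_of (u t)) v) (\<lambda>t. inner (w t) v))) \<and>
       (\<forall>v. primitive_on T (\<lambda>t. inner (L2_of (u t)) (L2_of v)) (\<lambda>t. weak_rhs a f lam h (u t) v)))"
proof (cases "continuous_on {0..} u")
  case True
  have c: "continuous_on {0..T} u" for T by (rule continuous_on_subset[OF True]) auto
  have cL: "continuous_on {0..T} (\<lambda>t. inner (L2_of (u t)) v)" for T v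
    by (intro continuous_intros continuous_on_L2_of c)
  have dp: "distrib_deriv_on T \<phi> \<psi> \<longleftrightarrow> primitive_on T \<phi> \<psi>"
    if "continuous_on {0..T} \<phi>" "integrable (lebesgue_on {0<..<T}) \<psi>" for T \<phi> \<psi>
    using primitive_on_if_distrib_deriv_on primitive_on_imp_distrib_deriv_on that by blast
  have "Linf_time T u" for T by (rule Linf_time_continuous[OF c])
  moreover have "L2_time_H2 T u \<longleftrightarrow> (AE t in lebesgue_on {0<..<T}. L2_of (u t) \<in> H2) \<and>
       L2_time T (\<lambda>t. weak_deriv (H01_deriv (u t)))" for T
    unfolding L2_time_H2_def
    using L2_time_continuous[OF continuous_on_L2_of[OF c]] L2_time_continuous[OF continuous_on_H01_deriv[OF c]] by blast
  moreover have "(L2_time T w \<and> has_time_deriv T (\<lambda>t. L2_of (u t)) w) \<longleftrightarrow>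
      L2_time T w \<and> (\<forall>v. primitive_on T (\<lambda>t. inner (L2_of (u t)) v) (\<lambda>t. inner (w t) v))" for T w
  proof -
    have "has_time_deriv T (\<lambda>t. L2_of (u t)) w \<longleftrightarrow>
      (\<forall>v. distrib_deriv_on T (\<lambda>t. inner (L2_of (u t)) v) (\<lambda>t. inner (w t) v))"
      unfolding has_time_deriv_def distrib_deriv_on_def by blast
    then show ?thesis using dp[OF cL L2_time_integrable(2)] by blast
  qed
  moreover have "(\<forall>\<phi> \<in> Cc_infty {0<..<T}.
        - (\<integral>t. inner (L2_of (u t)) (L2_of v) * deriv \<phi> t \<partial>lebesgue_on {0<..<T})
        + (\<integral>t. a ((norm (u t))\<^sup>2) * inner (H01_deriv (u t)) (H01_deriv v) * \<phi> t \<partial>lebesgue_on {0<..<T})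
        = (\<integral>t. (lam * inner (nemytskii f (u t)) (L2_of v) + inner h (L2_of v)) * \<phi> t \<partial>lebesgue_on {0<..<T}))
      \<longleftrightarrow> primitive_on T (\<lambda>t. inner (L2_of (u t)) (L2_of v)) (\<lambda>t. weak_rhs a f lam h (u t) v)" for T v
  proof -
    have cw: "continuous_on {0..T} (\<lambda>t. weak_rhs a f lam h (u t) v)" by (intro continuous_intros c)
    let ?A = "\<lambda>t. a ((norm (u t))\<^sup>2) * inner (H01_deriv (u t)) (H01_deriv v)"
    let ?B = "\<lambda>t. lam * inner (nemytskii f (u t)) (L2_of v) + inner h (L2_of v)"
    have "(\<integral>t. weak_rhs a f lam h (u t) v * \<phi> t \<partial>lebesgue_on {0<..<T}) =
       - (\<integral>t. ?A t * \<phi> t \<partial>lebesgue_on {0<..<T}) + (\<integral>t. ?B t * \<phi> t \<partial>lebesgue_on {0<..<T})"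
      if "\<phi> \<in> Cc_infty {0<..<T}" for \<phi>
    proof -
      have cp: "continuous_on {0..T} \<phi>" using that Cc_inftyD(1) smooth_continuous_on by blast
      have i1: "integrable (lebesgue_on {0<..<T}) (\<lambda>t. ?A t * \<phi> t)"
        by (intro continuous_imp_integrable_lebesgue_on_Ioo continuous_intros c cp continuous_on_H01_deriv)
      have i2: "integrable (lebesgue_on {0<..<T}) (\<lambda>t. ?B t * \<phi> t)"
        by (intro continuous_imp_integrable_lebesgue_on_Ioo continuous_intros c cp)
      have "(\<lambda>t. weak_rhs a f lam h (u t) v * \<phi> t) = (\<lambda>t. ?B t * \<phi> t - ?A t * \<phi> t)"
        by (simp add: fun_eq_iff weak_rhs_def inner_H01_eq algebra_simps)
      then show ?thesis using Bochner_Integration.integral_diff[OF i2 i1] by simp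
    qed
    then have "(\<forall>\<phi> \<in> Cc_infty {0<..<T}.
        - (\<integral>t. inner (L2_of (u t)) (L2_of v) * deriv \<phi> t \<partial>lebesgue_on {0<..<T})
        + (\<integral>t. ?A t * \<phi> t \<partial>lebesgue_on {0<..<T}) = (\<integral>t. ?B t * \<phi> t \<partial>lebesgue_on {0<..<T}))
      \<longleftrightarrow> distrib_deriv_on T (\<lambda>t. inner (L2_of (u t)) (L2_of v)) (\<lambda>t. weak_rhs a f lam h (u t) v)"
      unfolding distrib_deriv_on_def by (intro ball_cong refl) auto
    also have "\<dots> \<longleftrightarrow> primitive_on T (\<lambda>t. inner (L2_of (u t)) (L2_of v)) (\<lambda>t. weak_rhs a f lam h (u t) v)"
      by (rule dp[OF cL continuous_imp_integrable_lebesgue_on_Ioo[OF cw]])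
    finally show ?thesis .
  qed
  ultimately show ?thesis
    using True unfolding strong_solutions_def mem_Collect_eq by simp
next
  case False
  then show ?thesis by (simp add: strong_solutions_def)
qed

lemma strong_solutions_shift:
  assumes u: "u \<in> strong_solutions a f lam h" and s: "0 \<le> s"
  shows "(\<lambda>t. u (t + s)) \<in> strong_solutions a f lam h"
  unfolding strong_solutions_iff
proof (intro conjI allI impI)
  note u = u[unfolded strong_solutions_iff]
  show "continuous_on {0..} (\<lambda>t. u (t + s))"
    by (rule continuous_on_compose2[OF conjunct1[OF u]]) (use s in \<open>auto intro!: continuous_intros\<close>)
  fix T :: real assume "T > 0"
  then have "T + s > 0" using s by simp
  with u have uT: "AE t in lebesgue_on {0<..<T + s}. L2_of (u t) \<in> H2"
    "L2_time (T + s) (\<lambda>t. weak_deriv (H01_deriv (u t)))"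
    "\<exists>w. L2_time (T + s) w \<and> (\<forall>v. primitive_on (T + s) (\<lambda>t. inner (L2_of (u t)) v) (\<lambda>t. inner (w t) v))"
    "\<And>v. primitive_on (T + s) (\<lambda>t. inner (L2_of (u t)) (L2_of v)) (\<lambda>t. weak_rhs a f lam h (u t) v)"
    by blast+
  from AE_lebesgue_plus[OF uT(1)[unfolded AE_lebesgue_on_Ioo], of s]
  show "AE t in lebesgue_on {0<..<T}. L2_of (u (t + s)) \<in> H2"
    unfolding AE_lebesgue_on_Ioo by (rule AE_mp) (use s in \<open>auto intro!: AE_I2 simp: add.commute\<close>)
  show "L2_time T (\<lambda>t. weak_deriv (H01_deriv (u (t + s))))"
    by (rule L2_time_shift[OF uT(2) s])
  from uT(3) obtain w where w: "L2_time (T + s) w"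
    "\<And>v. primitive_on (T + s) (\<lambda>t. inner (L2_of (u t)) v) (\<lambda>t. inner (w t) v)" by blast
  show "\<exists>w. L2_time T w \<and> (\<forall>v. primitive_on T (\<lambda>t. inner (L2_of (u (t + s))) v) (\<lambda>t. inner (w t) v))"
    using L2_time_shift[OF w(1) s] primitive_on_shift[OF w(2) s] by (intro exI[of _ "\<lambda>t. w (t + s)"]) simp
  show "primitive_on T (\<lambda>t. inner (L2_of (u (t + s))) (L2_of v)) (\<lambda>t. weak_rhs a f lam h (u (t + s)) v)" for v
    using primitive_on_shift[OF uT(4) s] by simp
qed

text \<open>Primitives over adjacent intervals add up once the values agree at
  \<open>\<tau>\<close>; the remaining conditions ignore a single instant.\<close>

lemma strong_solutions_glue:
  assumes u1: "u1 \<in> strong_solutions a f lam h" and u2: "u2 \<in> strong_solutions a f lam h"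
    and \<tau>: "0 < \<tau>" and eq: "u2 0 = u1 \<tau>"
  shows "(\<lambda>t. if t \<le> \<tau> then u1 t else u2 (t - \<tau>)) \<in> strong_solutions a f lam h" (is "?u \<in> _")
  unfolding strong_solutions_iff
proof (intro conjI allI impI)
  note u1 = u1[unfolded strong_solutions_iff] and u2 = u2[unfolded strong_solutions_iff]
  have right: "?u t = u2 (t - \<tau>)" if "\<tau> \<le> t" for t
    using that eq by auto
  have "continuous_on ({0..\<tau>} \<union> {\<tau>..}) ?u"
  proof (rule continuous_on_If)
    show "continuous_on {0..\<tau>} u1" by (rule continuous_on_subset[OF conjunct1[OF u1]]) auto
    show "continuous_on {\<tau>..} (\<lambda>t. u2 (t - \<tau>))"
      by (rule continuous_on_compose2[OF conjunct1[OF u2]]) (auto intro!: continuous_intros)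
  qed (use eq in auto)
  moreover have "{0..\<tau>} \<union> {\<tau>..} = {0..}" using \<tau> by auto
  ultimately show "continuous_on {0..} ?u" by simp
  fix T :: real assume T: "T > 0"
  from u1 \<tau> have h1: "AE t in lebesgue_on {0<..<\<tau>}. L2_of (u1 t) \<in> H2"
    "L2_time \<tau> (\<lambda>t. weak_deriv (H01_deriv (u1 t)))"
    "\<exists>w. L2_time \<tau> w \<and> (\<forall>v. primitive_on \<tau> (\<lambda>t. inner (L2_of (u1 t)) v) (\<lambda>t. inner (w t) v))"
    "\<And>v. primitive_on \<tau> (\<lambda>t. inner (L2_of (u1 t)) (L2_of v)) (\<lambda>t. weak_rhs a f lam h (u1 t) v)"
    by blast+
  from u2 T have h2: "AE t in lebesgue_on {0<..<T}. L2_of (u2 t) \<in> H2"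
    "L2_time T (\<lambda>t. weak_deriv (H01_deriv (u2 t)))"
    "\<exists>w. L2_time T w \<and> (\<forall>v. primitive_on T (\<lambda>t. inner (L2_of (u2 t)) v) (\<lambda>t. inner (w t) v))"
    "\<And>v. primitive_on T (\<lambda>t. inner (L2_of (u2 t)) (L2_of v)) (\<lambda>t. weak_rhs a f lam h (u2 t) v)"
    by blast+
  \<comment> \<open>All properties are glued on \<open>(0, T + \<tau>)\<close> and then restricted
    to \<open>(0, T)\<close>, which avoids comparing \<open>T\<close> with
    \<open>\<tau>\<close>.\<close>
  have T': "T \<le> T + \<tau>" "0 \<le> \<tau>" using \<tau> by auto
  show "AE t in lebesgue_on {0<..<T}. L2_of (?u t) \<in> H2"
    unfolding AE_lebesgue_on_Ioo
    using h1(1)[unfolded AE_lebesgue_on_Ioo] AE_lebesgue_plus[OF h2(1)[unfolded AE_lebesgue_on_Ioo], of "- \<tau>"]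
      AE_lebesgue_neq[of \<tau>]
    by eventually_elim (use \<tau> in auto)
  have "L2_time (T + \<tau>) (\<lambda>t. weak_deriv (H01_deriv (?u t)))"
    by (rule L2_time_glue[OF h1(2) h2(2) T'(2) T]) auto
  then show "L2_time T (\<lambda>t. weak_deriv (H01_deriv (?u t)))"
    by (rule L2_time_subset[OF _ T'(1)])
  from h1(3) obtain w1 where w1: "L2_time \<tau> w1"
    "\<And>v. primitive_on \<tau> (\<lambda>t. inner (L2_of (u1 t)) v) (\<lambda>t. inner (w1 t) v)" by blast
  from h2(3) obtain w2 where w2: "L2_time T w2"
    "\<And>v. primitive_on T (\<lambda>t. inner (L2_of (u2 t)) v) (\<lambda>t. inner (w2 t) v)" by blast
  let ?w = "\<lambda>t. if t \<le> \<tau> then w1 t else w2 (t - \<tau>)"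
  have "L2_time (T + \<tau>) ?w"
    by (rule L2_time_glue[OF w1(1) w2(1) T'(2) T]) auto
  moreover have "primitive_on (T + \<tau>) (\<lambda>t. inner (L2_of (?u t)) v) (\<lambda>t. inner (?w t) v)" for v
    by (rule primitive_on_glue[OF w1(2) w2(2) T'(2)]) (use right in auto)
  ultimately show "\<exists>w. L2_time T w \<and> (\<forall>v. primitive_on T (\<lambda>t. inner (L2_of (?u t)) v) (\<lambda>t. inner (w t) v))"
    using L2_time_subset[OF _ T'(1)] primitive_on_subset[OF _ T'(1)] by blast
  have "primitive_on (T + \<tau>) (\<lambda>t. inner (L2_of (?u t)) (L2_of v)) (\<lambda>t. weak_rhs a f lam h (?u t) v)" for v
    by (rule primitive_on_glue[OF h1(4) h2(4) T'(2)]) (use right in auto)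
  then show "primitive_on T (\<lambda>t. inner (L2_of (?u t)) (L2_of v)) (\<lambda>t. weak_rhs a f lam h (?u t) v)" for v
    by (rule primitive_on_subset[OF _ T'(1)])
qed

lemma stationary_imp_strong_solution:
  assumes z: "z \<in> stationary_points a f lam h"
  shows "(\<lambda>t. z) \<in> strong_solutions a f lam h"
  unfolding strong_solutions_iff
proof (intro conjI allI impI)
  have H2: "L2_of z \<in> H2" and eq: "- a ((norm z)\<^sup>2) *\<^sub>R weak_deriv (H01_deriv z) = lam *\<^sub>R nemytskii f z + h"
    using z by (auto simp: stationary_points_def)
  fix T :: real
  show "AE t in lebesgue_on {0<..<T}. L2_of z \<in> H2" using H2 by simp
  show "L2_time T (\<lambda>t. weak_deriv (H01_deriv z))" by (intro L2_time_continuous continuous_intros)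
  have p0: "primitive_on T (\<lambda>t. c) (\<lambda>t. 0)" for c by (simp add: primitive_on_def)
  then show "\<exists>w. L2_time T w \<and> (\<forall>v. primitive_on T (\<lambda>t. inner (L2_of z) v) (\<lambda>t. inner (w t) v))"
    by (intro exI[of _ "\<lambda>t. 0"]) (auto intro!: L2_time_continuous continuous_intros)
  have "weak_rhs a f lam h z v = 0" for v
  proof -
    have "inner (- a ((norm z)\<^sup>2) *\<^sub>R weak_deriv (H01_deriv z)) (L2_of v) = inner (lam *\<^sub>R nemytskii f z + h) (L2_of v)"
      by (simp only: eq)
    then show ?thesis by (simp add: weak_rhs_def inner_H01_H2[OF H2] inner_add_left)
  qed
  then show "primitive_on T (\<lambda>t. inner (L2_of z) (L2_of v)) (\<lambda>t. weak_rhs a f lam h z v)" for v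
    using p0 by simp
qed (intro continuous_intros)

text \<open>Division by the positive number \<open>a ((norm z)\<^sup>2)\<close> leaves a linear weak
  equation for \<open>z\<close>, and \<open>weak_equation_imp_H2\<close> supplies the second
  derivative.\<close>

lemma weak_rhs_zero_imp_stationary:
  assumes "\<And>v. weak_rhs a f lam h z v = 0" and pos: "a ((norm z)\<^sup>2) > 0"
  shows "z \<in> stationary_points a f lam h"
proof -
  let ?a = "a ((norm z)\<^sup>2)" and ?g = "(1 / a ((norm z)\<^sup>2)) *\<^sub>R (lam *\<^sub>R nemytskii f z + h)"
  have "inner z v = inner ?g (L2_of v)" for v
  proof -
    have "?a * inner z v = inner (lam *\<^sub>R nemytskii f z + h) (L2_of v)"
      using assms(1)[of v] by (simp add: weak_rhs_def inner_add_left)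
    moreover have "?a * inner ?g (L2_of v) = inner (lam *\<^sub>R nemytskii f z + h) (L2_of v)"
      using pos by (simp only: inner_scaleR_left) simp
    ultimately show ?thesis using pos by (metis mult_cancel_left order_less_irrefl)
  qed
  from weak_equation_imp_H2[OF this] show ?thesis
    using pos by (simp add: stationary_points_def)
qed

end

section \<open>The energy inequality\<close>

lemma continuous_on_Icc_le:
  fixes g :: "real \<Rightarrow> real"
  assumes "continuous_on {c..d} g"
  obtains B where "\<And>x. x \<in> {c..d} \<Longrightarrow> g x \<le> B"
proof -
  have "bounded (g ` {c..d})"
    by (intro compact_imp_bounded compact_continuous_image assms) auto
  then obtain B where "\<forall>x\<in>{c..d}. \<bar>g x\<bar> \<le> B" by (auto simp: bounded_iff)
  then show thesis using that[of B] by (simp add: abs_le_iff)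
qed

text \<open>The coefficient \<open>a\<close> is only assumed continuous on \<open>[0, \<infinity>)\<close>, hence the truncation in the equation
  for its antiderivative.\<close>

locale energy_setting = continuous_coefficients +
  fixes m :: real and F Ahat :: "real \<Rightarrow> real"
  assumes m_pos: "m > 0" and a_ge: "\<And>s. s \<ge> 0 \<Longrightarrow> a s \<ge> m"
    and F_deriv: "\<And>x. (F has_field_derivative f x) (at x)"
    and Ahat_deriv: "\<And>x. (Ahat has_field_derivative a (max 0 x)) (at x)"
begin

definition energy :: "H01 \<Rightarrow> real" where
  "energy u = Ahat ((norm u)\<^sup>2) / 2 - (lam * potential F u + inner h (L2_of u))"

lemma continuous_on_energy: "continuous_on S energy"
proof -
  have "continuous_on UNIV Ahat"
    using Ahat_deriv by (meson DERIV_continuous_on has_field_derivative_at_within)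
  then have "continuous_on S (\<lambda>u. Ahat ((norm u)\<^sup>2))"
    by (rule continuous_on_compose2) (auto intro!: continuous_intros)
  moreover have "continuous_on S (potential F)"
    by (rule continuous_potential[OF f_cont F_deriv])
  ultimately show ?thesis
    unfolding energy_def by (intro continuous_intros continuous_on_L2_of) auto
qed

definition force :: "H01 \<Rightarrow> H01 \<Rightarrow> real" where
  "force u v = lam * inner (nemytskii f u) (L2_of v) + inner h (L2_of v)"

lemma weak_rhs_eq: "weak_rhs a f lam h u v = force u v - a ((norm u)\<^sup>2) * inner u v"
  by (simp add: weak_rhs_def force_def)

lemma weak_rhs_scaleR: "weak_rhs a f lam h u (c *\<^sub>R v) = c * weak_rhs a f lam h u v"
  by (simp add: weak_rhs_def L2_of_simps inner_add_right algebra_simps)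

lemma norm_L2_of_le: "norm (L2_of u) \<le> 2 * norm u"
  using Poincare[OF L2_of[of u]] by (simp add: norm_H01_def H01_deriv_def)

lemma force_le: "force u v \<le> (\<bar>lam\<bar> * norm (nemytskii f u) + norm h) * norm (L2_of v)"
proof -
  have "lam * inner (nemytskii f u) (L2_of v) \<le> \<bar>lam * inner (nemytskii f u) (L2_of v)\<bar>"
    by (rule abs_ge_self)
  also have "\<dots> \<le> \<bar>lam\<bar> * (norm (nemytskii f u) * norm (L2_of v))"
    unfolding abs_mult by (rule mult_left_mono[OF Cauchy_Schwarz_ineq2]) simp
  finally have "lam * inner (nemytskii f u) (L2_of v) \<le> \<bar>lam\<bar> * (norm (nemytskii f u) * norm (L2_of v))" .
  then show ?thesis
    using norm_cauchy_schwarz[of h "L2_of v"] by (simp add: force_def distrib_right mult.assoc)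
qed

text \<open>A bound for the dual norm of \<open>weak_rhs\<close>, continuous in \<open>u\<close>;
  the factor 2 is the constant of \<open>Poincare\<close>.\<close>

definition rhs_bound :: "H01 \<Rightarrow> real" where
  "rhs_bound u = a ((norm u)\<^sup>2) * norm u + (\<bar>lam\<bar> * norm (nemytskii f u) + norm h) * 2"

lemma weak_rhs_le: "\<bar>weak_rhs a f lam h u v\<bar> \<le> rhs_bound u * norm v"
proof -
  have a0: "0 \<le> a ((norm u)\<^sup>2)" using a_ge[of "(norm u)\<^sup>2"] m_pos by simp
  have le: "weak_rhs a f lam h u v \<le> rhs_bound u * norm v" for v
  proof -
    have "force u v \<le> (\<bar>lam\<bar> * norm (nemytskii f u) + norm h) * (2 * norm v)"
      by (rule order.trans[OF force_le mult_left_mono[OF norm_L2_of_le]]) simp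
    moreover have "- (a ((norm u)\<^sup>2) * inner u v) \<le> a ((norm u)\<^sup>2) * (norm u * norm v)"
      using mult_left_mono[OF norm_cauchy_schwarz[of "- u" v] a0] by simp
    ultimately show ?thesis
      by (simp add: weak_rhs_eq rhs_bound_def algebra_simps)
  qed
  show ?thesis using le[of v] le[of "- v"] weak_rhs_scaleR[of u "-1" v] by (simp add: abs_le_iff)
qed

text \<open>The slope is \<open>a x\<close> at the moving point, not \<open>a y\<close>, because
  \<open>dist_sq_le\<close> contains the coefficient at the running time. Continuity of
  \<open>a\<close> at \<open>y\<close> makes the two interchangeable.\<close>

lemma Ahat_first_order:
  assumes "y \<ge> 0" "e > 0"
  obtains d where "d > 0" "\<And>x. x \<ge> 0 \<Longrightarrow> \<bar>x - y\<bar> < d \<Longrightarrow> \<bar>Ahat x - Ahat y - a x * (x - y)\<bar> \<le> e * \<bar>x - y\<bar>"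
proof -
  have "continuous_on UNIV (\<lambda>x. a (max 0 x))"
    by (rule continuous_on_compose2[OF a_cont]) (auto intro!: continuous_intros)
  then have "isCont (\<lambda>x. a (max 0 x)) y" by (simp add: continuous_on_eq_continuous_at)
  from this[unfolded continuous_at_eps_delta, rule_format, of "e / 2"] assms(2)
  obtain d where d: "d > 0" "\<And>x. \<bar>x - y\<bar> < d \<Longrightarrow> \<bar>a (max 0 x) - a (max 0 y)\<bar> < e / 2"
    by (auto simp: dist_real_def)
  show thesis
  proof (rule that[OF d(1)])
    fix x :: real assume x: "x \<ge> 0" "\<bar>x - y\<bar> < d"
    obtain z where z: "\<bar>z - y\<bar> \<le> \<bar>x - y\<bar>" "Ahat x - Ahat y = (x - y) * a (max 0 z)"
    proof (cases x y rule: linorder_cases)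
      case less
      from MVT2[OF this, of Ahat "\<lambda>x. a (max 0 x)"] Ahat_deriv obtain z
        where "x < z" "z < y" "Ahat y - Ahat x = (y - x) * a (max 0 z)" by blast
      then show ?thesis by (intro that[of z]) (auto simp: algebra_simps)
    next
      case greater
      from MVT2[OF this, of Ahat "\<lambda>x. a (max 0 x)"] Ahat_deriv obtain z
        where "y < z" "z < x" "Ahat x - Ahat y = (x - y) * a (max 0 z)" by blast
      then show ?thesis by (intro that[of z]) auto
    qed (use that[of y] in auto)
    have "\<bar>a (max 0 z) - a x\<bar> \<le> e"
    proof -
      have "\<bar>a (max 0 z) - a (max 0 y)\<bar> < e / 2" "\<bar>a (max 0 x) - a (max 0 y)\<bar> < e / 2"
        using z(1) x(2) by (intro d(2); simp)+
      then have "\<bar>a (max 0 z) - a (max 0 x)\<bar> < e" by linarith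
      then show ?thesis using x(1) by (simp add: max_absorb2)
    qed
    then have "\<bar>(a (max 0 z) - a x) * (x - y)\<bar> \<le> e * \<bar>x - y\<bar>"
      unfolding abs_mult by (rule mult_right_mono) simp
    then show "\<bar>Ahat x - Ahat y - a x * (x - y)\<bar> \<le> e * \<bar>x - y\<bar>"
      by (simp add: z(2) algebra_simps)
  qed
qed

end

locale strong_solution = energy_setting +
  fixes u :: "real \<Rightarrow> H01"
  assumes u_sol: "u \<in> strong_solutions a f lam h"
begin

section \<open>Squared distances and bounded variation along a solution\<close>

lemma u_cont: "continuous_on {0..} u"
  using u_sol by (simp add: strong_solutions_iff)

lemma u_cont_Icc [continuous_intros]: "0 \<le> s \<Longrightarrow> continuous_on {s..t} u"
  by (rule continuous_on_subset[OF u_cont]) auto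

lemma pairing_has_integral:
  assumes "0 \<le> s" "s \<le> t"
  shows "((\<lambda>r. weak_rhs a f lam h (u r) v) has_integral
    (inner (L2_of (u t)) (L2_of v) - inner (L2_of (u s)) (L2_of v))) {s..t}"
proof -
  have "primitive_on (t + 1) (\<lambda>t. inner (L2_of (u t)) (L2_of v)) (\<lambda>t. weak_rhs a f lam h (u t) v)"
    using u_sol assms unfolding strong_solutions_iff by simp
  then show ?thesis using assms by (simp add: primitive_on_def)
qed

lemma pairing_has_derivative:
  assumes "0 \<le> t" "t \<le> T"
  shows "((\<lambda>r. inner (L2_of (u r)) (L2_of v)) has_real_derivative weak_rhs a f lam h (u t) v) (at t within {0..T})"
proof -
  have "continuous_on {0..T} (\<lambda>r. weak_rhs a f lam h (u r) v)"
    by (intro continuous_intros) auto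
  then have "((\<lambda>r. integral {0..r} (\<lambda>r. weak_rhs a f lam h (u r) v)) has_real_derivative weak_rhs a f lam h (u t) v) (at t within {0..T})"
    unfolding has_real_derivative_iff_has_vector_derivative
    by (rule integral_has_vector_derivative) (use assms in auto)
  then have "((\<lambda>r. inner (L2_of (u 0)) (L2_of v) + integral {0..r} (\<lambda>r. weak_rhs a f lam h (u r) v))
      has_real_derivative weak_rhs a f lam h (u t) v) (at t within {0..T})"
    by (auto intro!: derivative_eq_intros)
  then show ?thesis
    by (rule has_field_derivative_transform_within[of _ _ _ _ 1])
      (use assms in \<open>auto simp: integral_unique[OF pairing_has_integral]\<close>)
qed

text \<open>For fixed \<open>v\<close> the pairing is Lipschitz in time with constant
  \<open>C * norm v\<close>. Taking \<open>v = u r - u t\<close> bounds the square by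
  \<open>C * norm (u r - u t) * \<bar>r - t\<bar>\<close>, and the norm tends to 0 by continuity
  into \<open>H01\<close>.\<close>

lemma dist_sq_has_derivative_0:
  assumes "0 \<le> t" "t \<le> T"
  shows "((\<lambda>r. (norm (L2_of (u r) - L2_of (u t)))\<^sup>2) has_real_derivative 0) (at t within {0..T})"
proof -
  have "continuous_on {0..T} (\<lambda>r. rhs_bound (u r))"
    unfolding rhs_bound_def by (intro continuous_intros) auto
  then obtain C where C: "\<And>r. r \<in> {0..T} \<Longrightarrow> rhs_bound (u r) \<le> C"
    by (rule continuous_on_Icc_le) blast
  have est: "\<bar>inner (L2_of (u s)) (L2_of v) - inner (L2_of (u r)) (L2_of v)\<bar> \<le> C * norm v * (s - r)"
    if "0 \<le> r" "r \<le> s" "s \<le> T" for r s v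
  proof -
    have "norm (inner (L2_of (u s)) (L2_of v) - inner (L2_of (u r)) (L2_of v)) \<le> C * norm v * measure lborel {r..s}"
    proof (rule has_integral_bound_real[where S = "{}"])
      show "((\<lambda>r. weak_rhs a f lam h (u r) v) has_integral
          (inner (L2_of (u s)) (L2_of v) - inner (L2_of (u r)) (L2_of v))) {r..s}"
        using pairing_has_integral[of r s v] that by simp
      have "0 \<le> rhs_bound (u r)"
        using a_ge[of "(norm (u r))\<^sup>2"] m_pos by (simp add: rhs_bound_def)
      then show "0 \<le> C * norm v" using C[of r] that by simp
      show "norm (weak_rhs a f lam h (u x) v) \<le> C * norm v" if "x \<in> {r..s} - {}" for x
        using order.trans[OF weak_rhs_le mult_right_mono[OF C]] that \<open>0 \<le> r\<close> \<open>s \<le> T\<close> by simp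
    qed simp
    then show ?thesis using that by simp
  qed
  have est2: "(norm (L2_of (u r) - L2_of (u t)))\<^sup>2 \<le> C * norm (u r - u t) * \<bar>r - t\<bar>" if "r \<in> {0..T}" for r
  proof (cases "t \<le> r")
    case True
    then show ?thesis using est[of t r "u r - u t"] assms that
      by (simp add: power2_norm_eq_inner L2_of_simps inner_diff_left)
  next
    case False
    then show ?thesis using est[of r t "u r - u t"] assms that
      by (simp add: power2_norm_eq_inner L2_of_simps inner_diff_left)
  qed
  have "((\<lambda>r. C * norm (u r - u t)) \<longlongrightarrow> C * norm (u t - u t)) (at t within {0..T})"
    using u_cont_Icc[of 0 T] assms by (intro tendsto_intros) (auto simp: continuous_on_def)
  then have "((\<lambda>r. C * norm (u r - u t)) \<longlongrightarrow> 0) (at t within {0..T})" by simp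
  then have "((\<lambda>r. (norm (L2_of (u r) - L2_of (u t)))\<^sup>2 / (r - t)) \<longlongrightarrow> 0) (at t within {0..T})"
  proof (rule Lim_null_comparison[rotated])
    show "\<forall>\<^sub>F r in at t within {0..T}. norm ((norm (L2_of (u r) - L2_of (u t)))\<^sup>2 / (r - t)) \<le> C * norm (u r - u t)"
      unfolding eventually_at_filter
    proof (intro always_eventually allI impI)
      fix r assume "r \<noteq> t" "r \<in> {0..T}"
      then show "norm ((norm (L2_of (u r) - L2_of (u t)))\<^sup>2 / (r - t)) \<le> C * norm (u r - u t)"
        using est2[of r] by (simp add: pos_divide_le_eq)
    qed
  qed
  then show ?thesis by (simp add: has_field_derivative_iff)
qed

lemma dist_sq_has_integral:
  assumes t: "0 \<le> t" and r: "t \<le> r"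
  shows "((\<lambda>\<sigma>. 2 * weak_rhs a f lam h (u \<sigma>) (u \<sigma> - u t)) has_integral (norm (L2_of (u r) - L2_of (u t)))\<^sup>2) {t..r}"
proof -
  let ?z = "\<lambda>r. (norm (L2_of (u r) - L2_of (u t)))\<^sup>2"
  have "((\<lambda>\<sigma>. 2 * weak_rhs a f lam h (u \<sigma>) (u \<sigma> - u t)) has_integral (?z r - ?z t)) {t..r}"
  proof (rule fundamental_theorem_of_calculus[OF r])
    fix x assume x: "x \<in> {t..r}"
    let ?v = "2 *\<^sub>R (u x - u t)"
    \<comment> \<open>Expansion about \<open>x\<close>: the distance to \<open>u x\<close> has
      derivative 0 there, and the rest is a pairing with the fixed element \<open>?v\<close>. This
      gives the derivative at every \<open>x\<close>, although \<open>u\<close> need not be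
      differentiable.\<close>
    have eq: "?z = (\<lambda>y. (norm (L2_of (u y) - L2_of (u x)))\<^sup>2 + inner (L2_of (u y)) (L2_of ?v) +
        (?z x - inner (L2_of (u x)) (L2_of ?v)))"
      by (simp add: fun_eq_iff power2_norm_eq_inner L2_of_simps inner_diff_left inner_diff_right inner_commute algebra_simps)
    have "((\<lambda>y. (norm (L2_of (u y) - L2_of (u x)))\<^sup>2 + inner (L2_of (u y)) (L2_of ?v) +
        (?z x - inner (L2_of (u x)) (L2_of ?v))) has_real_derivative
        0 + weak_rhs a f lam h (u x) ?v + 0) (at x within {0..r})"
      by (intro DERIV_add dist_sq_has_derivative_0 pairing_has_derivative DERIV_const) (use x t in auto)
    then have "(?z has_real_derivative weak_rhs a f lam h (u x) ?v) (at x within {0..r})"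
      by (subst eq) simp
    then have "(?z has_real_derivative weak_rhs a f lam h (u x) ?v) (at x within {t..r})"
      by (rule has_field_derivative_subset) (use t in auto)
    then show "(?z has_vector_derivative 2 * weak_rhs a f lam h (u x) (u x - u t)) (at x within {t..r})"
      by (simp add: has_real_derivative_iff_has_vector_derivative weak_rhs_scaleR)
  qed
  then show ?thesis by simp
qed

lemma dist_sq_le:
  assumes t: "0 \<le> t" and r: "t \<le> r"
  shows "(norm (L2_of (u r) - L2_of (u t)))\<^sup>2 \<le> integral {t..r}
    (\<lambda>\<sigma>. 2 * force (u \<sigma>) (u \<sigma> - u t) - a ((norm (u \<sigma>))\<^sup>2) * ((norm (u \<sigma>))\<^sup>2 - (norm (u t))\<^sup>2))"
proof (rule has_integral_le[OF dist_sq_has_integral[OF t r] integrable_integral])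
  show "(\<lambda>\<sigma>. 2 * force (u \<sigma>) (u \<sigma> - u t) - a ((norm (u \<sigma>))\<^sup>2) * ((norm (u \<sigma>))\<^sup>2 - (norm (u t))\<^sup>2))
      integrable_on {t..r}"
    unfolding force_def by (intro integrable_continuous_real continuous_intros continuous_on_L2_of t)
  fix \<sigma> assume "\<sigma> \<in> {t..r}"
  \<comment> \<open>Convexity of the squared norm trades the product of \<open>u \<sigma>\<close>
    with an increment for an increment of \<open>norm u\<close> squared.\<close>
  have "(norm (u \<sigma>))\<^sup>2 - (norm (u t))\<^sup>2 \<le> 2 * inner (u \<sigma>) (u \<sigma> - u t)"
  proof -
    have "0 \<le> inner (u \<sigma> - u t) (u \<sigma> - u t)" by simp
    then show ?thesis
      by (simp add: power2_norm_eq_inner inner_diff_left inner_diff_right inner_commute)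
  qed
  then have "a ((norm (u \<sigma>))\<^sup>2) * ((norm (u \<sigma>))\<^sup>2 - (norm (u t))\<^sup>2) \<le> a ((norm (u \<sigma>))\<^sup>2) * (2 * inner (u \<sigma>) (u \<sigma> - u t))"
    by (rule mult_left_mono) (use a_ge[of "(norm (u \<sigma>))\<^sup>2"] m_pos in auto)
  then show "2 * weak_rhs a f lam h (u \<sigma>) (u \<sigma> - u t) \<le>
      2 * force (u \<sigma>) (u \<sigma> - u t) - a ((norm (u \<sigma>))\<^sup>2) * ((norm (u \<sigma>))\<^sup>2 - (norm (u t))\<^sup>2)"
    by (simp add: weak_rhs_eq algebra_simps)
qed

text \<open>\<open>M\<close> is the integral of the norm of the time derivative \<open>w\<close>.
  Pairing with the increment itself avoids integrals with values in \<open>L2\<close>.\<close>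

lemma L2_bounded_variation:
  assumes T: "0 < T"
  obtains M where "continuous_on {0..T} M"
    "\<And>s t. 0 \<le> s \<Longrightarrow> s \<le> t \<Longrightarrow> t \<le> T \<Longrightarrow> norm (L2_of (u t) - L2_of (u s)) \<le> M t - M s"
proof -
  obtain w where w: "L2_time T w" "\<And>v. primitive_on T (\<lambda>t. inner (L2_of (u t)) v) (\<lambda>t. inner (w t) v)"
    using u_sol T unfolding strong_solutions_iff by blast
  define M where "M t = integral {0..t} (\<lambda>t. norm (w t))" for t
  have i: "(\<lambda>t. norm (w t)) integrable_on {0..T}"
    using integral_lebesgue_on_Ioo_eq(2)[OF L2_time_integrable(1)[OF w(1)]]
    by (simp add: set_lebesgue_integral_eq_integral(1))
  show thesis
  proof (rule that)
    show "continuous_on {0..T} M" unfolding M_def by (rule indefinite_integral_continuous_1[OF i])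
    fix s t assume st: "0 \<le> s" "s \<le> t" "t \<le> T"
    let ?D = "L2_of (u t) - L2_of (u s)"
    have sub: "(\<lambda>t. norm (w t)) integrable_on {s..t}"
      by (rule integrable_on_subinterval[OF i]) (use st in auto)
    have "M s + integral {s..t} (\<lambda>t. norm (w t)) = M t" unfolding M_def
      by (rule Henstock_Kurzweil_Integration.integral_combine)
        (use st i in \<open>auto intro: integrable_on_subinterval\<close>)
    then have "integral {s..t} (\<lambda>t. norm (w t)) = M t - M s" by linarith
    then have hi: "((\<lambda>t. norm (w t) * norm ?D) has_integral (M t - M s) * norm ?D) {s..t}"
      using has_integral_mult_left[OF integrable_integral[OF sub]] by simp
    have hj: "((\<lambda>t. inner (w t) ?D) has_integral (inner (L2_of (u t)) ?D - inner (L2_of (u s)) ?D)) {s..t}"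
      using w(2)[of ?D] st by (simp add: primitive_on_def)
    have "inner (L2_of (u t)) ?D - inner (L2_of (u s)) ?D \<le> (M t - M s) * norm ?D"
      by (rule has_integral_le[OF hj hi]) (rule norm_cauchy_schwarz)
    then have "norm ?D * norm ?D \<le> (M t - M s) * norm ?D"
      by (simp only: inner_diff_left[symmetric] power2_norm_eq_inner[symmetric] power2_eq_square)
    moreover have "0 \<le> M t - M s"
      using has_integral_nonneg[OF integrable_integral[OF sub]] \<open>integral {s..t} (\<lambda>t. norm (w t)) = M t - M s\<close>
      by simp
    ultimately show "norm ?D \<le> M t - M s"
      by (cases "?D = 0") auto
  qed
qed

text \<open>The equation controls the squared \<open>H01\<close> norm from one side only: where it
  rises faster than \<open>C * M\<close>, diffusion outweighs the force. Then \<open>C * M\<close>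
  minus the squared norm is non-decreasing, so the squared norm is a difference of monotone
  functions.\<close>

lemma norm_sq_bounded_variation:
  assumes T: "0 < T"
  obtains V where "continuous_on {0..T} V"
    "\<And>s t. 0 \<le> s \<Longrightarrow> s \<le> t \<Longrightarrow> t \<le> T \<Longrightarrow> norm (L2_of (u t) - L2_of (u s)) \<le> V t - V s"
    "\<And>s t. 0 \<le> s \<Longrightarrow> s \<le> t \<Longrightarrow> t \<le> T \<Longrightarrow> \<bar>(norm (u t))\<^sup>2 - (norm (u s))\<^sup>2\<bar> \<le> V t - V s"
proof -
  obtain M where M: "continuous_on {0..T} M"
    "\<And>s t. 0 \<le> s \<Longrightarrow> s \<le> t \<Longrightarrow> t \<le> T \<Longrightarrow> norm (L2_of (u t) - L2_of (u s)) \<le> M t - M s"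
    by (rule L2_bounded_variation[OF T]) blast
  have Mm: "M s \<le> M t" if "0 \<le> s" "s \<le> t" "t \<le> T" for s t
    using order.trans[OF norm_ge_zero M(2)[OF that]] by simp
  let ?b = "\<lambda>t. \<bar>lam\<bar> * norm (nemytskii f (u t)) + norm h"
  have "continuous_on {0..T} ?b" by (intro continuous_intros) auto
  then obtain B where B: "\<And>r. r \<in> {0..T} \<Longrightarrow> ?b r \<le> B"
    by (rule continuous_on_Icc_le) blast
  have "0 \<le> ?b 0" by simp
  also have "\<dots> \<le> B" using B[of 0] T by simp
  finally have B0: "0 \<le> B" .
  \<comment> \<open>Chosen so that \<open>m * C\<close> exceeds \<open>2 * B\<close>, the bound on
    twice the force per unit of \<open>M\<close>.\<close>
  define C where "C = 2 * (B + 1) / m"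
  have C: "C \<ge> 0" "m * C = 2 * (B + 1)" using B0 m_pos by (auto simp: C_def)
  let ?y = "\<lambda>t. (norm (u t))\<^sup>2"
  \<comment> \<open>If \<open>C M - \<parallel>u\<parallel>\<^sup>2\<close> stayed below its value at \<open>q\<close>, the integrand in \<open>dist_sq_le\<close> would be negative.\<close>
  have up: "C * M s - ?y s \<le> C * M t - ?y t" if st: "0 \<le> s" "s \<le> t" "t \<le> T" for s t
  proof (rule le_if_no_last_record[OF st(2)])
    show "continuous_on {s..t} (\<lambda>t. C * M t - ?y t)"
      by (intro continuous_intros continuous_on_subset[OF M(1)]) (use st in auto)
    fix q assume q: "s \<le> q" "q < t"
    show "\<exists>r. q < r \<and> r \<le> t \<and> C * M q - ?y q \<le> C * M r - ?y r"
    proof (rule ccontr)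
      assume "\<not> ?thesis"
      then have less: "C * (M r - M q) < ?y r - ?y q" if "q < r" "r \<le> t" for r
        using that by (force simp: algebra_simps)
      let ?g = "\<lambda>\<sigma>. 2 * force (u \<sigma>) (u \<sigma> - u q) - a (?y \<sigma>) * (?y \<sigma> - ?y q)"
      have "integral {q..t} ?g < integral {q..t} (\<lambda>_. 0)"
      proof (rule integral_less_real)
        show "continuous_on {q..t} ?g"
          unfolding force_def by (intro continuous_intros continuous_on_L2_of) (use q st in auto)
        show "{q<..<t} \<noteq> {}" using q by (simp add: greaterThanLessThan_empty_iff)
        fix \<sigma> assume \<sigma>: "\<sigma> \<in> {q<..<t}"
        let ?d = "M \<sigma> - M q"
        have d: "0 \<le> ?d" "norm (L2_of (u \<sigma> - u q)) \<le> ?d"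
          using Mm[of q \<sigma>] M(2)[of q \<sigma>] \<sigma> q st by (auto simp: L2_of_simps)
        have "force (u \<sigma>) (u \<sigma> - u q) \<le> ?b \<sigma> * norm (L2_of (u \<sigma> - u q))" by (rule force_le)
        also have "\<dots> \<le> B * ?d"
          by (rule mult_mono[OF B d(2) B0]) (use \<sigma> q st in auto)
        finally have 1: "force (u \<sigma>) (u \<sigma> - u q) \<le> B * ?d" .
        have l: "C * ?d < ?y \<sigma> - ?y q" using less[of \<sigma>] \<sigma> by auto
        then have "m * (C * ?d) < m * (?y \<sigma> - ?y q)" using m_pos by simp
        moreover have "0 \<le> ?y \<sigma> - ?y q"
          using l mult_nonneg_nonneg[OF C(1) d(1)] by linarith
        then have "m * (?y \<sigma> - ?y q) \<le> a (?y \<sigma>) * (?y \<sigma> - ?y q)"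
          by (intro mult_right_mono a_ge) auto
        ultimately have "m * (C * ?d) < a (?y \<sigma>) * (?y \<sigma> - ?y q)" by (rule less_le_trans)
        moreover have "m * (C * ?d) = 2 * (B * ?d) + 2 * ?d"
          by (simp only: mult.assoc[symmetric] C(2)) (simp add: algebra_simps)
        moreover have "2 * force (u \<sigma>) (u \<sigma> - u q) \<le> 2 * (B * ?d) + 2 * ?d"
        proof -
          have "2 * x \<le> 2 * y + 2 * z" if "x \<le> y" "0 \<le> z" for x y z :: real
            using that by linarith
          then show ?thesis using 1 d(1) by blast
        qed
        ultimately have "2 * force (u \<sigma>) (u \<sigma> - u q) < a (?y \<sigma>) * (?y \<sigma> - ?y q)" by (simp only: le_less_trans)
        then show "?g \<sigma> < 0" by simp
      qed auto
      moreover have "0 \<le> integral {q..t} ?g"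
        by (rule order.trans[OF _ dist_sq_le]) (use q st in auto)
      ultimately show False by simp
    qed
  qed
  show thesis
  \<comment> \<open>The increment of this function is \<open>2 * C + 1\<close> times that of
    \<open>M\<close> minus that of the squared norm, where the latter is at most \<open>C\<close>
    times that of \<open>M\<close>. One copy of \<open>C * M\<close> pays for a rise of the norm, a
    fall counts in full, and the extra \<open>M\<close> covers the \<open>L2\<close>
    distance.\<close>
  proof (rule that[of "\<lambda>t. (2 * C + 1) * M t - ?y t"])
    show "continuous_on {0..T} (\<lambda>t. (2 * C + 1) * M t - ?y t)"
      by (intro continuous_intros M(1)) auto
    fix s t assume st: "0 \<le> s" "s \<le> t" "t \<le> T"
    have 1: "?y t - ?y s \<le> C * (M t - M s)" using up[OF st] by (simp add: algebra_simps)
    have 2: "0 \<le> C * (M t - M s)" using C(1) Mm[OF st] by simp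
    have eq: "(2 * C + 1) * M t - ?y t - ((2 * C + 1) * M s - ?y s) =
      2 * (C * (M t - M s)) + (M t - M s) - (?y t - ?y s)" by (simp add: algebra_simps)
    show "norm (L2_of (u t) - L2_of (u s)) \<le> (2 * C + 1) * M t - ?y t - ((2 * C + 1) * M s - ?y s)"
      unfolding eq using 1 2 M(2)[OF st] by linarith
    show "\<bar>?y t - ?y s\<bar> \<le> (2 * C + 1) * M t - ?y t - ((2 * C + 1) * M s - ?y s)"
      unfolding eq using 1 2 Mm[OF st] by linarith
  qed
qed

text \<open>The quotient in the energy inequality is replaced by its minorant
  \<open>2 (D, v) - (T - s) \<parallel>v\<parallel>\<^sup>2\<close>, with
  \<open>D = u(T) - u(s)\<close> and \<open>v\<close> fixed. Unlike the quotient it is additive over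
  adjacent intervals, so local comparisons suffice.\<close>

lemma energy_inequality_linearized:
  assumes sT: "0 \<le> s" "s \<le> T"
  shows "energy (u T) + 2 * inner (L2_of (u T) - L2_of (u s)) (L2_of v) \<le>
    energy (u s) + (T - s) * (norm (L2_of v))\<^sup>2"
proof (cases "s = T")
  case False
  with sT have T: "0 < T" by simp
  obtain V where V: "continuous_on {0..T} V"
    "\<And>s t. 0 \<le> s \<Longrightarrow> s \<le> t \<Longrightarrow> t \<le> T \<Longrightarrow> norm (L2_of (u t) - L2_of (u s)) \<le> V t - V s"
    "\<And>s t. 0 \<le> s \<Longrightarrow> s \<le> t \<Longrightarrow> t \<le> T \<Longrightarrow> \<bar>(norm (u t))\<^sup>2 - (norm (u s))\<^sup>2\<bar> \<le> V t - V s"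
    by (rule norm_sq_bounded_variation[OF T]) blast
  let ?y = "\<lambda>t. (norm (u t))\<^sup>2" and ?p = "\<lambda>t. inner (L2_of (u t)) (L2_of v)"
  let ?G = "\<lambda>u. lam * potential F u + inner h (L2_of u)"
  let ?K = "\<lambda>e t. t * (norm (L2_of v))\<^sup>2 - energy (u t) - 2 * ?p t + e * (2 * V t + t)"
  \<comment> \<open>The terms with \<open>e\<close> absorb the first-order errors: \<open>V\<close> dominates the increments of \<open>u\<close> in \<open>L\<^sup>2\<close> and
    of \<open>\<parallel>u\<parallel>\<^sup>2\<close>, and \<open>e * t\<close> the error in linearizing \<open>(u(r) - u(t), v)\<close>. If \<open>K\<close> stayed below its value at \<open>t\<close>,
    integrating over \<open>[t, r1]\<close> would contradict \<open>dist_sq_le\<close> and \<open>\<parallel>D\<parallel>\<^sup>2 \<ge> 2 \<delta> (D, v) - \<delta>\<^sup>2 \<parallel>v\<parallel>\<^sup>2\<close>.\<close>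
  have main: "?K e s \<le> ?K e T" if e: "e > 0" for e
  proof (rule le_if_no_last_record[OF sT(2)])
    show "continuous_on {s..T} (?K e)"
      by (intro continuous_intros continuous_on_compose2[OF continuous_on_energy[of UNIV]]
          continuous_on_L2_of continuous_on_subset[OF V(1)]) (use sT in auto)
    fix t assume t: "s \<le> t" "t < T"
    then have t0: "0 \<le> t" using sT by simp
    show "\<exists>r. t < r \<and> r \<le> T \<and> ?K e t \<le> ?K e r"
    proof (rule ccontr)
      assume "\<not> ?thesis"
      then have less: "?K e r < ?K e t" if "t < r" "r \<le> T" for r
        using that by force
      obtain d1 where d1: "d1 > 0" "\<And>x. x \<ge> 0 \<Longrightarrow> \<bar>x - ?y t\<bar> < d1 \<Longrightarrow>
          \<bar>Ahat x - Ahat (?y t) - a x * (x - ?y t)\<bar> \<le> e * \<bar>x - ?y t\<bar>"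
        by (rule Ahat_first_order[of "?y t" e]) (use e in auto)
      \<comment> \<open>After multiplication by \<open>\<bar>lam\<bar>\<close> the error of the
        potential is at most \<open>e\<close> times the \<open>L2\<close> distance.\<close>
      have el: "e / (\<bar>lam\<bar> + 1) > 0" using e by simp
      obtain d2 where d2: "d2 > 0" "\<And>u' v w :: H01. norm u' \<le> norm (u t) + 1 \<Longrightarrow> norm v \<le> norm (u t) + 1 \<Longrightarrow>
          norm w \<le> norm (u t) + 1 \<Longrightarrow> norm (v - u') < d2 \<Longrightarrow> norm (w - u') < d2 \<Longrightarrow>
          \<bar>potential F v - potential F u' - inner (nemytskii f w) (L2_of v - L2_of u')\<bar> \<le>
            e / (\<bar>lam\<bar> + 1) * norm (L2_of v - L2_of u')"
        by (rule potential_first_order[OF f_cont F_deriv el, where R = "norm (u t) + 1"]) blast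
      define c where "c = weak_rhs a f lam h (u t) v"
      have lims: "((\<lambda>r. ?y r) \<longlongrightarrow> ?y t) (at t within {0..T})" "(u \<longlongrightarrow> u t) (at t within {0..T})"
        "((\<lambda>r. (?p r - ?p t) / (r - t)) \<longlongrightarrow> c) (at t within {0..T})"
        using u_cont_Icc[of 0 T] t t0 pairing_has_derivative[of t T v]
        by (auto intro!: tendsto_intros simp: continuous_on_def c_def has_field_derivative_iff)
      have e8: "e / 8 > 0" using e by simp
      have "\<forall>\<^sub>F r in at t within {0..T}. dist (?y r) (?y t) < d1 \<and> dist (u r) (u t) < min 1 d2 \<and>
          dist ((?p r - ?p t) / (r - t)) c < e / 8"
        by (intro eventually_conj tendstoD[OF lims(1)] tendstoD[OF lims(2)] tendstoD[OF lims(3)] e8 d1)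
          (use d2(1) in auto)
      then obtain d where d: "d > 0" "\<And>r. r \<in> {0..T} \<Longrightarrow> r \<noteq> t \<Longrightarrow> \<bar>r - t\<bar> < d \<Longrightarrow> dist (?y r) (?y t) < d1 \<and>
          dist (u r) (u t) < min 1 d2 \<and> dist ((?p r - ?p t) / (r - t)) c < e / 8"
        unfolding eventually_at dist_real_def by blast
      define r1 where "r1 = min T (t + d / 2)"
      have r1: "t < r1" "r1 \<le> T" "r1 - t < d" using d(1) t by (auto simp: r1_def)
      \<comment> \<open>Twice the inequality \<open>?K e r < ?K e t\<close>, divided by
        \<open>r - t\<close>: the pairing gives \<open>4 * c\<close>, the term with \<open>v\<close>
        gives \<open>- 2 * (norm (L2_of v))\<^sup>2\<close>, and \<open>e * t\<close> gives
        \<open>- 2 * e\<close>, of which \<open>e / 2\<close> is lost to the error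
        \<open>e / 8\<close> in the slope of the pairing. The doubled \<open>V\<close> absorbs the
        errors of \<open>Ahat\<close> and of the potential.\<close>
      let ?k = "4 * c - 2 * (norm (L2_of v))\<^sup>2 - 3 / 2 * e"
      let ?g = "\<lambda>\<sigma>. 2 * force (u \<sigma>) (u \<sigma> - u t) - a (?y \<sigma>) * (?y \<sigma> - ?y t)"
      have near: "\<bar>?p r - ?p t - c * (r - t)\<bar> \<le> e / 8 * (r - t)" if r: "t < r" "r \<le> r1" for r
      proof -
        have "\<bar>(?p r - ?p t) / (r - t) - c\<bar> \<le> e / 8"
          using d(2)[of r] r r1 t0 by (auto simp: dist_real_def)
        then have "\<bar>(?p r - ?p t) / (r - t) - c\<bar> * (r - t) \<le> e / 8 * (r - t)"
          by (rule mult_right_mono) (use r in simp)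
        moreover have "\<bar>(?p r - ?p t) / (r - t) - c\<bar> * (r - t) = \<bar>((?p r - ?p t) / (r - t) - c) * (r - t)\<bar>"
          using r by (simp add: abs_mult)
        moreover have "((?p r - ?p t) / (r - t) - c) * (r - t) = ?p r - ?p t - c * (r - t)"
          using r by (simp only: left_diff_distrib) simp
        ultimately show ?thesis by simp
      qed
      have g_le: "?g r \<le> ?k * (r - t)" if r: "r \<in> {t..r1}" for r
      proof (cases "r = t")
        case True
        then show ?thesis by (simp add: force_def L2_of_simps)
      next
        case False
        then have rt: "t < r" "r \<le> r1" "r \<le> T" using r r1 by auto
        let ?D = "L2_of (u r) - L2_of (u t)"
        have dr: "\<bar>?y r - ?y t\<bar> < d1" "norm (u r - u t) < 1" "norm (u r - u t) < d2"
          using d(2)[of r] rt r1 t0 by (auto simp: dist_real_def dist_norm)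
        have nr: "norm (u r) \<le> norm (u t) + 1"
          using dr(2) norm_triangle_ineq2[of "u r" "u t"] by linarith
        have A: "Ahat (?y r) - Ahat (?y t) \<le> a (?y r) * (?y r - ?y t) + e * \<bar>?y r - ?y t\<bar>"
          using d1(2)[of "?y r"] dr(1) by (simp add: abs_le_iff)
        have "\<bar>potential F (u r) - potential F (u t) - inner (nemytskii f (u r)) ?D\<bar> \<le> e / (\<bar>lam\<bar> + 1) * norm ?D"
          by (rule d2(2)) (use dr nr in auto)
        then have "\<bar>lam\<bar> * \<bar>potential F (u r) - potential F (u t) - inner (nemytskii f (u r)) ?D\<bar> \<le>
            \<bar>lam\<bar> * (e / (\<bar>lam\<bar> + 1) * norm ?D)" by (rule mult_left_mono) simp
        also have "\<dots> = (\<bar>lam\<bar> / (\<bar>lam\<bar> + 1)) * (e * norm ?D)" by simp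
        also have "\<dots> \<le> 1 * (e * norm ?D)"
          by (rule mult_right_mono) (use e in \<open>auto simp: divide_le_eq_1\<close>)
        finally have "\<bar>lam * (potential F (u r) - potential F (u t) - inner (nemytskii f (u r)) ?D)\<bar> \<le> e * norm ?D"
          by (simp only: abs_mult mult_1)
        moreover have "?G (u r) - ?G (u t) - force (u r) (u r - u t) =
            lam * (potential F (u r) - potential F (u t) - inner (nemytskii f (u r)) ?D)"
          by (simp add: force_def L2_of_simps inner_diff_right right_diff_distrib)
        ultimately have B: "force (u r) (u r - u t) - e * norm ?D \<le> ?G (u r) - ?G (u t)"
          by linarith
        have arith: "2 * fo - ay \<le> k"
          if "Kr < Kt" "Kr - Kt = rN - dA / 2 + dG - 2 * dp + 2 * eV + er" "k = 4 * cr - 2 * rN - 3 / 2 * er"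
            "dp \<le> cr + 1 / 8 * er" "eD \<le> eV" "eY \<le> eV" "0 \<le> eY" "dA \<le> ay + eY" "fo - eD \<le> dG"
          for fo ay k Kr Kt rN dA dG dp eV er cr eD eY :: real
          using that by linarith
        show ?thesis
        proof (rule arith[OF less[OF rt(1,3)] _ _ _ _ _ _ A B])
          show "?K e r - ?K e t = (r - t) * (norm (L2_of v))\<^sup>2 - (Ahat (?y r) - Ahat (?y t)) / 2
            + (?G (u r) - ?G (u t)) - 2 * (?p r - ?p t) + 2 * (e * (V r - V t)) + e * (r - t)"
            by (simp add: energy_def algebra_simps diff_divide_distrib)
          show "?k * (r - t) = 4 * (c * (r - t)) - 2 * ((r - t) * (norm (L2_of v))\<^sup>2) - 3 / 2 * (e * (r - t))"
            by (simp add: algebra_simps)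
          show "?p r - ?p t \<le> c * (r - t) + 1 / 8 * (e * (r - t))"
            using abs_le_D1[OF near[OF rt(1,2)]] by simp
        qed (use V(2,3)[of t r] rt t0 e in auto)
      qed
      let ?\<delta> = "r1 - t" and ?D = "L2_of (u r1) - L2_of (u t)"
      have hk: "((\<lambda>r. ?k * (r - t)) has_integral (?k / 2 * ?\<delta>\<^sup>2 - ?k / 2 * (t - t)\<^sup>2)) {t..r1}"
        by (rule fundamental_theorem_of_calculus)
          (use r1 in \<open>auto simp: has_real_derivative_iff_has_vector_derivative[symmetric] intro!: derivative_eq_intros\<close>)
      have ig: "?g integrable_on {t..r1}"
        unfolding force_def by (intro integrable_continuous_real continuous_intros continuous_on_L2_of t0)
      have "(norm ?D)\<^sup>2 \<le> integral {t..r1} ?g"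
        by (rule dist_sq_le) (use t0 r1 in auto)
      also have "\<dots> \<le> ?k / 2 * ?\<delta>\<^sup>2 - ?k / 2 * (t - t)\<^sup>2"
        by (rule has_integral_le[OF integrable_integral[OF ig] hk]) (rule g_le)
      finally have up: "(norm ?D)\<^sup>2 \<le> (2 * c - (norm (L2_of v))\<^sup>2) * ?\<delta>\<^sup>2 - 3 / 4 * (e * ?\<delta>\<^sup>2)"
        by (simp add: algebra_simps)
      \<comment> \<open>Expanding this square bounds \<open>(norm ?D)\<^sup>2\<close> below with an
        error \<open>e / 4\<close> times \<open>?\<delta>\<^sup>2\<close>, whereas \<open>up\<close>
        has gained \<open>3 / 4\<close> of \<open>e * ?\<delta>\<^sup>2\<close>; the two are
        incompatible.\<close>
      have "0 \<le> (norm (?D - ?\<delta> *\<^sub>R L2_of v))\<^sup>2" by simp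
      also have "\<dots> = (norm ?D)\<^sup>2 - 2 * (?\<delta> * inner ?D (L2_of v)) + (norm (L2_of v))\<^sup>2 * ?\<delta>\<^sup>2"
      proof -
        have "(norm (x - k *\<^sub>R z))\<^sup>2 = (norm x)\<^sup>2 - 2 * (k * inner x z) + (norm z)\<^sup>2 * k\<^sup>2" for x z :: L2 and k
          unfolding power2_norm_eq_inner
          by (simp add: inner_diff_left inner_diff_right inner_commute[of z x] power2_eq_square algebra_simps)
        then show ?thesis .
      qed
      finally have low: "2 * (?\<delta> * inner ?D (L2_of v)) - (norm (L2_of v))\<^sup>2 * ?\<delta>\<^sup>2 \<le> (norm ?D)\<^sup>2" by linarith
      have "c * ?\<delta> - e / 8 * ?\<delta> \<le> inner ?D (L2_of v)"
        using abs_le_D2[OF near[of r1]] r1 by (simp add: inner_diff_left)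
      then have "?\<delta> * (c * ?\<delta> - e / 8 * ?\<delta>) \<le> ?\<delta> * inner ?D (L2_of v)"
        by (rule mult_left_mono) (use r1 in simp)
      moreover have "k * (c * k - e / 8 * k) = c * k\<^sup>2 - 1 / 8 * (e * k\<^sup>2)" for k
        by (simp add: power2_eq_square algebra_simps)
      from this[of ?\<delta>] have "?\<delta> * (c * ?\<delta> - e / 8 * ?\<delta>) = c * ?\<delta>\<^sup>2 - 1 / 8 * (e * ?\<delta>\<^sup>2)" .
      moreover have "(2 * c - (norm (L2_of v))\<^sup>2) * ?\<delta>\<^sup>2 = 2 * (c * ?\<delta>\<^sup>2) - (norm (L2_of v))\<^sup>2 * ?\<delta>\<^sup>2"
        by (simp add: left_diff_distrib)
      moreover have "0 < e * ?\<delta>\<^sup>2" using e r1 by simp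
      ultimately show False using up low by linarith
    qed
  qed
  have "energy (u T) + 2 * inner (L2_of (u T) - L2_of (u s)) (L2_of v) \<le>
    energy (u s) + (T - s) * (norm (L2_of v))\<^sup>2 + e'" if e': "e' > 0" for e'
  proof -
    \<comment> \<open>The total weight of the \<open>e\<close> terms over \<open>{s..T}\<close>, so
      that \<open>e' / ?W\<close> costs exactly \<open>e'\<close>.\<close>
    let ?W = "2 * (V T - V s) + (T - s)"
    have W: "?W > 0" using order.trans[OF norm_ge_zero V(2)[OF sT]] sT False by simp
    then have "e' / ?W > 0" using e' by simp
    from main[OF this] have "energy (u T) + 2 * inner (L2_of (u T) - L2_of (u s)) (L2_of v) \<le>
        energy (u s) + (T - s) * (norm (L2_of v))\<^sup>2 + e' / ?W * ?W"
      by (simp only: inner_diff_left left_diff_distrib right_diff_distrib distrib_left)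
    then show ?thesis using W by simp
  qed
  then show ?thesis by (rule field_le_epsilon)
qed simp

text \<open>The mean velocity is the \<open>v\<close> for which the linearized bound is
  sharpest.\<close>

lemma energy_inequality:
  assumes "0 \<le> s" "s < T"
  shows "energy (u T) + (norm (L2_of (u T) - L2_of (u s)))\<^sup>2 / (T - s) \<le> energy (u s)"
proof -
  let ?D = "L2_of (u T) - L2_of (u s)" and ?v = "(1 / (T - s)) *\<^sub>R (u T - u s)"
  have v: "L2_of ?v = (1 / (T - s)) *\<^sub>R ?D" by (simp only: L2_of_simps)
  have "inner ?D (L2_of ?v) = (norm ?D)\<^sup>2 / (T - s)"
    by (simp only: v inner_scaleR_right power2_norm_eq_inner) simp
  moreover have "(T - s) * (norm (L2_of ?v))\<^sup>2 = (norm ?D)\<^sup>2 / (T - s)"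
    using assms(2) by (simp only: v norm_scaleR power_mult_distrib) (simp add: power2_eq_square)
  ultimately show ?thesis
    using energy_inequality_linearized[of s T ?v] assms by linarith
qed

end

section \<open>Trajectories and the attractor\<close>

lemma L2_time_cong: "(\<And>t. 0 < t \<Longrightarrow> w t = w' t) \<Longrightarrow> L2_time T w = L2_time T w'"
  unfolding L2_time_def
  by (intro arg_cong2[of _ _ _ _ "(\<and>)"] measurable_cong Bochner_Integration.integrable_cong) auto

lemma primitive_on_cong:
  "(\<And>t. 0 \<le> t \<Longrightarrow> \<phi> t = \<phi>' t) \<Longrightarrow> (\<And>t. 0 \<le> t \<Longrightarrow> \<psi> t = \<psi>' t) \<Longrightarrow> primitive_on T \<phi> \<psi> = primitive_on T \<phi>' \<psi>'"
  unfolding primitive_on_def by (intro all_cong1 imp_cong refl) (auto intro!: has_integral_cong)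

lemma set_dist_eq_0_imp_mem:
  assumes "closed A" "set_dist x A = 0"
  shows "x \<in> A"
proof -
  have "x \<in> closure A"
    unfolding closure_approachable
  proof (intro allI impI)
    fix e :: real assume "e > 0"
    then have "(INF y\<in>A. ennreal (dist x y)) < ennreal e"
      using assms(2) by (simp add: set_dist_def)
    then obtain y where "y \<in> A" "ennreal (dist x y) < ennreal e" by (auto simp: INF_less_iff)
    then show "\<exists>y\<in>A. dist y x < e" by (auto simp: ennreal_less_iff dist_commute)
  qed
  then show ?thesis using assms(1) by simp
qed

lemma set_dist_less_imp:
  assumes "set_dist x A < ennreal e" "e > 0"
  obtains y where "y \<in> A" "dist x y < e"
  using assms that by (auto simp: set_dist_def INF_less_iff ennreal_less_iff)

text \<open>A point reached from \<open>B\<close> at all large times has a distance to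
  \<open>A\<close> below a quantity tending to 0, and \<open>A\<close> is closed.\<close>

lemma global_attractor_contains:
  assumes A: "global_attractor G A" and "bounded B"
    and x: "eventually (\<lambda>t. x \<in> (\<Union>u0\<in>B. G t u0)) at_top"
  shows "x \<in> A"
proof -
  have "((\<lambda>t. Hausdorff_semidist (\<Union>u0\<in>B. G t u0) A) \<longlongrightarrow> 0) at_top"
    using A \<open>bounded B\<close> by (simp add: global_attractor_def)
  moreover have "\<forall>\<^sub>F t in at_top. set_dist x A \<le> Hausdorff_semidist (\<Union>u0\<in>B. G t u0) A"
    using x by eventually_elim (auto simp: Hausdorff_semidist_def intro: SUP_upper)
  ultimately have "set_dist x A \<le> 0"
    by (intro tendsto_lowerbound) auto
  then show ?thesis
    using A by (intro set_dist_eq_0_imp_mem) (auto simp: global_attractor_def compact_imp_closed)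
qed

lemma antimono_bounded_converges:
  fixes e :: "real \<Rightarrow> real"
  assumes mono: "\<And>s t. s \<le> t \<Longrightarrow> e t \<le> e s" and b: "\<And>t. \<bar>e t\<bar> \<le> B"
  obtains L where "(e \<longlongrightarrow> L) at_top"
proof -
  have bdd: "bdd_below (range e)" 
  proof (rule bdd_belowI2)
    show "- B \<le> e t" for t using abs_le_D2[OF b[of t]] by simp
  qed
  have "(e \<longlongrightarrow> Inf (range e)) at_top"
  proof (rule order_tendstoI)
    fix c assume "c < Inf (range e)"
    moreover have "Inf (range e) \<le> e t" for t by (rule cInf_lower[OF _ bdd]) simp
    ultimately show "\<forall>\<^sub>F t in at_top. c < e t" by (intro always_eventually) (auto intro: less_le_trans)
  next
    fix c assume "Inf (range e) < c"
    then obtain t0 where "e t0 < c" using cInf_less_iff[OF _ bdd] by auto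
    then have "e t < c" if "t0 \<le> t" for t using mono[OF that] by simp
    then show "\<forall>\<^sub>F t in at_top. e t < c" by (auto simp: eventually_at_top_linorder)
  qed
  then show thesis by (rule that)
qed

text \<open>A bounded monotone function converges at both ends. The reflection
  \<open>- e (- t)\<close> is again non-increasing and carries the claim from plus to minus
  infinity.\<close>

lemma antimono_bounded_increment:
  fixes e :: "real \<Rightarrow> real"
  assumes mono: "\<And>s t. s \<le> t \<Longrightarrow> e t \<le> e s" and b: "\<And>t. \<bar>e t\<bar> \<le> B"
  shows "((\<lambda>t. e t - e (t + 1)) \<longlongrightarrow> 0) at_top" "((\<lambda>t. e t - e (t + 1)) \<longlongrightarrow> 0) at_bot"
proof -
  obtain L where L: "(e \<longlongrightarrow> L) at_top" by (rule antimono_bounded_converges[OF mono b])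
  have shift: "filterlim (\<lambda>t::real. t + c) at_top at_top" for c
    unfolding filterlim_at_top
  proof
    fix Z :: real
    show "\<forall>\<^sub>F t in at_top. Z \<le> t + c" using eventually_ge_at_top[of "Z - c"] by eventually_elim simp
  qed
  have "((\<lambda>t. e t - e (t + 1)) \<longlongrightarrow> L - L) at_top"
    by (rule tendsto_diff[OF L filterlim_compose[OF L shift]])
  then show "((\<lambda>t. e t - e (t + 1)) \<longlongrightarrow> 0) at_top" by simp
  obtain L' where L': "((\<lambda>t. - e (- t)) \<longlongrightarrow> L') at_top"
    by (rule antimono_bounded_converges[of "\<lambda>t. - e (- t)" B]) (use mono b in auto)
  have "((\<lambda>t. - e (- (t + - 1)) - - e (- t)) \<longlongrightarrow> L' - L') at_top"
    by (rule tendsto_diff[OF filterlim_compose[OF L' shift] L'])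
  then show "((\<lambda>t. e t - e (t + 1)) \<longlongrightarrow> 0) at_bot"
    unfolding filterlim_at_bot_mirror by (simp add: add.commute)
qed

section \<open>Complete trajectories inside an invariant set\<close>

context continuous_coefficients
begin

text \<open>Solutions are total functions with arbitrary values at negative times, so pieces of a
  trajectory coincide with given solutions only on \<open>{0..}\<close>.\<close>

lemma strong_solutions_cong:
  assumes u: "u \<in> strong_solutions a f lam h" and eq: "\<And>t. 0 \<le> t \<Longrightarrow> u' t = u t"
  shows "u' \<in> strong_solutions a f lam h"
proof -
  have 1: "continuous_on {0..} u' = continuous_on {0..} u"
    by (rule continuous_on_cong) (use eq in auto)
  have 2: "(AE t in lebesgue_on {0<..<T}. L2_of (u' t) \<in> H2) = (AE t in lebesgue_on {0<..<T}. L2_of (u t) \<in> H2)" for T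
    by (rule AE_cong) (use eq in auto)
  have 3: "L2_time T (\<lambda>t. weak_deriv (H01_deriv (u' t))) = L2_time T (\<lambda>t. weak_deriv (H01_deriv (u t)))" for T
    by (rule L2_time_cong) (use eq in auto)
  have 4: "primitive_on T (\<lambda>t. inner (L2_of (u' t)) v) (\<psi> u') = primitive_on T (\<lambda>t. inner (L2_of (u t)) v) (\<psi> u)"
    if "\<And>t. 0 \<le> t \<Longrightarrow> \<psi> u' t = \<psi> u t" for T v and \<psi> :: "(real \<Rightarrow> H01) \<Rightarrow> real \<Rightarrow> real"
    by (rule primitive_on_cong) (use eq that in auto)
  have 5: "primitive_on T (\<lambda>t. inner (L2_of (u' t)) v) (\<lambda>t. inner (w t) v) = primitive_on T (\<lambda>t. inner (L2_of (u t)) v) (\<lambda>t. inner (w t) v)"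
    for T v w by (rule 4[of "\<lambda>_ t. inner (w t) v"]) simp
  have 6: "primitive_on T (\<lambda>t. inner (L2_of (u' t)) (L2_of v)) (\<lambda>t. weak_rhs a f lam h (u' t) v) =
    primitive_on T (\<lambda>t. inner (L2_of (u t)) (L2_of v)) (\<lambda>t. weak_rhs a f lam h (u t) v)"
    for T v by (rule 4[of "\<lambda>u t. weak_rhs a f lam h (u t) v"]) (simp add: eq)
  show ?thesis
    using u unfolding strong_solutions_iff 1 2 3 5 6 .
qed

text \<open>Invariance lets every point of \<open>A\<close> be reached from \<open>A\<close> in one
  unit of time. Prolonging a solution backwards unit by unit gives solutions \<open>V n\<close>, to
  be read as starting at time \<open>- n\<close>; they agree wherever they overlap.\<close>

lemma complete_trajectory_through:
  assumes inv: "\<And>t. 0 \<le> t \<Longrightarrow> A = (\<Union>u0\<in>A. semiflow (strong_solutions a f lam h) t u0)" and z: "z \<in> A"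
  obtains \<gamma> where "\<gamma> \<in> complete_trajectories (strong_solutions a f lam h)" "\<gamma> 0 = z" "range \<gamma> \<subseteq> A"
proof -
  let ?S = "strong_solutions a f lam h"
  have stay: "u t \<in> A" if "u \<in> ?S" "u 0 \<in> A" "0 \<le> t" for u t
    using equalityD2[OF inv[OF that(3)]] that(1,2) unfolding semiflow_def by blast
  obtain u0 where u0: "u0 \<in> ?S" "u0 0 = z"
    using subsetD[OF equalityD1[OF inv] z, of 0] unfolding semiflow_def by auto
  have "\<exists>V. \<forall>n. (V n \<in> ?S \<and> V n 0 \<in> A \<and> (n = 0 \<longrightarrow> V n 0 = z)) \<and> (\<forall>t\<ge>1. V (Suc n) t = V n (t - 1))"
  proof (rule dependent_nat_choice)
    show "\<exists>x. x \<in> ?S \<and> x 0 \<in> A \<and> (0 = (0::nat) \<longrightarrow> x 0 = z)"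
      using u0 z by blast
    fix v and n :: nat assume v: "v \<in> ?S \<and> v 0 \<in> A \<and> (n = 0 \<longrightarrow> v 0 = z)"
    then obtain w where w: "w \<in> ?S" "w 0 \<in> A" "w 1 = v 0"
      using subsetD[OF equalityD1[OF inv], of 1 "v 0"] unfolding semiflow_def by auto
    let ?v = "\<lambda>t. if t \<le> 1 then w t else v (t - 1)"
    have "?v \<in> ?S" by (rule strong_solutions_glue) (use w v in auto)
    moreover have "\<forall>t\<ge>1. ?v t = v (t - 1)" using w(3) by auto
    ultimately show "\<exists>v'. (v' \<in> ?S \<and> v' 0 \<in> A \<and> (Suc n = 0 \<longrightarrow> v' 0 = z)) \<and> (\<forall>t\<ge>1. v' t = v (t - 1))"
      using w(2) by (intro exI[of _ ?v]) auto
  qed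
  then obtain V where V: "\<And>n. V n \<in> ?S" "\<And>n. V n 0 \<in> A" "V 0 0 = z" "\<And>n t. t \<ge> 1 \<Longrightarrow> V (Suc n) t = V n (t - 1)"
    by blast
  have shift: "V (n + k) (t + real k) = V n t" if "0 \<le> t" for n k t
  proof (induction k)
    case (Suc k)
    have "V (n + Suc k) (t + real (Suc k)) = V (n + k) (t + real (Suc k) - 1)"
      using V(4)[of "t + real (Suc k)" "n + k"] that by simp
    then show ?case using Suc by (simp add: algebra_simps)
  qed simp
  \<comment> \<open>The least \<open>n\<close> for which \<open>V n\<close> is already running at
    time \<open>t\<close>.\<close>
  define N where "N t = nat \<lceil>- t\<rceil>" for t :: real
  have N: "0 \<le> t + real (N t)" for t unfolding N_def by linarith
  define \<gamma> where "\<gamma> t = V (N t) (t + real (N t))" for t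
  have \<gamma>: "\<gamma> t = V n (t + real n)" if n: "0 \<le> t + real n" for t n
  proof (cases "N t \<le> n")
    case True
    then obtain k where "n = N t + k" by (auto simp: le_iff_add)
    then show ?thesis using shift[OF N[of t], of "N t" k] by (simp add: \<gamma>_def algebra_simps)
  next
    case False
    then obtain k where "N t = n + k" by (metis le_iff_add nat_le_linear)
    then show ?thesis using shift[OF n, of n k] by (simp add: \<gamma>_def algebra_simps)
  qed
  have "(\<lambda>t. \<gamma> (t + s)) \<in> ?S" for s
  proof (rule strong_solutions_cong[OF strong_solutions_shift[OF V(1) N]])
    fix t :: real assume "0 \<le> t"
    then show "\<gamma> (t + s) = V (N s) (t + (s + real (N s)))"
      using \<gamma>[of "t + s" "N s"] N[of s] by (simp add: add.assoc)
  qed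
  then have "\<gamma> \<in> complete_trajectories ?S" by (simp add: complete_trajectories_def)
  moreover have "\<gamma> 0 = z" using \<gamma>[of 0 0] V(3) by simp
  moreover have "\<gamma> t \<in> A" for t
    unfolding \<gamma>_def by (rule stay[OF V(1,2) N])
  ultimately show thesis by (intro that[of \<gamma>]) auto
qed

end

section \<open>Limits of trajectories and the structure of the attractor\<close>

context energy_setting
begin

text \<open>A vanishing energy loss over the unit interval after \<open>X n\<close> makes the
  trajectory nearly constant there in \<open>L2\<close>. The mean value theorem finds a time in that
  interval at which \<open>weak_rhs\<close> equals the small increment of the pairing, and
  \<open>weak_rhs\<close> is continuous in \<open>H01\<close>.\<close>

lemma limit_point_stationary:
  assumes A: "compact A" and \<gamma>: "\<gamma> \<in> complete_trajectories (strong_solutions a f lam h)" "\<And>t. \<gamma> t \<in> A"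
    and X: "(\<lambda>n. energy (\<gamma> (X n)) - energy (\<gamma> (X n + 1))) \<longlonglongrightarrow> 0"
    and y: "(\<lambda>n. \<gamma> (X n)) \<longlonglongrightarrow> y"
  shows "y \<in> stationary_points a f lam h"
proof (rule weak_rhs_zero_imp_stationary)
  have yA: "y \<in> A"
    using closed_sequentially[OF compact_imp_closed[OF A] _ y] \<gamma>(2) by blast
  have sol: "strong_solution a f lam h m F Ahat (\<lambda>t. \<gamma> (t + r))" for r
    by unfold_locales (use \<gamma>(1) in \<open>auto simp: complete_trajectories_def\<close>)
  let ?\<eta> = "\<lambda>n. energy (\<gamma> (X n)) - energy (\<gamma> (X n + 1))"
  have close: "norm (L2_of (\<gamma> (X n + r)) - L2_of (\<gamma> (X n))) \<le> sqrt (?\<eta> n)" if r: "0 < r" "r \<le> 1" for n r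
  proof -
    have 1: "energy (\<gamma> (X n + r)) + (norm (L2_of (\<gamma> (X n + r)) - L2_of (\<gamma> (X n))))\<^sup>2 / r \<le> energy (\<gamma> (X n))"
      using strong_solution.energy_inequality[OF sol[of "X n"], of 0 r] r by (simp add: add.commute)
    have 2: "energy (\<gamma> (X n + 1)) \<le> energy (\<gamma> (X n + r))"
    proof (cases "r = 1")
      case False
      then have "energy (\<gamma> (X n + 1)) + (norm (L2_of (\<gamma> (X n + 1)) - L2_of (\<gamma> (X n + r))))\<^sup>2 / (1 - r) \<le> energy (\<gamma> (X n + r))"
        using strong_solution.energy_inequality[OF sol[of "X n"], of r 1] r by (simp add: add.commute)
      moreover have "0 \<le> (norm (L2_of (\<gamma> (X n + 1)) - L2_of (\<gamma> (X n + r))))\<^sup>2 / (1 - r)" using r by simp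
      ultimately show ?thesis by linarith
    qed simp
    have "(norm (L2_of (\<gamma> (X n + r)) - L2_of (\<gamma> (X n))))\<^sup>2 \<le> (norm (L2_of (\<gamma> (X n + r)) - L2_of (\<gamma> (X n))))\<^sup>2 / r"
      using r by (simp add: le_divide_eq mult_left_le)
    also have "\<dots> \<le> ?\<eta> n" using 1 2 by linarith
    finally show ?thesis by (rule real_le_rsqrt)
  qed
  have sq0: "(\<lambda>n. sqrt (?\<eta> n)) \<longlonglongrightarrow> 0" using tendsto_real_sqrt[OF X] by simp
  fix v :: H01
  have "\<exists>s. \<forall>n. s n \<in> {0<..<1} \<and> inner (L2_of (\<gamma> (X n + 1))) (L2_of v) - inner (L2_of (\<gamma> (X n))) (L2_of v) =
      weak_rhs a f lam h (\<gamma> (X n + s n)) v"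
  proof (rule choice, rule allI)
    fix n
    let ?q = "\<lambda>t. inner (L2_of (\<gamma> (t + X n))) (L2_of v)"
    have "\<exists>x\<in>{0<..<1}. ?q 1 - ?q 0 = (\<lambda>d. weak_rhs a f lam h (\<gamma> (x + X n)) v * d) (1 - 0)"
      by (rule mvt_simple)
        (use strong_solution.pairing_has_derivative[OF sol[of "X n"], of _ 1 v] in \<open>auto simp: has_field_derivative_def\<close>)
    then show "\<exists>s. s \<in> {0<..<1} \<and> inner (L2_of (\<gamma> (X n + 1))) (L2_of v) - inner (L2_of (\<gamma> (X n))) (L2_of v) =
      weak_rhs a f lam h (\<gamma> (X n + s)) v" by (auto simp: add.commute)
  qed
  then obtain s where s: "\<And>n. 0 < s n" "\<And>n. s n < 1"
    "\<And>n. inner (L2_of (\<gamma> (X n + 1))) (L2_of v) - inner (L2_of (\<gamma> (X n))) (L2_of v) = weak_rhs a f lam h (\<gamma> (X n + s n)) v"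
    by auto
  have "(\<lambda>n. L2_of (\<gamma> (X n + s n)) - L2_of (\<gamma> (X n))) \<longlonglongrightarrow> 0"
    by (rule Lim_null_comparison[OF always_eventually sq0]) (use close s less_imp_le in blast)
  from tendsto_add[OF this bounded_linear.tendsto[OF bounded_linear_L2_of y]]
  have L2: "(\<lambda>n. L2_of (\<gamma> (X n + s n))) \<longlonglongrightarrow> L2_of y" by simp
  \<comment> \<open>A continuous injection of the compact set \<open>A\<close> has a continuous
    inverse, which upgrades \<open>L2\<close> convergence to convergence in
    \<open>H01\<close>.\<close>
  have "continuous_on (L2_of ` A) H01_of"
    by (rule continuous_on_inv[OF continuous_on_L2_of[OF continuous_on_id] A]) (simp add: L2_of_inverse)
  from continuous_on_tendsto_compose[OF this L2] have "(\<lambda>n. \<gamma> (X n + s n)) \<longlonglongrightarrow> y"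
    using yA \<gamma>(2) by (simp add: L2_of_inverse)
  then have "(\<lambda>n. weak_rhs a f lam h (\<gamma> (X n + s n)) v) \<longlonglongrightarrow> weak_rhs a f lam h y v"
    using continuous_on_weak_rhs[OF continuous_on_id continuous_on_const, of UNIV v]
    by (auto intro: continuous_on_tendsto_compose)
  moreover have "(\<lambda>n. weak_rhs a f lam h (\<gamma> (X n + s n)) v) \<longlonglongrightarrow> 0"
  proof (rule Lim_null_comparison)
    show "(\<lambda>n. sqrt (?\<eta> n) * norm (L2_of v)) \<longlonglongrightarrow> 0"
      using tendsto_mult_right[OF sq0, of "norm (L2_of v)"] by simp
    show "\<forall>\<^sub>F n in sequentially. norm (weak_rhs a f lam h (\<gamma> (X n + s n)) v) \<le> sqrt (?\<eta> n) * norm (L2_of v)"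
    proof (intro always_eventually allI)
      fix n
      have "norm (weak_rhs a f lam h (\<gamma> (X n + s n)) v) = \<bar>inner (L2_of (\<gamma> (X n + 1)) - L2_of (\<gamma> (X n))) (L2_of v)\<bar>"
        using s(3)[of n] by (simp add: inner_diff_left)
      also have "\<dots> \<le> sqrt (?\<eta> n) * norm (L2_of v)"
        by (rule order.trans[OF Cauchy_Schwarz_ineq2 mult_right_mono[OF close]]) auto
      finally show "norm (weak_rhs a f lam h (\<gamma> (X n + s n)) v) \<le> sqrt (?\<eta> n) * norm (L2_of v)" .
    qed
  qed
  ultimately show "weak_rhs a f lam h y v = 0" by (rule LIMSEQ_unique)
next
  show "0 < a ((norm y)\<^sup>2)" using a_ge[of "(norm y)\<^sup>2"] m_pos by simp
qed

lemma trajectory_approaches_stationary_points: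
  assumes A: "compact A" and \<gamma>: "\<gamma> \<in> complete_trajectories (strong_solutions a f lam h)" "range \<gamma> \<subseteq> A"
  shows "((\<lambda>t. set_dist (\<gamma> t) (stationary_points a f lam h)) \<longlongrightarrow> 0) at_top"
    "((\<lambda>t. set_dist (\<gamma> t) (stationary_points a f lam h)) \<longlongrightarrow> 0) at_bot"
proof -
  let ?Z = "stationary_points a f lam h" and ?e = "\<lambda>t. energy (\<gamma> t)"
  have \<gamma>A: "\<gamma> t \<in> A" for t using \<gamma>(2) by blast
  have mono: "?e t \<le> ?e s" if "s \<le> t" for s t
  proof (cases "s = t")
    case False
    then have st: "0 < t - s" using that by simp
    interpret strong_solution a f lam h m F Ahat "\<lambda>r. \<gamma> (r + s)"
      by unfold_locales (use \<gamma>(1) in \<open>auto simp: complete_trajectories_def\<close>)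
    have "0 \<le> (norm (L2_of (\<gamma> t) - L2_of (\<gamma> s)))\<^sup>2 / (t - s)" using st by simp
    moreover have "energy (\<gamma> t) + (norm (L2_of (\<gamma> t) - L2_of (\<gamma> s)))\<^sup>2 / (t - s) \<le> energy (\<gamma> s)"
      using energy_inequality[of 0 "t - s"] st by simp
    ultimately show ?thesis by linarith
  qed simp
  have "bounded (energy ` A)"
    by (intro compact_imp_bounded compact_continuous_image continuous_on_energy A)
  then obtain B where "\<And>x. x \<in> A \<Longrightarrow> \<bar>energy x\<bar> \<le> B" by (auto simp: bounded_iff)
  then have B: "\<bar>?e t\<bar> \<le> B" for t using \<gamma>A by blast
  note inc = antimono_bounded_increment[of ?e B, OF mono B]
  \<comment> \<open>Both limits reduce to sequences of times. If the distances failed to tend to 0,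
    compactness of \<open>A\<close> would give a subsequence bounded away from the stationary points
    whose limit is stationary.\<close>
  have seq: "(\<lambda>n. set_dist (\<gamma> (X n)) ?Z) \<longlonglongrightarrow> 0" if X: "(\<lambda>n. ?e (X n) - ?e (X n + 1)) \<longlonglongrightarrow> 0" for X
  proof (rule order_tendstoI)
    fix c :: ennreal assume c: "0 < c"
    show "\<forall>\<^sub>F n in sequentially. set_dist (\<gamma> (X n)) ?Z < c"
    proof (rule ccontr)
      assume "\<not> ?thesis"
      then obtain r :: "nat \<Rightarrow> nat" where r: "strict_mono r" "\<And>n. \<not> set_dist (\<gamma> (X (r n))) ?Z < c"
        using not_eventually_sequentiallyD[of "\<lambda>n. set_dist (\<gamma> (X n)) ?Z < c"] by blast
      obtain y q where y: "strict_mono (q :: nat \<Rightarrow> nat)" "((\<lambda>n. \<gamma> (X (r n))) \<circ> q) \<longlonglongrightarrow> y"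
        using A \<gamma>A unfolding compact_def by meson
      have lim: "(\<lambda>n. \<gamma> (X (r (q n)))) \<longlonglongrightarrow> y" using y(2) by (simp add: o_def)
      have "(\<lambda>n. ?e (X (r (q n))) - ?e (X (r (q n)) + 1)) \<longlonglongrightarrow> 0"
        using LIMSEQ_subseq_LIMSEQ[OF X strict_mono_o[OF r(1) y(1)]] by (simp add: o_def)
      then have yZ: "y \<in> ?Z"
        by (rule limit_point_stationary[OF A \<gamma>(1) \<gamma>A _ lim])
      have "(\<lambda>n. ennreal (dist (\<gamma> (X (r (q n)))) y)) \<longlonglongrightarrow> ennreal 0"
        by (intro tendsto_ennrealI) (use lim in \<open>simp add: tendsto_dist_iff[symmetric]\<close>)
      then have "\<forall>\<^sub>F n in sequentially. ennreal (dist (\<gamma> (X (r (q n)))) y) < c"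
        using c by (intro order_tendstoD) auto
      then obtain n where "ennreal (dist (\<gamma> (X (r (q n)))) y) < c"
        by (auto simp: eventually_sequentially)
      moreover have "set_dist (\<gamma> (X (r (q n)))) ?Z \<le> ennreal (dist (\<gamma> (X (r (q n)))) y)"
        unfolding set_dist_def by (rule INF_lower[OF yZ])
      ultimately show False using r(2)[of "q n"] by simp
    qed
  qed simp
  show "((\<lambda>t. set_dist (\<gamma> t) ?Z) \<longlongrightarrow> 0) at_top"
    by (rule tendsto_at_topI_sequentially, rule seq, rule filterlim_compose[OF inc(1)])
  show "((\<lambda>t. set_dist (\<gamma> t) ?Z) \<longlongrightarrow> 0) at_bot"
    by (rule tendsto_at_botI_sequentially, rule seq, rule filterlim_compose[OF inc(2)])
qed

lemma attractor_eq_unstable_stable_sets: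
  assumes A: "global_attractor (semiflow (strong_solutions a f lam h)) A"
  shows "A = M_plus (strong_solutions a f lam h) (stationary_points a f lam h)"
    "A = M_minus (strong_solutions a f lam h) (stationary_points a f lam h)"
proof -
  let ?S = "strong_solutions a f lam h" and ?Z = "stationary_points a f lam h"
  have cA: "compact A" and inv: "\<And>t. 0 \<le> t \<Longrightarrow> A = (\<Union>u0\<in>A. semiflow ?S t u0)"
    using A by (auto simp: global_attractor_def)
  have reach: "\<gamma> s \<in> semiflow ?S t (\<gamma> (s - t))" if "\<gamma> \<in> complete_trajectories ?S" for \<gamma> s t
  proof -
    have "(\<lambda>r. \<gamma> (r + (s - t))) \<in> ?S" using that by (simp add: complete_trajectories_def)
    then show ?thesis unfolding semiflow_def by (intro CollectI exI[of _ "\<lambda>r. \<gamma> (r + (s - t))"]) simp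
  qed
  \<comment> \<open>For every \<open>t \<ge> s - t0\<close> the point \<open>\<gamma> s\<close> is
    reached in time \<open>t\<close> from \<open>\<gamma> (s - t)\<close>, which lies in the bounded
    past.\<close>
  have past: "\<gamma> s \<in> A" if \<gamma>: "\<gamma> \<in> complete_trajectories ?S" and b: "bounded (\<gamma> ` {..t0})" for \<gamma> s t0
  proof (rule global_attractor_contains[OF A b])
    have "\<gamma> s \<in> (\<Union>u0\<in>\<gamma> ` {..t0}. semiflow ?S t u0)" if "s - t0 \<le> t" for t
      using reach[OF \<gamma>, of s t] that by (intro UN_I[of "\<gamma> (s - t)"]) auto
    then show "\<forall>\<^sub>F t in at_top. \<gamma> s \<in> (\<Union>u0\<in>\<gamma> ` {..t0}. semiflow ?S t u0)"
      by (auto simp: eventually_at_top_linorder)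
  qed
  have plus: "M_plus ?S ?Z \<subseteq> A"
  proof
    fix z assume "z \<in> M_plus ?S ?Z"
    then obtain \<gamma> where g: "\<gamma> \<in> complete_trajectories ?S" "bounded (range \<gamma>)" "\<gamma> 0 = z"
      by (auto simp: M_plus_def bounded_complete_trajectories_def)
    have "bounded (\<gamma> ` {..0})" by (rule bounded_subset[OF g(2)]) auto
    from past[OF g(1) this, of 0] show "z \<in> A" using g(3) by simp
  qed
  \<comment> \<open>Constant trajectories are bounded. Hence the stationary set is bounded, so a
    trajectory close to it near minus infinity has a bounded past.\<close>
  have ZA: "?Z \<subseteq> A"
  proof
    fix z assume "z \<in> ?Z"
    then have "(\<lambda>t. z) \<in> complete_trajectories ?S"
      using stationary_imp_strong_solution by (simp add: complete_trajectories_def)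
    then show "z \<in> A" by (rule past[of "\<lambda>t. z" 0 0]) (simp add: image_constant_conv)
  qed
  have minus: "M_minus ?S ?Z \<subseteq> A"
  proof
    fix z assume "z \<in> M_minus ?S ?Z"
    then obtain \<gamma> where g: "\<gamma> \<in> complete_trajectories ?S" "\<gamma> 0 = z"
      "((\<lambda>t. set_dist (\<gamma> t) ?Z) \<longlongrightarrow> 0) at_bot"
      by (auto simp: M_minus_def)
    from order_tendstoD(2)[OF g(3), of 1] obtain t0 where t0: "\<And>t. t \<le> t0 \<Longrightarrow> set_dist (\<gamma> t) ?Z < ennreal 1"
      by (auto simp: eventually_at_bot_linorder)
    obtain B where B: "\<And>x. x \<in> A \<Longrightarrow> norm x \<le> B"
      using compact_imp_bounded[OF cA] by (auto simp: bounded_iff)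
    have "norm (\<gamma> t) \<le> B + 1" if t: "t \<le> t0" for t
    proof -
      obtain y where y: "y \<in> ?Z" "dist (\<gamma> t) y < 1"
        by (rule set_dist_less_imp[OF t0[OF t]]) auto
      then have "norm y \<le> B" using B ZA by blast
      then show ?thesis using y(2) norm_triangle_ineq2[of "\<gamma> t" y] by (simp add: dist_norm)
    qed
    then have "bounded (\<gamma> ` {..t0})" by (auto simp: bounded_iff)
    from past[OF g(1) this, of 0] show "z \<in> A" using g(2) by simp
  qed
  have "A \<subseteq> M_plus ?S ?Z \<inter> M_minus ?S ?Z"
  proof
    fix z assume "z \<in> A"
    obtain \<gamma> where g: "\<gamma> \<in> complete_trajectories ?S" "\<gamma> 0 = z" "range \<gamma> \<subseteq> A"
      by (rule complete_trajectory_through[OF inv \<open>z \<in> A\<close>])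
    have "bounded (range \<gamma>)" by (rule bounded_subset[OF compact_imp_bounded[OF cA] g(3)])
    then show "z \<in> M_plus ?S ?Z \<inter> M_minus ?S ?Z"
      using g trajectory_approaches_stationary_points[OF cA g(1,3)]
      by (auto simp: M_plus_def M_minus_def bounded_complete_trajectories_def)
  qed
  then show "A = M_plus ?S ?Z" "A = M_minus ?S ?Z" using plus minus by auto
qed

end

theorem theorem17:
  fixes f a :: "real \<Rightarrow> real" and h :: L2 and A :: "H01 set"
    and lam p C1 C2 C3 C4 m :: real
  assumes lam: "lam > 0"
    and f_cont: "continuous_on UNIV f"
    and p: "p \<ge> 2"
    and C_pos: "C1 > 0" "C2 > 0" "C3 > 0" "C4 > 0"
    and f_growth: "\<And>u. \<bar>f u\<bar> \<le> C1 + C2 * \<bar>u\<bar> powr (p - 1)"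
    and f_dissip: "p > 2 \<Longrightarrow> \<forall>u. f u * u \<le> C3 - C4 * \<bar>u\<bar> powr p"
    and f_limsup: "p = 2 \<Longrightarrow> Limsup at_top (\<lambda>u. ereal (f u / u)) \<le> 0 \<and>
                             Limsup at_bot (\<lambda>u. ereal (f u / u)) \<le> 0"
    and a_cont: "continuous_on {0..} a"
    and m: "m > 0" "\<And>s. s \<ge> 0 \<Longrightarrow> a s \<ge> m"
    and a_bdd_or_mono: "(\<exists>M1>0. \<forall>s\<ge>0. a s \<le> M1) \<or> mono_on {0..} a"
    and attractor: "global_attractor (semiflow (strong_solutions a f lam h)) A"
  shows "A = M_plus (strong_solutions a f lam h) (stationary_points a f lam h) \<and>
         M_plus (strong_solutions a f lam h) (stationary_points a f lam h) =
         M_minus (strong_solutions a f lam h) (stationary_points a f lam h)"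
proof -
  obtain F where F: "\<And>x. (F has_field_derivative f x) (at x)"
    by (rule antiderivative_exists[OF f_cont]) blast
  have "continuous_on UNIV (\<lambda>x. a (max 0 x))"
    by (rule continuous_on_compose2[OF a_cont]) (auto intro!: continuous_intros)
  then obtain Ahat where Ahat: "\<And>x. (Ahat has_field_derivative a (max 0 x)) (at x)"
    by (rule antiderivative_exists) blast
  interpret energy_setting a f lam h m F Ahat
    by unfold_locales (fact f_cont a_cont m F Ahat)+
  show ?thesis
    using attractor_eq_unstable_stable_sets[OF attractor] by simp
qed

end
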